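(* Let $\Omega\subset\mathbb{R}^N$, $N\in\{2,3\}$, together with $\Gamma_M\subset\partial\Omega$, $\bar x$, $\varepsilon_0$, satisfy the geometric assumption of the context. For $i=1,2$ let $a_i,b_i,c_i$ satisfy the coefficient assumption of the context, and suppose that the solvability assumption of the context holds for these coefficients. For any $g\in G$ let $u_i(g)$ denote a weak solution of $$-\operatorname{div}\big(a_i(u)\nabla u+b_i(x,u)\big)+c_i(x,u,\nabla u)=0\ \text{ in }\Omega,\qquad u=g\ \text{ on }\partial\Omega,$$ and let $j_i(g)$ be the corresponding Neumann flux. Then $$a_1\not\equiv a_2\ \text{ on }(\underline g,\overline g)\ \Longrightarrow\ j_1(g)\not\equiv j_2(g)\ \text{ on }\Gamma_M\ \text{ for some }g\in G.$$ If, in addition, for $i=1,2$ and every $g\in G$ the weak solution $u_i(g)$ is unique and satisfies $\underline g\le u_i(g)\le\overline g$, and if $b_1\equiv b_2$ and $c_1\equiv c_2$, then the reverse implication holds as well.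
   Context: Fixed are real numbers $\underline g<\overline g$ and positive constants $C_A,C_G,\underline a,\overline a$. $B_r(y)$ is the open ball of radius $r$ about $y$; $n$ is the outward unit normal on $\partial\Omega$; $(\cdot,\cdot)_\Omega$ is the $L^2(\Omega)$ inner product. Geometric assumption: $\Omega\subset\mathbb{R}^N$, $N\in\{2,3\}$, is a bounded Lipschitz domain and $\Gamma_M'\subset\partial\Omega$ is an open smooth part of the boundary with $|\Gamma_M'|\neq0$; $\bar x\in\Gamma_M'$ and $\varepsilon_0>0$ are such that $B_{\varepsilon_0}(\bar x+\varepsilon_0 n(\bar x))\cap\Omega=\emptyset$ and $\Gamma_M:=B_{\varepsilon_0}(\bar x)\cap\partial\Omega\subset\Gamma_M'$. Moreover $\Gamma_M$ is flat: $n(x)=n(\bar x)=e_N$ (the $N$-th unit vector) for $x\in\Gamma_M$. Coefficient assumption: the functions $a=a(u)$, $b=b(x,u)\in\mathbb{R}^N$, $c=c(x,u,p)$ (with $x\in\Omega$, $u\in\mathbb{R}$, $p\in\mathbb{R}^N$) lie in $W^{1,\infty}$ of their respective domains with norm bounded by $C_A$, and $0<\underline a\le a\le\overline a$. Dirichlet data: $G=\{g\in H^1(\partial\Omega):\ \underline g\le g\le\overline g,\ \|g\|_{H^1(\partial\Omega)}\le C_G\}$, where $C_G$ is chosen so large that for all $\underline g\le g_1<g_2\le\overline g$ and all $0<\varepsilon\le\varepsilon_0$ the function $g_1+\gamma\varepsilon^{(3-N)/2}\chi^\varepsilon_{\bar x}$ on $\partial\Omega$ has $H^1(\partial\Omega)$-norm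 at most $C_G$; here $\gamma=(g_2-g_1)\min(1,\varepsilon_0^{(N-3)/2})$ and $\chi^\varepsilon_{\bar x}(x)=1$ for $|x-\bar x|\le\varepsilon/2$, $=2-2|x-\bar x|/\varepsilon$ for $\varepsilon/2<|x-\bar x|<\varepsilon$, $=0$ otherwise. Weak solution for coefficients $(a,b,c)$ and $g\in G$: a function $u\in H^1(\Omega)$ with $u=g$ on $\partial\Omega$ in the sense of traces and $(a(u)\nabla u+b(x,u),\nabla\varphi)_\Omega+(c(x,u,\nabla u),\varphi)_\Omega=0$ for all $\varphi\in H^1_0(\Omega)$. Solvability assumption: for $i=1,2$ and every $g\in G$ a weak solution for $(a_i,b_i,c_i)$ exists, and every such weak solution satisfies $\|u\|_{H^1(\Omega)}\le C_U$ with a constant $C_U$ independent of $i$ and of $g\in G$. Neumann flux: for a weak solution $u$, $j$ is the linear functional on $H^1(\Omega)$ given by $\langle j,\varphi\rangle_{\partial\Omega}=\int_\Omega a(u)\nabla u\cdot\nabla\varphi+b(x,u)\cdot\nabla\varphi+c(x,u,\nabla u)\varphi\,dx$. One says $j\equiv0$ on $\Gamma_M$ if $\langle j,\varphi\rangle_{\partial\Omega}=0$ for all $\varphi\in H^1(\Omega)$ with $\varphi=0$ on $\partial\Omega\setminus\Gamma_M$ in the sense of traces; $j_1\equiv j_2$ on $\Gamma_M$ means $j_1-j_2\equiv0$ on $\Gamma_M$. *)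

theory Defs
  imports "HOL-Analysis.Analysis"
begin

section \<open>Smooth functions, weak gradients and Sobolev spaces on open sets\<close>

primrec C_k :: "nat \<Rightarrow> ('a::euclidean_space \<Rightarrow> real) \<Rightarrow> bool" where
  "C_k 0 f \<longleftrightarrow> continuous_on UNIV f"
| "C_k (Suc k) f \<longleftrightarrow> (\<forall>x. f differentiable (at x)) \<and>
     (\<forall>i\<in>Basis. C_k k (\<lambda>x. frechet_derivative f (at x) i))"

definition smooth :: "('a::euclidean_space \<Rightarrow> real) \<Rightarrow> bool" where
  "smooth f \<longleftrightarrow> (\<forall>k. C_k k f)"

definition test_functions :: "'a::euclidean_space set \<Rightarrow> ('a \<Rightarrow> real) set" where
  "test_functions \<Omega> =
     {\<phi>. smooth \<phi> \<and> (\<exists>K. compact K \<and> K \<subseteq> \<Omega> \<and> (\<forall>x. x \<notin> K \<longrightarrow> \<phi> x = 0))}"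

definition locally_integrable ::
    "'a::euclidean_space set \<Rightarrow> ('a \<Rightarrow> 'b::euclidean_space) \<Rightarrow> bool" where
  "locally_integrable \<Omega> f \<longleftrightarrow> (\<forall>K. compact K \<and> K \<subseteq> \<Omega> \<longrightarrow> integrable (lebesgue_on K) f)"

definition weak_gradient ::
    "'a::euclidean_space set \<Rightarrow> ('a \<Rightarrow> real) \<Rightarrow> ('a \<Rightarrow> 'a) \<Rightarrow> bool" where
  "weak_gradient \<Omega> u D \<longleftrightarrow> locally_integrable \<Omega> u \<and> locally_integrable \<Omega> D \<and>
     (\<forall>\<phi>\<in>test_functions \<Omega>. \<forall>i\<in>Basis.
        (\<integral>x. u x * frechet_derivative \<phi> (at x) i \<partial>lebesgue_on \<Omega>)
          = - (\<integral>x. (D x \<bullet> i) * \<phi> x \<partial>lebesgue_on \<Omega>))"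

text \<open>Functions that coincide almost everywhere are not identified; the weak gradient is
  determined only up to a null set, and \<open>wgrad\<close> picks a representative.\<close>

definition wgrad :: "'a::euclidean_space set \<Rightarrow> ('a \<Rightarrow> real) \<Rightarrow> 'a \<Rightarrow> 'a" where
  "wgrad \<Omega> u = (SOME D. weak_gradient \<Omega> u D)"

definition square_integrable :: "'a measure \<Rightarrow> ('a \<Rightarrow> 'b::euclidean_space) \<Rightarrow> bool" where
  "square_integrable M f \<longleftrightarrow> f \<in> borel_measurable M \<and> integrable M (\<lambda>x. (norm (f x))\<^sup>2)"

definition L2_converges ::
    "'a measure \<Rightarrow> (nat \<Rightarrow> 'a \<Rightarrow> 'b::euclidean_space) \<Rightarrow> ('a \<Rightarrow> 'b) \<Rightarrow> bool" where
  "L2_converges M f g \<longleftrightarrow>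
     (\<lambda>m. \<integral>\<^sup>+x. ennreal ((norm (f m x - g x))\<^sup>2) \<partial>M) \<longlonglongrightarrow> 0"

definition H1 :: "'a::euclidean_space set \<Rightarrow> ('a \<Rightarrow> real) set" where
  "H1 \<Omega> = {u. square_integrable (lebesgue_on \<Omega>) u \<and>
     (\<exists>D. weak_gradient \<Omega> u D \<and> square_integrable (lebesgue_on \<Omega>) D)}"

definition H1_norm :: "'a::euclidean_space set \<Rightarrow> ('a \<Rightarrow> real) \<Rightarrow> real" where
  "H1_norm \<Omega> u = sqrt (\<integral>x. (u x)\<^sup>2 + (norm (wgrad \<Omega> u x))\<^sup>2 \<partial>lebesgue_on \<Omega>)"

definition H1_converges ::
    "'a::euclidean_space set \<Rightarrow> (nat \<Rightarrow> 'a \<Rightarrow> real) \<Rightarrow> ('a \<Rightarrow> real) \<Rightarrow> bool" where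
  "H1_converges \<Omega> f u \<longleftrightarrow> L2_converges (lebesgue_on \<Omega>) f u \<and>
     L2_converges (lebesgue_on \<Omega>) (\<lambda>m. wgrad \<Omega> (f m)) (wgrad \<Omega> u)"

definition H1_0 :: "'a::euclidean_space set \<Rightarrow> ('a \<Rightarrow> real) set" where
  "H1_0 \<Omega> = {u \<in> H1 \<Omega>. \<exists>\<phi>. (\<forall>m. \<phi> m \<in> test_functions \<Omega>) \<and> H1_converges \<Omega> \<phi> u}"

text \<open>Membership in \<open>W\<^sup>1\<^sup>,\<^sup>\<infinity>(D)\<close> with norm at most \<open>C\<close>, where the norm is the maximum of the
  essential suprema of the function and of its weak gradient. As usual the continuous
  representative is meant, so that compositions such as \<open>x \<mapsto> f (x, u x)\<close> with a measurable
  \<open>u\<close> do not depend on the choice of a representative of \<open>f\<close>.\<close>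

definition W1inf_bounded ::
    "'a::euclidean_space set \<Rightarrow> real \<Rightarrow> ('a \<Rightarrow> real) \<Rightarrow> bool" where
  "W1inf_bounded D C f \<longleftrightarrow> continuous_on D f \<and> (AE x in lebesgue_on D. \<bar>f x\<bar> \<le> C) \<and>
     (\<exists>F. weak_gradient D f F \<and> (AE x in lebesgue_on D. norm (F x) \<le> C))"


section \<open>Boundaries\<close>

text \<open>Near \<open>x\<close>, the set \<open>\<Omega>\<close> is the region below the graph of \<open>\<psi>\<close> over the hyperplane
  orthogonal to \<open>\<nu>\<close>; a function on that hyperplane is encoded as a function on the whole space
  that is constant in the direction \<open>\<nu>\<close>.\<close>

definition local_graph ::
    "'a::euclidean_space set \<Rightarrow> 'a \<Rightarrow> 'a \<Rightarrow> ('a \<Rightarrow> real) \<Rightarrow> bool" where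
  "local_graph \<Omega> x \<nu> \<psi> \<longleftrightarrow> norm \<nu> = 1 \<and> (\<forall>y t. \<psi> (y + t *\<^sub>R \<nu>) = \<psi> y) \<and>
     (\<exists>r>0. \<Omega> \<inter> ball x r = {y \<in> ball x r. y \<bullet> \<nu> < \<psi> y})"

definition bounded_lipschitz_domain :: "'a::euclidean_space set \<Rightarrow> bool" where
  "bounded_lipschitz_domain \<Omega> \<longleftrightarrow> open \<Omega> \<and> connected \<Omega> \<and> bounded \<Omega> \<and> \<Omega> \<noteq> {} \<and>
     (\<forall>x\<in>frontier \<Omega>. \<exists>\<nu> \<psi>. local_graph \<Omega> x \<nu> \<psi> \<and> (\<exists>L. L-lipschitz_on UNIV \<psi>))"

definition open_smooth_boundary_part :: "'a::euclidean_space set \<Rightarrow> 'a set \<Rightarrow> bool" where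
  "open_smooth_boundary_part \<Omega> \<Gamma> \<longleftrightarrow> openin (top_of_set (frontier \<Omega>)) \<Gamma> \<and>
     (\<forall>x\<in>\<Gamma>. \<exists>\<nu> \<psi>. local_graph \<Omega> x \<nu> \<psi> \<and> smooth \<psi>)"

text \<open>The outward unit normal is the normalised gradient of the local defining function
  \<open>y \<mapsto> y \<bullet> \<nu> - \<psi> y\<close>. It is independent of the graph representation. Where no graph
  representation is differentiable (a null set of the boundary of a Lipschitz domain) its value
  is arbitrary.\<close>

definition outer_normal :: "'a::euclidean_space set \<Rightarrow> 'a \<Rightarrow> 'a" where
  "outer_normal \<Omega> x =
     (SOME n. \<exists>\<nu> \<psi> d. local_graph \<Omega> x \<nu> \<psi> \<and> GDERIV \<psi> x :> d \<and> n = sgn (\<nu> - d))"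

text \<open>Hausdorff measure of dimension \<open>d \<ge> 1\<close>, normalised so as to agree with Lebesgue measure
  on \<open>d\<close>-dimensional planes. Boundedness of the covering sets is required because
  \<^const>\<open>diameter\<close> is meaningless for unbounded sets.\<close>

definition hausdorff_outer :: "nat \<Rightarrow> 'a::euclidean_space set \<Rightarrow> ennreal" where
  "hausdorff_outer d A = (SUP \<delta>\<in>{0::real<..}.
     INF U\<in>{U :: nat \<Rightarrow> 'a set. A \<subseteq> (\<Union>i. U i) \<and> (\<forall>i. bounded (U i) \<and> diameter (U i) \<le> \<delta>)}.
       (\<Sum>i. ennreal (unit_ball_vol (real d) * (diameter (U i) / 2) ^ d)))"

definition hausdorff_measure :: "nat \<Rightarrow> 'a::euclidean_space measure" where
  "hausdorff_measure d =
     measure_of UNIV (lambda_system UNIV (Pow UNIV) (hausdorff_outer d)) (hausdorff_outer d)"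

definition surface_measure :: "'a::euclidean_space set \<Rightarrow> 'a measure" where
  "surface_measure \<Omega> = restrict_space (hausdorff_measure (DIM('a) - 1)) (frontier \<Omega>)"

text \<open>Functions on the boundary are encoded as functions on the whole space, of which only the
  values on \<open>frontier \<Omega>\<close> matter. The trace operator is the continuous extension of the
  restriction \<open>\<phi> \<mapsto> \<phi>|\<^sub>\<partial>\<^sub>\<Omega>\<close> of smooth functions to \<open>H\<^sup>1(\<Omega>)\<close>; the following is its graph.\<close>

definition has_trace ::
    "'a::euclidean_space set \<Rightarrow> ('a \<Rightarrow> real) \<Rightarrow> ('a \<Rightarrow> real) \<Rightarrow> bool" where
  "has_trace \<Omega> u g \<longleftrightarrow> u \<in> H1 \<Omega> \<and> square_integrable (surface_measure \<Omega>) g \<and>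
     (\<exists>\<phi>. (\<forall>m. smooth (\<phi> m)) \<and> H1_converges \<Omega> \<phi> u \<and> L2_converges (surface_measure \<Omega>) \<phi> g)"

text \<open>The tangential gradient on the boundary, defined weakly by means of the tangential
  derivatives \<open>n\<^sub>i \<partial>\<^sub>j - n\<^sub>j \<partial>\<^sub>i\<close>: for smooth \<open>g\<close> and \<open>\<phi>\<close>, Stokes' theorem on the closed
  surface \<open>\<partial>\<Omega>\<close> says that the integral of \<open>(n\<^sub>i \<partial>\<^sub>j - n\<^sub>j \<partial>\<^sub>i) (g \<phi>)\<close> vanishes.\<close>

definition weak_tangential_gradient ::
    "'a::euclidean_space set \<Rightarrow> ('a \<Rightarrow> real) \<Rightarrow> ('a \<Rightarrow> 'a) \<Rightarrow> bool" where
  "weak_tangential_gradient \<Omega> g V \<longleftrightarrow> square_integrable (surface_measure \<Omega>) V \<and>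
     (AE x in surface_measure \<Omega>. V x \<bullet> outer_normal \<Omega> x = 0) \<and>
     (\<forall>\<phi>. smooth \<phi> \<longrightarrow> (\<forall>i\<in>Basis. \<forall>j\<in>Basis.
        (\<integral>x. g x * ((outer_normal \<Omega> x \<bullet> i) * frechet_derivative \<phi> (at x) j
                  - (outer_normal \<Omega> x \<bullet> j) * frechet_derivative \<phi> (at x) i) \<partial>surface_measure \<Omega>)
        = - (\<integral>x. ((outer_normal \<Omega> x \<bullet> i) * (V x \<bullet> j)
                  - (outer_normal \<Omega> x \<bullet> j) * (V x \<bullet> i)) * \<phi> x \<partial>surface_measure \<Omega>)))"

definition H1_boundary :: "'a::euclidean_space set \<Rightarrow> ('a \<Rightarrow> real) set" where
  "H1_boundary \<Omega> = {g. square_integrable (surface_measure \<Omega>) g \<and>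
     (\<exists>V. weak_tangential_gradient \<Omega> g V)}"

definition H1_boundary_norm :: "'a::euclidean_space set \<Rightarrow> ('a \<Rightarrow> real) \<Rightarrow> real" where
  "H1_boundary_norm \<Omega> g = sqrt (\<integral>x. (g x)\<^sup>2 +
     (norm ((SOME V. weak_tangential_gradient \<Omega> g V) x))\<^sup>2 \<partial>surface_measure \<Omega>)"


section \<open>The boundary value problem\<close>

definition geometric_assumption ::
    "(real^'n) set \<Rightarrow> (real^'n) set \<Rightarrow> real^'n \<Rightarrow> real \<Rightarrow> real^'n \<Rightarrow> bool" where
  "geometric_assumption \<Omega> \<Gamma>' xbar \<epsilon>0 e \<longleftrightarrow>
     bounded_lipschitz_domain \<Omega> \<and>
     \<Gamma>' \<subseteq> frontier \<Omega> \<and> open_smooth_boundary_part \<Omega> \<Gamma>' \<and>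
     emeasure (surface_measure \<Omega>) \<Gamma>' \<noteq> 0 \<and>
     xbar \<in> \<Gamma>' \<and> \<epsilon>0 > 0 \<and>
     ball (xbar + \<epsilon>0 *\<^sub>R outer_normal \<Omega> xbar) \<epsilon>0 \<inter> \<Omega> = {} \<and>
     ball xbar \<epsilon>0 \<inter> frontier \<Omega> \<subseteq> \<Gamma>' \<and>
     (\<forall>x \<in> ball xbar \<epsilon>0 \<inter> frontier \<Omega>. outer_normal \<Omega> x = e)"

text \<open>The vector-valued \<open>b\<close> is measured componentwise.\<close>

definition coefficient_assumption ::
    "(real^'n) set \<Rightarrow> real \<Rightarrow> real \<Rightarrow> real \<Rightarrow> (real \<Rightarrow> real) \<Rightarrow> (real^'n \<Rightarrow> real \<Rightarrow> real^'n) \<Rightarrow>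
     (real^'n \<Rightarrow> real \<Rightarrow> real^'n \<Rightarrow> real) \<Rightarrow> bool" where
  "coefficient_assumption \<Omega> C_A alo ahi a b c \<longleftrightarrow>
     W1inf_bounded UNIV C_A a \<and>
     (\<forall>i. W1inf_bounded (\<Omega> \<times> UNIV) C_A (\<lambda>(x, s). b x s $ i)) \<and>
     W1inf_bounded (\<Omega> \<times> UNIV \<times> UNIV) C_A (\<lambda>(x, s, p). c x s p) \<and>
     (\<forall>s. alo \<le> a s \<and> a s \<le> ahi)"

definition dirichlet_data :: "(real^'n) set \<Rightarrow> real \<Rightarrow> real \<Rightarrow> real \<Rightarrow> (real^'n \<Rightarrow> real) set" where
  "dirichlet_data \<Omega> glo ghi C_G =
     {g \<in> H1_boundary \<Omega>. (AE x in surface_measure \<Omega>. glo \<le> g x \<and> g x \<le> ghi) \<and>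
        H1_boundary_norm \<Omega> g \<le> C_G}"

definition cutoff :: "real^'n \<Rightarrow> real \<Rightarrow> real^'n \<Rightarrow> real" where
  "cutoff xbar \<epsilon> x =
     (if norm (x - xbar) \<le> \<epsilon> / 2 then 1
      else if norm (x - xbar) < \<epsilon> then 2 - 2 * norm (x - xbar) / \<epsilon>
      else 0)"

definition peak_data ::
    "real^'n \<Rightarrow> real \<Rightarrow> real \<Rightarrow> real \<Rightarrow> real \<Rightarrow> real^'n \<Rightarrow> real" where
  "peak_data xbar \<epsilon>0 g1 g2 \<epsilon> x =
     (let \<gamma> = (g2 - g1) * min 1 (\<epsilon>0 powr ((real CARD('n) - 3) / 2))
      in g1 + \<gamma> * \<epsilon> powr ((3 - real CARD('n)) / 2) * cutoff xbar \<epsilon> x)"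

definition large_enough :: "(real^'n) set \<Rightarrow> real^'n \<Rightarrow> real \<Rightarrow> real \<Rightarrow> real \<Rightarrow> real \<Rightarrow> bool" where
  "large_enough \<Omega> xbar \<epsilon>0 glo ghi C_G \<longleftrightarrow>
     (\<forall>g1 g2 \<epsilon>. glo \<le> g1 \<and> g1 < g2 \<and> g2 \<le> ghi \<and> 0 < \<epsilon> \<and> \<epsilon> \<le> \<epsilon>0 \<longrightarrow>
        peak_data xbar \<epsilon>0 g1 g2 \<epsilon> \<in> H1_boundary \<Omega> \<and>
        H1_boundary_norm \<Omega> (peak_data xbar \<epsilon>0 g1 g2 \<epsilon>) \<le> C_G)"

definition weak_solution ::
    "(real^'n) set \<Rightarrow> (real \<Rightarrow> real) \<Rightarrow> (real^'n \<Rightarrow> real \<Rightarrow> real^'n) \<Rightarrow>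
     (real^'n \<Rightarrow> real \<Rightarrow> real^'n \<Rightarrow> real) \<Rightarrow> (real^'n \<Rightarrow> real) \<Rightarrow> (real^'n \<Rightarrow> real) \<Rightarrow> bool" where
  "weak_solution \<Omega> a b c g u \<longleftrightarrow> u \<in> H1 \<Omega> \<and> has_trace \<Omega> u g \<and>
     (\<forall>\<phi>\<in>H1_0 \<Omega>.
        (\<integral>x. (a (u x) *\<^sub>R wgrad \<Omega> u x + b x (u x)) \<bullet> wgrad \<Omega> \<phi> x \<partial>lebesgue_on \<Omega>)
        + (\<integral>x. c x (u x) (wgrad \<Omega> u x) * \<phi> x \<partial>lebesgue_on \<Omega>) = 0)"

definition solvability_assumption ::
    "(real^'n) set \<Rightarrow> (real^'n \<Rightarrow> real) set \<Rightarrow> real \<Rightarrow> (real \<Rightarrow> real) \<Rightarrow>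
     (real^'n \<Rightarrow> real \<Rightarrow> real^'n) \<Rightarrow> (real^'n \<Rightarrow> real \<Rightarrow> real^'n \<Rightarrow> real) \<Rightarrow> bool" where
  "solvability_assumption \<Omega> G C_U a b c \<longleftrightarrow>
     (\<forall>g\<in>G. (\<exists>u. weak_solution \<Omega> a b c g u) \<and>
             (\<forall>u. weak_solution \<Omega> a b c g u \<longrightarrow> H1_norm \<Omega> u \<le> C_U))"

definition neumann_flux ::
    "(real^'n) set \<Rightarrow> (real \<Rightarrow> real) \<Rightarrow> (real^'n \<Rightarrow> real \<Rightarrow> real^'n) \<Rightarrow>
     (real^'n \<Rightarrow> real \<Rightarrow> real^'n \<Rightarrow> real) \<Rightarrow> (real^'n \<Rightarrow> real) \<Rightarrow> (real^'n \<Rightarrow> real) \<Rightarrow> real" where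
  "neumann_flux \<Omega> a b c u \<phi> =
     (\<integral>x. a (u x) * (wgrad \<Omega> u x \<bullet> wgrad \<Omega> \<phi> x) + b x (u x) \<bullet> wgrad \<Omega> \<phi> x
         + c x (u x) (wgrad \<Omega> u x) * \<phi> x \<partial>lebesgue_on \<Omega>)"

definition vanishes_on ::
    "(real^'n) set \<Rightarrow> (real^'n) set \<Rightarrow> ((real^'n \<Rightarrow> real) \<Rightarrow> real) \<Rightarrow> bool" where
  "vanishes_on \<Omega> \<Gamma> j \<longleftrightarrow>
     (\<forall>\<phi> t. \<phi> \<in> H1 \<Omega> \<and> has_trace \<Omega> \<phi> t \<and> (AE x in surface_measure \<Omega>. x \<notin> \<Gamma> \<longrightarrow> t x = 0)
        \<longrightarrow> j \<phi> = 0)"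

definition same_flux_on ::
    "(real^'n) set \<Rightarrow> (real^'n) set \<Rightarrow> ((real^'n \<Rightarrow> real) \<Rightarrow> real) \<Rightarrow>
     ((real^'n \<Rightarrow> real) \<Rightarrow> real) \<Rightarrow> bool" where
  "same_flux_on \<Omega> \<Gamma> j1 j2 \<longleftrightarrow> vanishes_on \<Omega> \<Gamma> (\<lambda>\<phi>. j1 \<phi> - j2 \<phi>)"

definition unique_bounded_solutions ::
    "(real^'n) set \<Rightarrow> (real^'n \<Rightarrow> real) set \<Rightarrow> real \<Rightarrow> real \<Rightarrow> (real \<Rightarrow> real) \<Rightarrow>
     (real^'n \<Rightarrow> real \<Rightarrow> real^'n) \<Rightarrow> (real^'n \<Rightarrow> real \<Rightarrow> real^'n \<Rightarrow> real) \<Rightarrow> bool" where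
  "unique_bounded_solutions \<Omega> G glo ghi a b c \<longleftrightarrow>
     (\<forall>g\<in>G. \<forall>u. weak_solution \<Omega> a b c g u \<longrightarrow>
        (\<forall>v. weak_solution \<Omega> a b c g v \<longrightarrow> (AE x in lebesgue_on \<Omega>. v x = u x)) \<and>
        (AE x in lebesgue_on \<Omega>. glo \<le> u x \<and> u x \<le> ghi))"

end

theory Submission
  imports Defs
begin

text \<open>Assume that all fluxes agree and that \<open>a1 > a2\<close> on an interval starting at \<open>s\<close>. Let
  \<open>A\<^sub>i\<close> be the antiderivative of \<open>a\<^sub>i\<close> that vanishes at \<open>s\<close>. For a test function \<open>\<phi>\<close>
  supported where the boundary is flat, the leading part of the flux difference is the integral of
  \<open>\<nabla> (A\<^sub>1 (u\<^sub>1) - A\<^sub>2 (u\<^sub>2)) \<bullet> \<nabla> \<phi>\<close>, which by Green's identity is the boundary integral of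
  \<open>(A\<^sub>1 - A\<^sub>2) (g) \<partial>\<^sub>n \<phi>\<close> up to a term with the Laplacian of \<open>\<phi>\<close>. Take the peak of width \<open>\<epsilon>\<close> at
  \<open>xbar\<close> over the base value \<open>s\<close> as Dirichlet data \<open>g\<close>, and for \<open>\<phi>\<close> a cut-off dipole potential with its pole outside the
  domain, at distance \<open>\<epsilon>\<close> from \<open>xbar\<close>. The boundary integral is then of order \<open>\<epsilon>\<close> to the power
  \<open>(1 - N) / 2\<close>, whereas all other terms are smaller by a positive power of \<open>\<epsilon>\<close>; they only involve
  the \<open>L\<^sup>2\<close> bound on the solutions and the bounds on the coefficients. For the converse, \<open>u\<^sub>1\<close>
  also solves the second problem, as its values stay in the range where \<open>a1 = a2\<close>.\<close>

section \<open>Smooth functions\<close>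

text \<open>The obstacle is that \<open>\<nabla> u\<close> is bounded in \<open>L\<^sup>2\<close>
  only, while \<open>\<nabla> \<phi>\<close> has \<open>L\<^sup>2\<close> norm of order
  \<open>\<epsilon> powr (- N / 2)\<close>, more than the boundary integral. So no derivative may
  stay on \<open>u\<close>. After integration by parts \<open>A (u)\<close> meets the Laplacian of
  \<open>\<phi>\<close>; the dipole is harmonic, so only terms containing derivatives of the cut-off
  survive there, and their \<open>L\<^sup>2\<close> norm is about
  \<open>\<epsilon> powr ((2 - N) / 2)\<close>. The terms with \<open>b\<close> and \<open>c\<close>
  have bounded coefficients and meet \<open>\<phi>\<close> and \<open>\<nabla> \<phi>\<close> in
  \<open>L\<^sup>1\<close>, where the growth is logarithmic;
  \<open>\<epsilon> powr (- 1 / 4)\<close> is a crude but sufficient substitute. The order of the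
  boundary integral is a product: the height \<open>\<epsilon> powr ((3 - N) / 2)\<close> of the
  peak, the largest that a bounded \<open>H\<^sup>1\<close> norm on the boundary permits; the size
  \<open>\<epsilon> powr (- N)\<close> of the normal derivative; the area
  \<open>\<epsilon> powr (N - 1)\<close> of the disc. Nothing cancels, since for
  \<open>N \<ge> 2\<close> the normal derivative is nonnegative on the whole peak. Off the peak the
  data equal \<open>s\<close>, where both antiderivatives vanish, so the sign of the normal
  derivative there is irrelevant.\<close>

abbreviation pd :: "'a::euclidean_space \<Rightarrow> ('a \<Rightarrow> real) \<Rightarrow> 'a \<Rightarrow> real" where
  "pd i f \<equiv> \<lambda>x. frechet_derivative f (at x) i"

lemma pd_eq: "(f has_derivative f') (at x) \<Longrightarrow> frechet_derivative f (at x) i = f' i"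
  by (metis frechet_derivative_at)

lemma C_k_differentiable: "C_k (Suc k) f \<Longrightarrow> f differentiable (at x)"
  by simp

lemma C_k_Suc_D: "C_k (Suc k) f \<Longrightarrow> C_k k f"
proof (induction k arbitrary: f)
  case 0
  then show ?case
    by (auto intro!: continuous_at_imp_continuous_on differentiable_imp_continuous_within)
next
  case (Suc k)
  then show ?case by (metis C_k.simps(2))
qed

lemma C_k_const: "C_k k (\<lambda>x. c)"
  by (induction k arbitrary: c) auto

lemma C_k_linear: "bounded_linear f \<Longrightarrow> C_k k f"
proof (cases k)
  case 0
  assume "bounded_linear f"
  then show ?thesis using 0 by (simp add: linear_continuous_on)
next
  case (Suc m)
  assume f: "bounded_linear f"
  have "(f has_derivative f) (at x)" for x
    using f by (rule bounded_linear_imp_has_derivative)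
  then have "pd i f = (\<lambda>x. f i)" and "f differentiable (at x)" for i x
    by (auto intro: pd_eq simp: differentiable_def)
  then show ?thesis using Suc by (simp add: C_k_const)
qed

lemma C_k_add: "C_k k f \<Longrightarrow> C_k k g \<Longrightarrow> C_k k (\<lambda>x. f x + g x)"
proof (induction k arbitrary: f g)
  case 0
  then show ?case by (auto intro: continuous_intros)
next
  case (Suc k)
  have "pd i (\<lambda>x. f x + g x) = (\<lambda>x. pd i f x + pd i g x)" for i
    using Suc.prems by (auto intro!: pd_eq derivative_intros simp: frechet_derivative_works[symmetric])
  then show ?case using Suc by auto
qed

lemma C_k_mult: "C_k k f \<Longrightarrow> C_k k g \<Longrightarrow> C_k k (\<lambda>x. f x * g x)"
proof (induction k arbitrary: f g)
  case 0
  then show ?case by (auto intro: continuous_intros)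
next
  case (Suc k)
  have "(f has_derivative frechet_derivative f (at x)) (at x)"
    "(g has_derivative frechet_derivative g (at x)) (at x)" for x
    using Suc.prems by (simp_all add: frechet_derivative_works[symmetric])
  note D = has_derivative_mult[OF this]
  have *: "pd i (\<lambda>x. f x * g x) = (\<lambda>x. f x * pd i g x + pd i f x * g x)" for i
    by (rule ext) (rule pd_eq[OF D])
  have "(\<lambda>x. f x * g x) differentiable at x" for x
    using D by (rule differentiableI)
  then show ?case using Suc.prems C_k_Suc_D[OF Suc.prems(1)] C_k_Suc_D[OF Suc.prems(2)]
    by (simp add: * C_k_add Suc.IH)
qed

text \<open>The induction on \<open>k\<close> works because the family \<open>F\<close> is closed
  under differentiation: each derivative is a linear combination of members, so the chain rule leads
  back to compositions \<open>F q (h x)\<close> with one degree of smoothness less to prove. It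
  serves real powers and the functions \<open>flat\<close>.\<close>

lemma C_k_family_compose:
  fixes F :: "'i \<Rightarrow> real \<Rightarrow> real" and h :: "'a::euclidean_space \<Rightarrow> real"
  assumes cont: "\<And>m. continuous_on T (F m)"
    and der: "\<And>m t. t \<in> T \<Longrightarrow> (F m has_real_derivative (\<Sum>l\<in>L m. c m l * F (q m l) t)) (at t)"
    and h: "C_k k h" and hT: "\<And>x. h x \<in> T"
  shows "C_k k (\<lambda>x. F m (h x))"
  using h
proof (induction k arbitrary: m)
  case 0
  then show ?case
    using cont hT by (auto intro: continuous_on_compose2)
next
  case (Suc k)
  have D: "((\<lambda>x. F m (h x)) has_derivative
      (\<lambda>i. (\<Sum>l\<in>L m. c m l * F (q m l) (h x)) * frechet_derivative h (at x) i)) (at x)" for x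
  proof -
    have "(F m has_derivative (\<lambda>t. (\<Sum>l\<in>L m. c m l * F (q m l) (h x)) * t)) (at (h x))"
      using der[OF hT] by (simp add: has_field_derivative_def)
    moreover have "(h has_derivative frechet_derivative h (at x)) (at x)"
      using Suc.prems frechet_derivative_works by auto
    ultimately show ?thesis
      using has_derivative_compose[of h "frechet_derivative h (at x)" x UNIV "F m"] by simp
  qed
  have S: "C_k k (\<lambda>x. \<Sum>l\<in>B. c m l * F (q m l) (h x))" if "finite B" for B
    using that
    by (induction B) (auto intro!: C_k_add C_k_mult C_k_const Suc.IH C_k_Suc_D[OF Suc.prems])
  have "C_k k (\<lambda>x. \<Sum>l\<in>L m. c m l * F (q m l) (h x))"
    using S C_k_const[of k 0] by (cases "finite (L m)") auto
  moreover have "pd i (\<lambda>x. F m (h x)) = (\<lambda>x. (\<Sum>l\<in>L m. c m l * F (q m l) (h x)) * pd i h x)" for i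
    using pd_eq[OF D] by auto
  ultimately show ?case
    using Suc.prems D by (auto intro!: C_k_mult simp: differentiable_def)
qed

lemma smooth_const [simp]: "smooth (\<lambda>x. c)"
  by (simp add: smooth_def C_k_const)

lemma smooth_linear: "bounded_linear f \<Longrightarrow> smooth f"
  by (simp add: smooth_def C_k_linear)

lemma smooth_inner [simp]: "smooth (\<lambda>x. x \<bullet> i)"
  by (rule smooth_linear) (rule bounded_linear_inner_left)

lemma smooth_add: "smooth f \<Longrightarrow> smooth g \<Longrightarrow> smooth (\<lambda>x. f x + g x)"
  by (simp add: smooth_def C_k_add)

lemma smooth_mult: "smooth f \<Longrightarrow> smooth g \<Longrightarrow> smooth (\<lambda>x. f x * g x)"
  by (simp add: smooth_def C_k_mult)

lemma smooth_diff: "smooth f \<Longrightarrow> smooth g \<Longrightarrow> smooth (\<lambda>x. f x - g x)"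
  using smooth_add[OF _ smooth_mult[OF smooth_const[of "-1"]], of f g] by simp

lemma smooth_prod: "(\<And>i. i \<in> I \<Longrightarrow> smooth (f i)) \<Longrightarrow> smooth (\<lambda>x. \<Prod>i\<in>I. f i x)"
  by (induction I rule: infinite_finite_induct) (auto intro: smooth_mult)

lemma smooth_sum: "(\<And>i. i \<in> I \<Longrightarrow> smooth (f i)) \<Longrightarrow> smooth (\<lambda>x. \<Sum>i\<in>I. f i x)"
  by (induction I rule: infinite_finite_induct) (auto intro: smooth_add)

lemma smooth_norm_sq: "smooth (\<lambda>x. (norm (x - a))\<^sup>2)"
proof -
  have "(\<lambda>x. (norm (x - a))\<^sup>2) = (\<lambda>x. \<Sum>i\<in>Basis. (x \<bullet> i - a \<bullet> i) * (x \<bullet> i - a \<bullet> i))"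
    by (simp only: fun_eq_iff power2_norm_eq_inner inner_diff_left[symmetric] euclidean_inner[of "_ - _" "_ - _"])
      simp
  then show ?thesis
    by (simp add: smooth_sum smooth_mult smooth_diff)
qed

lemma smooth_differentiable: "smooth f \<Longrightarrow> f differentiable (at x)"
  by (meson C_k_differentiable smooth_def)

lemma smooth_has_derivative: "smooth f \<Longrightarrow> (f has_derivative frechet_derivative f (at x)) (at x)"
  using frechet_derivative_works smooth_differentiable by blast

lemma smooth_pd: "smooth f \<Longrightarrow> i \<in> Basis \<Longrightarrow> smooth (pd i f)"
  unfolding smooth_def using C_k.simps(2) by blast

lemma smooth_continuous_on: "smooth f \<Longrightarrow> continuous_on S f"
  by (metis C_k.simps(1) continuous_on_subset smooth_def subset_UNIV)

lemma smooth_powr: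
  assumes "smooth h" "\<And>x. h x > 0"
  shows "smooth (\<lambda>x. h x powr m)"
  unfolding smooth_def
proof
  fix k
  show "C_k k (\<lambda>x. h x powr m)"
  proof (rule C_k_family_compose[where F = "\<lambda>m t. t powr m" and T = "{0<..}" and L = "\<lambda>_. {()}"
        and c = "\<lambda>m _. m" and q = "\<lambda>m _. m - 1"])
    show "C_k k h" using assms(1) by (simp add: smooth_def)
  qed (use assms(2) in \<open>auto intro!: continuous_intros derivative_eq_intros\<close>)
qed

section \<open>Functions vanishing to infinite order at the origin\<close>

text \<open>\<open>flat 0\<close> is the classical function exp(-1/t) extended by zero. The division
  by \<open>t ^ m\<close> yields a family closed under differentiation.\<close>

definition flat :: "nat \<Rightarrow> real \<Rightarrow> real" where
  "flat m t = (if t > 0 then exp (- 1 / t) / t ^ m else 0)"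

lemma flat_nonneg [simp]: "flat m t \<ge> 0"
  by (simp add: flat_def)

lemma flat_pos_iff [simp]: "flat m t > 0 \<longleftrightarrow> t > 0"
  by (simp add: flat_def)

lemma flat_nonpos [simp]: "t \<le> 0 \<Longrightarrow> flat m t = 0"
  by (simp add: flat_def)

text \<open>Since \<open>flat m 0 = 0\<close>, this is the difference quotient at 0. From the right,
  the substitution s = 1/t reduces it to a power divided by an exponential.\<close>

lemma flat_tendsto_0: "((\<lambda>t. flat m t / t) \<longlongrightarrow> 0) (at 0)"
proof (rule filterlim_split_at)
  show "((\<lambda>t. flat m t / t) \<longlongrightarrow> 0) (at_left 0)"
    by (rule tendsto_eventually) (auto simp: eventually_at_filter)
next
  have "((\<lambda>s. s ^ Suc m / exp s) \<longlongrightarrow> (0::real)) at_top"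
    by (rule tendsto_power_div_exp_0)
  then have "((\<lambda>t. (inverse t) ^ Suc m / exp (inverse t)) \<longlongrightarrow> (0::real)) (at_right 0)"
    by (rule filterlim_compose) (rule filterlim_inverse_at_top_right)
  then show "((\<lambda>t. flat m t / t) \<longlongrightarrow> 0) (at_right 0)"
    by (rule Lim_transform_eventually)
      (auto simp: eventually_at_filter flat_def exp_minus field_simps)
qed

lemma flat_has_derivative:
  "(flat m has_real_derivative (flat (Suc (Suc m)) t - m * flat (Suc m) t)) (at t)"
proof (cases t "0::real" rule: linorder_cases)
  case less
  have "((\<lambda>t. 0) has_real_derivative 0) (at t)" by simp
  then have "(flat m has_real_derivative 0) (at t)"
    by (rule has_field_derivative_transform_within_open[where S = "{..<0}"]) (use less in auto)
  then show ?thesis using less by simp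
next
  case equal
  show ?thesis
    using flat_tendsto_0[of m] equal by (simp add: DERIV_def)
next
  case greater
  have "((\<lambda>t. exp (- 1 / t) / t ^ m) has_real_derivative (flat (Suc (Suc m)) t - m * flat (Suc m) t)) (at t)"
    using greater
    by (auto intro!: derivative_eq_intros simp: flat_def field_simps power2_eq_square)
      (cases m; auto simp: field_simps)
  then show ?thesis
    by (rule has_field_derivative_transform_within_open[where S = "{0<..}"])
      (use greater in \<open>auto simp: flat_def\<close>)
qed

lemma smooth_flat:
  assumes "smooth h"
  shows "smooth (\<lambda>x. flat m (h x))"
  unfolding smooth_def
proof
  fix k
  show "C_k k (\<lambda>x. flat m (h x))"
  \<comment> \<open>The two values of type \<open>bool\<close> index the two summands of
    \<open>flat_has_derivative\<close>.\<close>
  proof (rule C_k_family_compose[where F = flat and T = UNIV and L = "\<lambda>_. UNIV :: bool set"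
        and c = "\<lambda>m b. if b then 1 else - real m" and q = "\<lambda>m b. if b then Suc (Suc m) else Suc m"])
    show "C_k k h" using assms by (simp add: smooth_def)
    show "continuous_on UNIV (flat m)" for m
      using flat_has_derivative DERIV_isCont by (blast intro: continuous_at_imp_continuous_on)
  qed (use flat_has_derivative in \<open>auto simp: UNIV_bool\<close>)
qed

section \<open>Hausdorff measures\<close>

text \<open>The expression under the supremum in \<open>hausdorff_outer\<close>, isolated so that
  covering arguments can be carried out at a fixed scale.\<close>

definition hausdorff_pre :: "nat \<Rightarrow> real \<Rightarrow> 'a::euclidean_space set \<Rightarrow> ennreal" where
  "hausdorff_pre d \<delta> A =
     (INF U\<in>{U :: nat \<Rightarrow> 'a set. A \<subseteq> (\<Union>i. U i) \<and> (\<forall>i. bounded (U i) \<and> diameter (U i) \<le> \<delta>)}.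
       (\<Sum>i. ennreal (unit_ball_vol (real d) * (diameter (U i) / 2) ^ d)))"

lemma hausdorff_outer_pre: "hausdorff_outer d A = (SUP \<delta>\<in>{0<..}. hausdorff_pre d \<delta> A)"
  by (simp add: hausdorff_outer_def hausdorff_pre_def)

lemma hausdorff_pre_le:
  assumes "A \<subseteq> (\<Union>i. U i)" "\<And>i. bounded (U i)" "\<And>i. diameter (U i) \<le> \<delta>"
  shows "hausdorff_pre d \<delta> A \<le> (\<Sum>i. ennreal (unit_ball_vol (real d) * (diameter (U i) / 2) ^ d))"
  unfolding hausdorff_pre_def by (rule INF_lower) (use assms in auto)

lemma hausdorff_pre_approx:
  assumes "hausdorff_pre d \<delta> A < c"
  obtains U where "A \<subseteq> (\<Union>i. U i)" "\<And>i. bounded (U i)" "\<And>i. diameter (U i) \<le> \<delta>"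
    "(\<Sum>i. ennreal (unit_ball_vol (real d) * (diameter (U i) / 2) ^ d)) < c"
  using assms unfolding hausdorff_pre_def INF_less_iff by auto

lemma hausdorff_pre_mono: "A \<subseteq> B \<Longrightarrow> hausdorff_pre d \<delta> A \<le> hausdorff_pre d \<delta> B"
  unfolding hausdorff_pre_def by (rule INF_superset_mono) auto

lemma hausdorff_outer_mono: "A \<subseteq> B \<Longrightarrow> hausdorff_outer d A \<le> hausdorff_outer d B"
  unfolding hausdorff_outer_pre by (intro SUP_mono' hausdorff_pre_mono)

lemma hausdorff_pre_le_outer: "\<delta> > 0 \<Longrightarrow> hausdorff_pre d \<delta> A \<le> hausdorff_outer d A"
  unfolding hausdorff_outer_pre by (rule SUP_upper) auto

lemma hausdorff_pre_antimono: "\<delta> \<le> \<delta>' \<Longrightarrow> hausdorff_pre d \<delta>' A \<le> hausdorff_pre d \<delta> A"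
  unfolding hausdorff_pre_def by (rule INF_superset_mono) (auto intro: order_trans)

text \<open>The empty set is covered by empty sets of diameter 0; \<open>d \<ge> 1\<close> makes
  their weight vanish, as \<open>0 ^ 0 = 1\<close>.\<close>

lemma hausdorff_outer_empty: "d \<ge> 1 \<Longrightarrow> hausdorff_outer d {} = 0"
proof -
  assume "d \<ge> 1"
  then have "hausdorff_pre d \<delta> {} \<le> 0" if "\<delta> > 0" for \<delta>
    using hausdorff_pre_le[of "{}" "\<lambda>_. {}" \<delta> d] that by (simp add: diameter_def zero_power)
  then have "hausdorff_outer d {} \<le> 0"
    unfolding hausdorff_outer_pre by (intro SUP_least) auto
  then show ?thesis by simp
qed

text \<open>Each \<open>A n\<close> gets a cover that is optimal up to
  \<open>e / 2 ^ (n + 1)\<close>; the pairing function arranges all these covers in one sequence,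
  and the errors sum to \<open>e\<close>.\<close>

lemma hausdorff_pre_subadditive:
  "hausdorff_pre d \<delta> (\<Union>n. A n) \<le> (\<Sum>n. hausdorff_pre d \<delta> (A n))"
proof (rule ennreal_le_epsilon)
  fix e :: real assume fin: "(\<Sum>n. hausdorff_pre d \<delta> (A n)) < top" and e: "e > 0"
  let ?\<mu> = "\<lambda>B. ennreal (unit_ball_vol (real d) * (diameter B / 2) ^ d)"
  let ?e = "\<lambda>n. ennreal (e * (1 / 2) ^ Suc n)"
  have "\<exists>U. A n \<subseteq> (\<Union>i. U i) \<and> (\<forall>i. bounded (U i) \<and> diameter (U i) \<le> \<delta>) \<and>
      (\<Sum>i. ?\<mu> (U i)) < hausdorff_pre d \<delta> (A n) + ?e n" for n
  proof -
    have "hausdorff_pre d \<delta> (A n) < top"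
      by (rule le_less_trans[OF _ fin]) (use sum_le_suminf[of "\<lambda>n. hausdorff_pre d \<delta> (A n)" "{n}"] in auto)
    then have "hausdorff_pre d \<delta> (A n) < hausdorff_pre d \<delta> (A n) + ?e n"
      using e by (simp add: less_top)
    from hausdorff_pre_approx[OF this] show ?thesis by metis
  qed
  then obtain U where U: "\<And>n. A n \<subseteq> (\<Union>i. U n i)" "\<And>n i. bounded (U n i)" "\<And>n i. diameter (U n i) \<le> \<delta>"
    "\<And>n. (\<Sum>i. ?\<mu> (U n i)) < hausdorff_pre d \<delta> (A n) + ?e n"
    by metis
  let ?V = "\<lambda>k. case prod_decode k of (n, i) \<Rightarrow> U n i"
  have "hausdorff_pre d \<delta> (\<Union>n. A n) \<le> (\<Sum>k. ?\<mu> (?V k))"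
  proof (rule hausdorff_pre_le)
    show "(\<Union>n. A n) \<subseteq> (\<Union>k. ?V k)"
    proof
      fix x assume "x \<in> (\<Union>n. A n)"
      then obtain n i where "x \<in> U n i" using U(1) by blast
      then show "x \<in> (\<Union>k. ?V k)" by (intro UN_I[of "prod_encode (n, i)"]) auto
    qed
  qed (use U in \<open>auto split: prod.splits\<close>)
  also have "\<dots> = (\<Sum>n. \<Sum>i. ?\<mu> (U n i))"
    using suminf_ennreal_2dimen[of "\<lambda>n. \<Sum>i. ?\<mu> (U n i)" "\<lambda>(n, i). ?\<mu> (U n i)"]
    by (simp add: comp_def case_prod_unfold)
  also have "\<dots> \<le> (\<Sum>n. hausdorff_pre d \<delta> (A n) + ?e n)"
    by (intro suminf_le less_imp_le[OF U(4)]) auto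
  also have "\<dots> = (\<Sum>n. hausdorff_pre d \<delta> (A n)) + (\<Sum>n. ?e n)"
    by (simp add: suminf_add)
  also have "(\<Sum>n. ?e n) = ennreal e"
  proof (rule suminf_ennreal_eq)
    show "(\<lambda>n. e * (1 / 2) ^ Suc n) sums e"
      using sums_mult[OF power_half_series, of e] by simp
  qed (use e in simp)
  finally show "hausdorff_pre d \<delta> (\<Union>n. A n) \<le> (\<Sum>n. hausdorff_pre d \<delta> (A n)) + ennreal e" .
qed

lemma hausdorff_outer_subadditive:
  "hausdorff_outer d (\<Union>n. A n) \<le> (\<Sum>n. hausdorff_outer d (A n))"
  unfolding hausdorff_outer_pre[of d "\<Union>n. A n"]
proof (rule SUP_least)
  fix \<delta> :: real assume "\<delta> \<in> {0<..}"
  have "hausdorff_pre d \<delta> (\<Union>n. A n) \<le> (\<Sum>n. hausdorff_pre d \<delta> (A n))"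
    by (rule hausdorff_pre_subadditive)
  also have "\<dots> \<le> (\<Sum>n. hausdorff_outer d (A n))"
    using \<open>\<delta> \<in> {0<..}\<close> by (intro suminf_le hausdorff_pre_le_outer) auto
  finally show "hausdorff_pre d \<delta> (\<Union>n. A n) \<le> (\<Sum>n. hausdorff_outer d (A n))" .
qed

lemma hausdorff_outer_measure_space:
  "d \<ge> 1 \<Longrightarrow> outer_measure_space (Pow UNIV) (hausdorff_outer d)"
  by (auto simp: outer_measure_space_def positive_def increasing_def countably_subadditive_def
      hausdorff_outer_empty hausdorff_outer_mono hausdorff_outer_subadditive)

lemma hausdorff_outer_Un_le:
  "d \<ge> 1 \<Longrightarrow> hausdorff_outer d (A \<union> B) \<le> hausdorff_outer d A + hausdorff_outer d B"
proof -
  assume "d \<ge> 1"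
  let ?F = "\<lambda>n::nat. if n = 0 then A else if n = 1 then B else {}"
  have "A \<union> B = (\<Union>n. ?F n)"
    by (auto split: if_splits)
  then have "hausdorff_outer d (A \<union> B) \<le> (\<Sum>n. hausdorff_outer d (?F n))"
    using hausdorff_outer_subadditive[of d ?F] by simp
  also have "\<dots> = (\<Sum>n\<in>{0, 1}. hausdorff_outer d (?F n))"
    using \<open>d \<ge> 1\<close> by (intro suminf_finite) (auto simp: hausdorff_outer_empty)
  finally show ?thesis by simp
qed

text \<open>A covering set of diameter at most \<open>\<delta>\<close> cannot meet both
  \<open>A\<close> and \<open>B\<close>, so every cover of the union splits into disjoint parts
  covering \<open>A\<close> and \<open>B\<close>.\<close>

lemma hausdorff_pre_separated:
  assumes d: "d \<ge> 1" and sep: "\<And>x y. x \<in> A \<Longrightarrow> y \<in> B \<Longrightarrow> dist x y > \<delta>"  and "\<delta> > 0"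
  shows "hausdorff_pre d \<delta> A + hausdorff_pre d \<delta> B \<le> hausdorff_pre d \<delta> (A \<union> B)"
  unfolding hausdorff_pre_def[of d \<delta> "A \<union> B"]
proof (rule INF_greatest)
  fix U :: "nat \<Rightarrow> 'a set"
  assume U: "U \<in> {U. A \<union> B \<subseteq> \<Union> (range U) \<and> (\<forall>i. bounded (U i) \<and> diameter (U i) \<le> \<delta>)}"
  let ?\<mu> = "\<lambda>B. ennreal (unit_ball_vol (real d) * (diameter B / 2) ^ d)"
  \<comment> \<open>Members that miss \<open>C\<close> are replaced by the empty set, which keeps
    the indexing and has weight 0 because \<open>d \<ge> 1\<close>.\<close>
  let ?V = "\<lambda>C i. if U i \<inter> C = {} then {} else U i"
  have pre: "hausdorff_pre d \<delta> C \<le> (\<Sum>i. ?\<mu> (?V C i))" if "C \<subseteq> A \<union> B" for C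
    by (rule hausdorff_pre_le) (use U that \<open>\<delta> > 0\<close> in \<open>fastforce+\<close>)
  have "hausdorff_pre d \<delta> A + hausdorff_pre d \<delta> B \<le> (\<Sum>i. ?\<mu> (?V A i)) + (\<Sum>i. ?\<mu> (?V B i))"
    by (intro add_mono pre) auto
  also have "\<dots> = (\<Sum>i. ?\<mu> (?V A i) + ?\<mu> (?V B i))"
    by (simp add: suminf_add)
  also have "\<dots> \<le> (\<Sum>i. ?\<mu> (U i))"
  proof (rule suminf_le)
    fix i
    have "U i \<inter> A = {} \<or> U i \<inter> B = {}"
    proof (rule ccontr)
      assume "\<not> ?thesis"
      then obtain x y where xy: "x \<in> U i" "x \<in> A" "y \<in> U i" "y \<in> B" by auto
      then have "dist x y \<le> diameter (U i)" using U diameter_bounded_bound by blast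
      also have "\<dots> \<le> \<delta>" using U by auto
      finally show False using sep[OF xy(2,4)] by simp
    qed
    then show "?\<mu> (?V A i) + ?\<mu> (?V B i) \<le> ?\<mu> (U i)"
      using d by (auto simp: zero_power)
  qed auto
  finally show "hausdorff_pre d \<delta> A + hausdorff_pre d \<delta> B \<le> (\<Sum>i. ?\<mu> (U i))" .
qed

text \<open>The two suprema on the left run over independent scales; by antitonicity both pass to
  one common scale below \<open>\<eta>\<close>, where \<open>hausdorff_pre_separated\<close>
  applies.\<close>

lemma hausdorff_outer_separated:
  assumes d: "d \<ge> 1" and "\<eta> > 0" and sep: "\<And>x y. x \<in> A \<Longrightarrow> y \<in> B \<Longrightarrow> dist x y \<ge> \<eta>"
  shows "hausdorff_outer d A + hausdorff_outer d B \<le> hausdorff_outer d (A \<union> B)"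
proof -
  have *: "hausdorff_pre d \<delta>1 A + hausdorff_pre d \<delta>2 B \<le> hausdorff_outer d (A \<union> B)"
    if "\<delta>1 > 0" "\<delta>2 > 0" for \<delta>1 \<delta>2
  proof -
    define \<delta> where "\<delta> = min (min \<delta>1 \<delta>2) (\<eta> / 2)"
    have \<delta>: "\<delta> > 0" "\<delta> \<le> \<delta>1" "\<delta> \<le> \<delta>2" "\<delta> < \<eta>" using that \<open>\<eta> > 0\<close> by (auto simp: \<delta>_def)
    have "hausdorff_pre d \<delta>1 A + hausdorff_pre d \<delta>2 B \<le> hausdorff_pre d \<delta> A + hausdorff_pre d \<delta> B"
      using \<delta> by (intro add_mono hausdorff_pre_antimono)
    also have "\<dots> \<le> hausdorff_pre d \<delta> (A \<union> B)"
      using \<delta> sep by (intro hausdorff_pre_separated[OF d]) (auto intro: less_le_trans)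
    also have "\<dots> \<le> hausdorff_outer d (A \<union> B)"
      using \<delta> by (intro hausdorff_pre_le_outer)
    finally show ?thesis .
  qed
  have "hausdorff_outer d A + hausdorff_outer d B
      = (SUP \<delta>1\<in>{0<..}. SUP \<delta>2\<in>{0<..}. hausdorff_pre d \<delta>1 A + hausdorff_pre d \<delta>2 B)"
    by (simp add: hausdorff_outer_pre ennreal_SUP_add_left[symmetric] ennreal_SUP_add_right[symmetric])
  also have "\<dots> \<le> hausdorff_outer d (A \<union> B)"
    using * by (intro SUP_least) auto
  finally show ?thesis .
qed

lemma hausdorff_outer_separated_UN:
  assumes d: "d \<ge> 1" and sep: "\<And>i j. i < j \<Longrightarrow> \<exists>\<eta>>0. \<forall>x\<in>R i. \<forall>y\<in>(\<Union>k\<in>{j..}. R k). dist x y \<ge> \<eta>"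
  shows "(\<Sum>i\<in>{m..<m+n}. hausdorff_outer d (R i)) \<le> hausdorff_outer d (\<Union>i\<in>{m..<m+n}. R (i::nat))"
proof (induction n arbitrary: m)
  case 0
  then show ?case by simp
next
  case (Suc n)
  obtain \<eta> where \<eta>: "\<eta> > 0" "\<And>x y. x \<in> R m \<Longrightarrow> y \<in> (\<Union>k\<in>{Suc m..}. R k) \<Longrightarrow> dist x y \<ge> \<eta>"
    using sep[of m "Suc m"] by blast
  have set: "{m..<m + Suc n} = insert m {Suc m..<Suc m + n}" by auto
  have "(\<Sum>i\<in>{m..<m + Suc n}. hausdorff_outer d (R i))
      = hausdorff_outer d (R m) + (\<Sum>i\<in>{Suc m..<Suc m+n}. hausdorff_outer d (R i))"
    unfolding set by (subst sum.insert) auto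
  also have "\<dots> \<le> hausdorff_outer d (R m) + hausdorff_outer d (\<Union>i\<in>{Suc m..<Suc m+n}. R i)"
    by (intro add_left_mono Suc.IH)
  also have "\<dots> \<le> hausdorff_outer d (R m \<union> (\<Union>i\<in>{Suc m..<Suc m+n}. R i))"
  proof (rule hausdorff_outer_separated[OF d \<eta>(1)])
    fix x y assume "x \<in> R m" "y \<in> (\<Union>i\<in>{Suc m..<Suc m+n}. R i)"
    then show "\<eta> \<le> dist x y" by (intro \<eta>(2)) auto
  qed
  also have "R m \<union> (\<Union>i\<in>{Suc m..<Suc m+n}. R i) = (\<Union>i\<in>{m..<m + Suc n}. R i)"
    unfolding set by auto
  finally show ?case .
qed

text \<open>Caratheodory's criterion: the points of \<open>A\<close> outside \<open>F\<close> are split into shells according to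
  their distance from \<open>F\<close>; shells that are not adjacent are at positive distance from each other,
  so that the measures of the shells are summable.\<close>

lemma hausdorff_outer_closed_split:
  fixes F :: "'a::euclidean_space set"
  assumes d: "d \<ge> 1" and F: "closed F"
  shows "hausdorff_outer d (A \<inter> F) + hausdorff_outer d (A - F) \<le> hausdorff_outer d A"
proof (cases "F = {} \<or> hausdorff_outer d A = \<infinity>")
  case True
  then show ?thesis using d by (auto simp: hausdorff_outer_empty)
next
  case False
  let ?H = "hausdorff_outer d"
  have ne: "F \<noteq> {}" and fin: "?H A < \<infinity>" using False by (auto simp: less_top)
  define S where "S n = {x\<in>A. infdist x F \<ge> 1 / Suc n}" for n
  define R where "R n = S (Suc n) - S n" for n
  have S_R: "A - F \<subseteq> S n \<union> (\<Union>k. R (k + n))" for n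
  proof
    fix x assume x: "x \<in> A - F"
    then have "infdist x F > 0" using F ne
      by (metis DiffD2 in_closed_iff_infdist_zero infdist_nonneg less_eq_real_def)
    then obtain m where "1 / Suc m < infdist x F"
      by (metis inverse_eq_divide reals_Archimedean)
    then have "x \<in> S m" using x by (auto simp: S_def)
    then have "x \<in> S (n + m)"
    proof -
      have "1 / real (Suc (n + m)) \<le> 1 / real (Suc m)" by (simp add: frac_le)
      then show ?thesis using \<open>x \<in> S m\<close> by (auto simp: S_def)
    qed
    moreover have "x \<in> S (n + m) \<Longrightarrow> x \<in> S n \<union> (\<Union>k. R (k + n))" for m
    proof (induction m)
      case (Suc m)
      then show ?case
      proof (cases "x \<in> S (n + m)")
        case False
        then have "x \<in> R (m + n)" using Suc.prems by (simp add: R_def add.commute)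
        then show ?thesis by auto
      qed auto
    qed auto
    ultimately show "x \<in> S n \<union> (\<Union>k. R (k + n))" by blast
  qed
  \<comment> \<open>The distance from \<open>F\<close> is 1-Lipschitz.\<close>
  have gap: "dist x y \<ge> 1 / real (Suc i) - 1 / real (Suc j)"
    if "x \<in> S i" "y \<notin> S j" "y \<in> A" for x y i j
  proof -
    have "1 / real (Suc i) \<le> infdist x F" "infdist y F < 1 / real (Suc j)" using that by (auto simp: S_def)
    moreover have "infdist x F \<le> infdist y F + dist x y" by (rule infdist_triangle)
    ultimately show ?thesis by simp
  qed
  have RA: "R i \<subseteq> A" for i by (auto simp: R_def S_def)
  have Smono: "S i \<subseteq> S j" if "i \<le> j" for i j
  proof -
    have "1 / real (Suc j) \<le> 1 / real (Suc i)" using that by (simp add: frac_le)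
    then show ?thesis by (auto simp: S_def)
  qed
  \<comment> \<open>With \<open>p = 0\<close> and \<open>p = 1\<close> these are the even and the
    odd shells; between two shells of equal parity lies a whole shell, whose thickness is the
    required distance.\<close>
  have par: "(\<Sum>k<m. ?H (R (2 * k + p))) \<le> ?H A" for m p
  proof -
    have "(\<Sum>k\<in>{0..<0+m}. ?H (R (2 * k + p))) \<le> ?H (\<Union>k\<in>{0..<0+m}. R (2 * k + p))"
    proof (rule hausdorff_outer_separated_UN[OF d])
      fix i j :: nat assume ij: "i < j"
      let ?a = "Suc (2 * i + p)"
      show "\<exists>\<eta>>0. \<forall>x\<in>R (2 * i + p). \<forall>y\<in>(\<Union>k\<in>{j..}. R (2 * k + p)). \<eta> \<le> dist x y"
      proof (intro exI[of _ "1 / real (Suc ?a) - 1 / real (Suc (Suc ?a))"] conjI ballI)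
        show "0 < 1 / real (Suc ?a) - 1 / real (Suc (Suc ?a))" by (simp add: frac_less2)
      next
        fix x y assume x: "x \<in> R (2 * i + p)" and "y \<in> (\<Union>k\<in>{j..}. R (2 * k + p))"
        then obtain k where k: "k \<ge> j" "y \<in> R (2 * k + p)" by auto
        have "S (Suc ?a) \<subseteq> S (2 * k + p)" using k ij by (intro Smono) auto
        then have "y \<notin> S (Suc ?a)" using k by (auto simp: R_def)
        moreover have "x \<in> S ?a" using x by (auto simp: R_def)
        ultimately show "1 / real (Suc ?a) - 1 / real (Suc (Suc ?a)) \<le> dist x y"
          using k RA by (intro gap) auto
      qed
    qed
    also have "\<dots> \<le> ?H A" using RA by (intro hausdorff_outer_mono) auto
    finally show ?thesis by (simp add: atLeast0LessThan)
  qed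
  have "(\<Sum>k<2 * m. ?H (R k)) \<le> 2 * ?H A" for m
  proof -
    have "(\<Sum>k<2 * m. ?H (R k)) = (\<Sum>k<m. ?H (R (2 * k + 0))) + (\<Sum>k<m. ?H (R (2 * k + 1)))"
      by (induction m) (auto simp: ac_simps)
    also have "\<dots> \<le> ?H A + ?H A" by (intro add_mono par)
    finally show ?thesis by (simp add: mult_2)
  qed
  then have le: "(\<Sum>k<2 * m. ?H (R k)) \<le> 2 * ?H A" for m .
  have "(\<Sum>k<m. ?H (R k)) \<le> 2 * ?H A" for m
  proof -
    have "(\<Sum>k<m. ?H (R k)) \<le> (\<Sum>k<2 * m. ?H (R k))" by (intro sum_mono2) auto
    also have "\<dots> \<le> 2 * ?H A" by (rule le)
    finally show ?thesis .
  qed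
  then have "(\<Sum>k. ?H (R k)) \<le> 2 * ?H A"
    by (intro suminf_le_const) auto
  also have "\<dots> < \<infinity>" using fin by (simp add: ennreal_mult_less_top)
  finally have sfin: "(\<Sum>k. ?H (R k)) < \<infinity>" .
  have main: "?H (A \<inter> F) + ?H (A - F) \<le> ?H A + (\<Sum>k. ?H (R (k + n)))" for n
  proof -
    have "?H (A - F) \<le> ?H (S n \<union> (\<Union>k. R (k + n)))" by (intro hausdorff_outer_mono S_R)
    also have "\<dots> \<le> ?H (S n) + ?H (\<Union>k. R (k + n))" by (rule hausdorff_outer_Un_le[OF d])
    also have "\<dots> \<le> ?H (S n) + (\<Sum>k. ?H (R (k + n)))"
      by (intro add_left_mono hausdorff_outer_subadditive)
    finally have "?H (A \<inter> F) + ?H (A - F) \<le> (?H (A \<inter> F) + ?H (S n)) + (\<Sum>k. ?H (R (k + n)))"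
      by (simp add: add_left_mono add.assoc)
    also have "?H (A \<inter> F) + ?H (S n) \<le> ?H ((A \<inter> F) \<union> S n)"
    proof (rule hausdorff_outer_separated[OF d, of "1 / Suc n"])
      fix x y assume "x \<in> A \<inter> F" "y \<in> S n"
      then have "1 / Suc n \<le> infdist y F" "infdist y F \<le> dist y x"
        by (auto simp: S_def intro: infdist_le)
      then show "1 / Suc n \<le> dist x y" by (simp add: dist_commute)
    qed auto
    also have "\<dots> \<le> ?H A" by (intro hausdorff_outer_mono) (auto simp: S_def)
    finally show ?thesis by (simp add: add_right_mono)
  qed
  \<comment> \<open>These are tails of a convergent series; the sum is finite, so the argument can
    be carried out in the reals.\<close>
  have "(\<lambda>n. \<Sum>k. ?H (R (k + n))) \<longlonglongrightarrow> 0"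
  proof -
    have "summable (\<lambda>k. enn2real (?H (R k)))" and eq: "\<And>k. ?H (R k) = ennreal (enn2real (?H (R k)))"
    proof -
      have *: "?H (R k) < \<infinity>" for k
        using le_less_trans[OF sum_le_suminf[of "\<lambda>k. ?H (R k)" "{k}"] sfin] by auto
      then show eq: "?H (R k) = ennreal (enn2real (?H (R k)))" for k by simp
      have "(\<Sum>k. ennreal (enn2real (?H (R k)))) \<noteq> \<infinity>" using sfin eq by simp
      then show "summable (\<lambda>k. enn2real (?H (R k)))"
        by (intro summable_suminf_not_top) auto
    qed
    then have "(\<lambda>n. ennreal (\<Sum>k. enn2real (?H (R (k + n))))) \<longlonglongrightarrow> ennreal 0"
      by (intro tendsto_ennrealI suminf_exist_split2)
    moreover have "ennreal (\<Sum>k. enn2real (?H (R (k + n)))) = (\<Sum>k. ?H (R (k + n)))" for n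
      using suminf_ennreal2[of "\<lambda>k. enn2real (?H (R (k + n)))"] eq
        summable_ignore_initial_segment[OF \<open>summable (\<lambda>k. enn2real (?H (R k)))\<close>, of n]
      by simp
    ultimately show ?thesis by simp
  qed
  then have "(\<lambda>n. ?H A + (\<Sum>k. ?H (R (k + n)))) \<longlonglongrightarrow> ?H A + 0"
    by (intro tendsto_add tendsto_const) auto
  then show ?thesis
    using main by (intro Lim_bounded2[of _ _ 0]) auto
qed

text \<open>By Caratheodory's theorem the lambda system is already a sigma-algebra and the outer
  measure is a measure on it, so \<open>measure_of\<close> changes neither. Closed sets belong to it
  by \<open>hausdorff_outer_closed_split\<close>, hence so do all Borel sets.\<close>

lemma
  assumes d: "d \<ge> 1"
  shows borel_subset_sets_hausdorff:
      "sets (borel :: 'a::euclidean_space measure) \<subseteq> sets (hausdorff_measure d)"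
    and space_hausdorff [simp]: "space (hausdorff_measure d :: 'a measure) = UNIV"
    and emeasure_hausdorff: "(A :: 'a set) \<in> sets (hausdorff_measure d) \<Longrightarrow>
      emeasure (hausdorff_measure d) A = hausdorff_outer d A"
proof -
  let ?L = "lambda_system UNIV (Pow UNIV) (hausdorff_outer d) :: 'a set set"
  interpret P: sigma_algebra UNIV "Pow UNIV :: 'a set set" by (rule sigma_algebra_Pow)
  have ms: "measure_space UNIV ?L (hausdorff_outer d)"
    using P.caratheodory_lemma[OF hausdorff_outer_measure_space[OF d]] by simp
  then have sa: "sigma_algebra UNIV ?L" by (simp add: measure_space_def)
  have sets: "sets (hausdorff_measure d :: 'a measure) = ?L"
    unfolding hausdorff_measure_def using sa by (subst sigma_algebra.sets_measure_of_eq) auto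
  show "space (hausdorff_measure d :: 'a measure) = UNIV"
    unfolding hausdorff_measure_def by (simp add: space_measure_of_conv)
  have closed: "F \<in> ?L" if "closed F" for F :: "'a set"
  proof -
    have "hausdorff_outer d (x \<inter> F) + hausdorff_outer d (x - F) = hausdorff_outer d x" for x
    proof (rule antisym)
      show "hausdorff_outer d x \<le> hausdorff_outer d (x \<inter> F) + hausdorff_outer d (x - F)"
        using hausdorff_outer_Un_le[OF d, of "x \<inter> F" "x - F"] by (simp add: Int_Diff_Un)
    qed (rule hausdorff_outer_closed_split[OF d that])
    then show ?thesis by (subst P.lambda_system_eq) auto
  qed
  show "sets (borel :: 'a measure) \<subseteq> sets (hausdorff_measure d)"
    unfolding sets borel_eq_closed using closed sa
    by (subst sets_measure_of) (auto simp del: Pow_UNIV dest: sigma_algebra.sigma_sets_subset[of _ _ "Collect closed"])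
  show "emeasure (hausdorff_measure d) A = hausdorff_outer d A" if "A \<in> sets (hausdorff_measure d)"
  proof -
    have "A \<in> ?L" using that sets by blast
    with ms show ?thesis unfolding hausdorff_measure_def
    by (intro emeasure_measure_of_sigma) (auto simp: measure_space_def simp del: Pow_UNIV)
  qed
qed

section \<open>Integrals of partial derivatives\<close>

lemma compact_support_bounded:
  fixes g :: "'a::euclidean_space \<Rightarrow> real"
  assumes "continuous_on UNIV g" "compact K" "\<And>x. x \<notin> K \<Longrightarrow> g x = 0"
  obtains M where "M > 0" "\<And>x. \<bar>g x\<bar> \<le> M"
proof -
  have "bounded (g ` K)"
    using assms by (intro compact_imp_bounded compact_continuous_image) (auto intro: continuous_on_subset)
  then obtain M where "M > 0" "\<And>x. x \<in> K \<Longrightarrow> \<bar>g x\<bar> \<le> M"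
    by (auto simp: bounded_pos)
  then show ?thesis using that[of M] assms(3) by (metis abs_zero less_imp_le)
qed

lemma pd_vanishes:
  assumes "closed K" "\<And>x. x \<notin> K \<Longrightarrow> f x = 0" "x \<notin> K"
  shows "frechet_derivative f (at x) i = 0"
proof -
  have "((\<lambda>x. 0) has_derivative (\<lambda>h. 0)) (at x)" by simp
  then have "(f has_derivative (\<lambda>h. 0)) (at x)"
    by (rule has_derivative_transform_within_open[where s = "- K"]) (use assms in auto)
  then show ?thesis by (rule pd_eq)
qed

lemma has_derivative_line:
  fixes f :: "'a::euclidean_space \<Rightarrow> real"
  assumes "\<And>x. f differentiable (at x)"
  shows "((\<lambda>t. f (x + t *\<^sub>R i)) has_real_derivative pd i f (x + t *\<^sub>R i)) (at t)"
proof -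
  have "(f has_derivative frechet_derivative f (at (x + t *\<^sub>R i))) (at (x + t *\<^sub>R i))"
    using assms frechet_derivative_works by blast
  moreover have "((\<lambda>t. x + t *\<^sub>R i) has_derivative (\<lambda>h. h *\<^sub>R i)) (at t)"
    by (auto intro!: derivative_eq_intros)
  ultimately have "((\<lambda>t. f (x + t *\<^sub>R i)) has_derivative
      (\<lambda>h. frechet_derivative f (at (x + t *\<^sub>R i)) (h *\<^sub>R i))) (at t)"
    using has_derivative_compose by blast
  moreover have "frechet_derivative f (at (x + t *\<^sub>R i)) (h *\<^sub>R i) = pd i f (x + t *\<^sub>R i) * h" for h
    using linear_frechet_derivative[OF assms] by (simp add: linear_cmul)
  ultimately show ?thesis by (simp add: has_field_derivative_def)
qed

text \<open>Dominated convergence: the mean value theorem bounds the quotients by the supremum of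
  the derivative, and steps of length at most 1 keep the support in a ball of radius
  \<open>R + 1\<close>. Integrals of derivatives thus reduce to translations instead of iterated
  integrals.\<close>

lemma difference_quotient_tendsto_integral:
  fixes f :: "'a::euclidean_space \<Rightarrow> real"
  assumes diff: "\<And>x. f differentiable (at x)" and cont: "continuous_on UNIV (pd i f)"
    and i: "i \<in> Basis" and K: "compact K" "\<And>x. x \<notin> K \<Longrightarrow> f x = 0"
    and S: "S \<in> sets borel"
  shows "(\<lambda>n. \<integral>x. indicator S x * ((f (x + inverse (real (Suc n)) *\<^sub>R i) - f x) / inverse (real (Suc n))) \<partial>lborel)
    \<longlonglongrightarrow> (\<integral>x. indicator S x * pd i f x \<partial>lborel)"
proof -
  have z: "pd i f x = 0" if "x \<notin> K" for x
    using K that by (intro pd_vanishes) (auto intro: compact_imp_closed)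
  obtain M where M: "M > 0" "\<And>x. \<bar>pd i f x\<bar> \<le> M"
    using compact_support_bounded[OF cont K(1) z] by metis
  obtain R where R: "R > 0" "\<And>x. x \<in> K \<Longrightarrow> norm x \<le> R"
    using compact_imp_bounded[OF K(1)] by (auto simp: bounded_pos)
  have fc: "continuous_on UNIV f"
    using diff by (simp add: continuous_at_imp_continuous_on differentiable_imp_continuous_within)
  have fm [measurable]: "f \<in> borel_measurable borel" "pd i f \<in> borel_measurable borel"
    using fc cont by (auto intro: borel_measurable_continuous_onI)
  note S [measurable]
  show ?thesis
  proof (rule integral_dominated_convergence[where w = "\<lambda>x. M * indicator (cball 0 (R + 1)) x"])
    show "integrable lborel (\<lambda>x::'a. M * indicator (cball 0 (R + 1)) x)"
      by (intro integrable_mult_right integrable_real_indicator) (auto simp: emeasure_lborel_cball_finite[unfolded infinity_ennreal_def])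
    show "AE x in lborel. (\<lambda>n. indicator S x * ((f (x + inverse (real (Suc n)) *\<^sub>R i) - f x) / inverse (real (Suc n))))
        \<longlonglongrightarrow> indicator S x * pd i f x"
    proof (intro AE_I2 tendsto_mult tendsto_const)
      fix x
      have "((\<lambda>t. (f (x + t *\<^sub>R i) - f x) / t) \<longlongrightarrow> pd i f x) (at 0)"
        using has_derivative_line[OF diff, of x i 0] by (simp add: DERIV_def)
      moreover have "filterlim (\<lambda>n. inverse (real (Suc n))) (at 0) sequentially"
        unfolding filterlim_at using LIMSEQ_inverse_real_of_nat by (auto intro: always_eventually)
      ultimately show "(\<lambda>n. (f (x + inverse (real (Suc n)) *\<^sub>R i) - f x) / inverse (real (Suc n))) \<longlonglongrightarrow> pd i f x"
        by (rule filterlim_compose)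
    qed
    fix n
    show "AE x in lborel. norm (indicator S x * ((f (x + inverse (real (Suc n)) *\<^sub>R i) - f x) / inverse (real (Suc n))))
        \<le> M * indicator (cball 0 (R + 1)) x"
    proof (rule AE_I2)
      fix x
      let ?h = "inverse (real (Suc n))"
      have h: "?h > 0" "?h \<le> 1" by (auto simp: field_simps)
      show "norm (indicator S x * ((f (x + ?h *\<^sub>R i) - f x) / ?h)) \<le> M * indicator (cball 0 (R + 1)) x"
      proof (cases "norm x \<le> R + 1")
        case True
        obtain t where "f (x + ?h *\<^sub>R i) - f (x + 0 *\<^sub>R i) = (?h - 0) * pd i f (x + t *\<^sub>R i)"
          using MVT2[OF h(1), of "\<lambda>t. f (x + t *\<^sub>R i)" "\<lambda>t. pd i f (x + t *\<^sub>R i)"]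
            has_derivative_line[OF diff] by blast
        then have "(f (x + ?h *\<^sub>R i) - f x) / ?h = pd i f (x + t *\<^sub>R i)" using h by simp
        then show ?thesis using M(2) M(1) True
          by (auto simp: indicator_def abs_mult)
      next
        case False
        have "norm (?h *\<^sub>R i) \<le> 1" using h i by simp
        then have "norm (x + ?h *\<^sub>R i) > R" using False norm_diff_ineq[of x "?h *\<^sub>R i"] by linarith
        then have "x + ?h *\<^sub>R i \<notin> K" "x \<notin> K" using R False by force+
        then show ?thesis using K M by simp
      qed
    qed
  qed measurable
qed

lemma lborel_integral_translate:
  fixes f :: "'a::euclidean_space \<Rightarrow> real"
  assumes [measurable]: "f \<in> borel_measurable borel"
  shows "(\<integral>x. f (x + a) \<partial>lborel) = (\<integral>x. f x \<partial>lborel)"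
  using integral_distr[of "(+) a" lborel borel f]
  by (simp add: lborel_distr_plus add.commute)

lemma integrable_lborel_translate:
  fixes f :: "'a::euclidean_space \<Rightarrow> real"
  assumes "integrable lborel f"
  shows "integrable lborel (\<lambda>x. f (x + a))"
proof -
  have [measurable]: "f \<in> borel_measurable borel"
    using borel_measurable_integrable[OF assms] by simp
  have "integrable (distr lborel borel ((+) a)) f" using assms by (simp add: lborel_distr_plus)
  then have "integrable lborel (\<lambda>x. f (a + x))" by (subst (asm) integrable_distr_eq) auto
  then show ?thesis by (simp add: add.commute)
qed

lemma integrable_continuous_compact_support:
  fixes f :: "'a::euclidean_space \<Rightarrow> real"
  assumes "continuous_on UNIV f" "compact K" "\<And>x. x \<notin> K \<Longrightarrow> f x = 0"
  shows "integrable lborel f"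
proof -
  have "integrable lborel (\<lambda>x. indicator K x *\<^sub>R f x)"
    using assms by (intro borel_integrable_compact) (auto intro: continuous_on_subset)
  moreover have "(\<lambda>x. indicator K x *\<^sub>R f x) = f" using assms(3) by (auto simp: indicator_def fun_eq_iff)
  ultimately show ?thesis by simp
qed

text \<open>As \<open>S\<close> is invariant under translations along \<open>i\<close>, every
  difference quotient integrates to zero.\<close>

lemma integral_pd_invariant:
  fixes f :: "'a::euclidean_space \<Rightarrow> real"
  assumes diff: "\<And>x. f differentiable (at x)" and cont: "continuous_on UNIV (pd i f)"
    and i: "i \<in> Basis" and K: "compact K" "\<And>x. x \<notin> K \<Longrightarrow> f x = 0"
    and S: "S \<in> sets borel" "\<And>x t. x + t *\<^sub>R i \<in> S \<longleftrightarrow> x \<in> S"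
  shows "(\<integral>x. indicator S x * pd i f x \<partial>lborel) = 0"
proof -
  have fc: "continuous_on UNIV f"
    using diff by (simp add: continuous_at_imp_continuous_on differentiable_imp_continuous_within)
  have fi: "integrable lborel (\<lambda>x. indicator S x * f x)"
    using integrable_mult_indicator[OF _ integrable_continuous_compact_support[OF fc K], of S] S(1) by simp
  have zero: "(\<integral>x. indicator S x * ((f (x + h *\<^sub>R i) - f x) / h) \<partial>lborel) = 0" for h
  proof -
    have eq: "indicator S x * f (x + h *\<^sub>R i) = indicator S (x + h *\<^sub>R i) * f (x + h *\<^sub>R i)" for x
      using S(2) by (simp add: indicator_def)
    have "(\<integral>x. indicator S x * ((f (x + h *\<^sub>R i) - f x) / h) \<partial>lborel)
        = (\<integral>x. indicator S (x + h *\<^sub>R i) * f (x + h *\<^sub>R i) - indicator S x * f x \<partial>lborel) / h"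
      by (simp add: right_diff_distrib eq flip: integral_divide_zero)
    also have "\<dots> = ((\<integral>x. indicator S (x + h *\<^sub>R i) * f (x + h *\<^sub>R i) \<partial>lborel) - (\<integral>x. indicator S x * f x \<partial>lborel)) / h"
      using integrable_lborel_translate[OF fi] fi by (subst Bochner_Integration.integral_diff) auto
    also have "\<dots> = 0"
      using lborel_integral_translate[of "\<lambda>x. indicator S x * f x" "h *\<^sub>R i"] fi by simp
    finally show ?thesis .
  qed
  show ?thesis
    using difference_quotient_tendsto_integral[OF diff cont i K S(1)]
    unfolding zero LIMSEQ_const_iff by simp
qed

text \<open>The substitution replaces the coordinate along \<open>e\<close> by
  \<open>c + h * (x \<bullet> e)\<close> and has determinant \<open>h\<close>. It blows up a layer
  of thickness \<open>h\<close> to the unit slab.\<close>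

lemma lborel_integral_stretch:
  fixes f :: "'a::euclidean_space \<Rightarrow> real"
  assumes [measurable]: "f \<in> borel_measurable borel" and e: "e \<in> Basis" and h: "h > 0"
  shows "(\<integral>x. f x \<partial>lborel) = h * (\<integral>x. f (x + (c + h * (x \<bullet> e) - x \<bullet> e) *\<^sub>R e) \<partial>lborel)"
proof -
  let ?c = "\<lambda>j. if j = e then h else 1"
  let ?T = "\<lambda>x::'a. c *\<^sub>R e + (\<Sum>j\<in>Basis. (?c j * (x \<bullet> j)) *\<^sub>R j)"
  have T: "?T x = x + (c + h * (x \<bullet> e) - x \<bullet> e) *\<^sub>R e" for x
  proof (rule euclidean_eqI)
    fix b :: 'a assume b: "b \<in> Basis"
    have "(\<Sum>j\<in>Basis. (?c j * (x \<bullet> j)) *\<^sub>R j) \<bullet> b = ?c b * (x \<bullet> b)"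
      using b by (rule inner_sum_left_Basis)
    then show "?T x \<bullet> b = (x + (c + h * (x \<bullet> e) - x \<bullet> e) *\<^sub>R e) \<bullet> b"
      using b e by (cases "b = e") (simp_all add: inner_add_left inner_not_same_Basis)
  qed
  have p: "(\<Prod>j\<in>Basis. \<bar>?c j\<bar>) = h"
    using e h by (simp add: prod.remove[of Basis e] )
  have "lborel = density (distr lborel borel ?T) (\<lambda>_. ennreal h)"
    using lborel_affine_euclidean[of ?c "c *\<^sub>R e"] h p by auto
  then have "(\<integral>x. f x \<partial>lborel) = (\<integral>x. f x \<partial>density (distr lborel borel ?T) (\<lambda>_. ennreal h))"
    by simp
  also have "\<dots> = (\<integral>x. h * f (?T x) \<partial>lborel)"
    using h by (subst integral_density) (auto simp: integral_distr)
  finally show ?thesis unfolding T by simp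
qed

text \<open>Translating the half space leaves in the difference quotient only the layer of thickness
  \<open>h\<close> above the hyperplane. Stretched to the unit slab, it collapses onto the
  hyperplane as \<open>h\<close> tends to 0, which gives the fundamental theorem of calculus with
  the slab representing the boundary integral.\<close>

lemma integral_pd_halfspace:
  fixes f :: "'a::euclidean_space \<Rightarrow> real"
  assumes diff: "\<And>x. f differentiable (at x)" and cont: "continuous_on UNIV (pd e f)"
    and e: "e \<in> Basis" and K: "compact K" "\<And>x. x \<notin> K \<Longrightarrow> f x = 0"
  shows "(\<integral>x. indicator {x. x \<bullet> e < c} x * pd e f x \<partial>lborel)
    = (\<integral>x. indicator {x. 0 \<le> x \<bullet> e \<and> x \<bullet> e < 1} x * f (x + (c - x \<bullet> e) *\<^sub>R e) \<partial>lborel)"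
proof -
  have fc: "continuous_on UNIV f"
    using diff by (simp add: continuous_at_imp_continuous_on differentiable_imp_continuous_within)
  have fm [measurable]: "f \<in> borel_measurable borel"
    using fc by (auto intro: borel_measurable_continuous_onI)
  let ?S = "{x::'a. x \<bullet> e < c}" and ?B = "{x::'a. 0 \<le> x \<bullet> e \<and> x \<bullet> e < 1}"
  let ?T = "\<lambda>h x::'a. x + (c + h * (x \<bullet> e) - x \<bullet> e) *\<^sub>R e"
  have S [measurable]: "?S \<in> sets borel" "?B \<in> sets borel" by measurable
  have fi: "integrable lborel f" by (rule integrable_continuous_compact_support[OF fc K])
  have fiS: "integrable lborel (\<lambda>x. indicator A x * f x)" if "A \<in> sets borel" for A
    using integrable_mult_indicator[OF _ fi, of A] that by simp
  have eq: "(\<integral>x. indicator ?S x * ((f (x + h *\<^sub>R e) - f x) / h) \<partial>lborel)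
      = (\<integral>x. indicator ?B x * f (?T h x) \<partial>lborel)" if h: "h > 0" for h
  proof -
    let ?Sh = "{x. x \<bullet> e < c + h}"
    have ind: "indicator ?Sh (x + h *\<^sub>R e) = (indicator ?S x :: real)" for x
      using e by (auto simp: indicator_def inner_simps)
    have "(\<integral>x. indicator ?S x * ((f (x + h *\<^sub>R e) - f x) / h) \<partial>lborel)
        = (\<integral>x. indicator ?Sh (x + h *\<^sub>R e) * f (x + h *\<^sub>R e) - indicator ?S x * f x \<partial>lborel) / h"
      unfolding ind by (simp add: right_diff_distrib diff_divide_distrib flip: integral_divide_zero)
    also have "\<dots> = ((\<integral>x. indicator ?Sh (x + h *\<^sub>R e) * f (x + h *\<^sub>R e) \<partial>lborel) - (\<integral>x. indicator ?S x * f x \<partial>lborel)) / h"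
      by (subst Bochner_Integration.integral_diff)
        (auto intro!: fiS integrable_lborel_translate[of "\<lambda>x. indicator ?Sh x * f x"])
    also have "\<dots> = ((\<integral>x. indicator ?Sh x * f x \<partial>lborel) - (\<integral>x. indicator ?S x * f x \<partial>lborel)) / h"
      by (subst lborel_integral_translate[of "\<lambda>x. indicator ?Sh x * f x" "h *\<^sub>R e"]) auto
    also have "\<dots> = (\<integral>x. indicator ?Sh x * f x - indicator ?S x * f x \<partial>lborel) / h"
      by (subst Bochner_Integration.integral_diff) (auto intro!: fiS)
    also have "\<dots> = (\<integral>x. indicator {x. c \<le> x \<bullet> e \<and> x \<bullet> e < c + h} x * f x \<partial>lborel) / h"
      using h by (intro arg_cong2[where f = "(/)"] Bochner_Integration.integral_cong) (auto simp: indicator_def)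
    also have "\<dots> = (\<integral>x. indicator {x. c \<le> x \<bullet> e \<and> x \<bullet> e < c + h} (?T h x) * f (?T h x) \<partial>lborel)"
      using h by (subst lborel_integral_stretch[OF _ e h, of _ c]) auto
    also have "\<dots> = (\<integral>x. indicator ?B x * f (?T h x) \<partial>lborel)"
      using h e by (intro Bochner_Integration.integral_cong) (auto simp: indicator_def inner_simps zero_le_mult_iff)
    finally show ?thesis .
  qed
  obtain M where M: "M > 0" "\<And>x. \<bar>f x\<bar> \<le> M"
    using compact_support_bounded[OF fc K] by metis
  obtain R where R: "R > 0" "\<And>x. x \<in> K \<Longrightarrow> norm x \<le> R"
    using compact_imp_bounded[OF K(1)] by (auto simp: bounded_pos)
  \<comment> \<open>On the slab the displacement along \<open>e\<close> has length at most
    \<open>\<bar>c\<bar> + 2\<close>, so points outside this radius are mapped outside the support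
    of \<open>f\<close>.\<close>
  let ?R = "R + \<bar>c\<bar> + 3"
  have "(\<lambda>n. \<integral>x. indicator ?B x * f (?T (inverse (real (Suc n))) x) \<partial>lborel)
      \<longlonglongrightarrow> (\<integral>x. indicator ?B x * f (x + (c - x \<bullet> e) *\<^sub>R e) \<partial>lborel)"
  proof (rule integral_dominated_convergence[where w = "\<lambda>x. M * indicator (cball 0 ?R) x"])
    show "integrable lborel (\<lambda>x::'a. M * indicator (cball 0 ?R) x)"
      by (intro integrable_mult_right integrable_real_indicator) (auto simp: emeasure_lborel_cball_finite[unfolded infinity_ennreal_def])
    show "AE x in lborel. (\<lambda>n. indicator ?B x * f (?T (inverse (real (Suc n))) x))
        \<longlonglongrightarrow> indicator ?B x * f (x + (c - x \<bullet> e) *\<^sub>R e)"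
    proof (intro AE_I2 tendsto_mult tendsto_const)
      fix x
      have "(\<lambda>n. ?T (inverse (real (Suc n))) x) \<longlonglongrightarrow> x + (c + 0 * (x \<bullet> e) - x \<bullet> e) *\<^sub>R e"
        by (intro tendsto_intros LIMSEQ_inverse_real_of_nat)
      then show "(\<lambda>n. f (?T (inverse (real (Suc n))) x)) \<longlonglongrightarrow> f (x + (c - x \<bullet> e) *\<^sub>R e)"
        using fc by (auto intro: continuous_on_tendsto_compose[OF fc])
    qed
    fix n
    show "AE x in lborel. norm (indicator ?B x * f (?T (inverse (real (Suc n))) x)) \<le> M * indicator (cball 0 ?R) x"
    proof (rule AE_I2)
      fix x
      let ?h = "inverse (real (Suc n))"
      have h: "?h > 0" "?h \<le> 1" by (auto simp: field_simps)
      show "norm (indicator ?B x * f (?T ?h x)) \<le> M * indicator (cball 0 ?R) x"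
      proof (cases "x \<in> ?B \<and> norm x > ?R")
        case True
        then have "\<bar>c + ?h * (x \<bullet> e) - x \<bullet> e\<bar> \<le> \<bar>c\<bar> + 1 + 1"
        proof -
          have "0 \<le> ?h * (x \<bullet> e)" "?h * (x \<bullet> e) \<le> 1"
            using True h by (auto intro!: mult_le_one mult_nonneg_nonneg simp del: of_nat_Suc)
          moreover have "0 \<le> x \<bullet> e" "x \<bullet> e < 1" using True by auto
          ultimately show ?thesis by linarith
        qed
        then have "norm ((c + ?h * (x \<bullet> e) - x \<bullet> e) *\<^sub>R e) \<le> \<bar>c\<bar> + 2" using e by simp
        then have "norm (?T ?h x) > R"
          using True norm_diff_ineq[of x "(c + ?h * (x \<bullet> e) - x \<bullet> e) *\<^sub>R e"] by linarith
        then have "f (?T ?h x) = 0" using K(2) R(2) by force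
        then show ?thesis using M by simp
      next
        case False
        then show ?thesis using M(2)[of "?T ?h x"] M(1) by (auto simp: indicator_def)
      qed
    qed
  qed measurable
  moreover have "(\<lambda>n. \<integral>x. indicator ?B x * f (?T (inverse (real (Suc n))) x) \<partial>lborel)
      \<longlonglongrightarrow> (\<integral>x. indicator ?S x * pd e f x \<partial>lborel)"
    using difference_quotient_tendsto_integral[OF diff cont e K S(1)]
    by (subst eq[symmetric]) (simp_all del: of_nat_Suc)
  ultimately show ?thesis by (rule LIMSEQ_unique[rotated])
qed

section \<open>Weak gradients\<close>

text \<open>Open boxes are stable under intersection and generate the Borel sets, so the Dynkin
  argument extends the hypothesis to all Borel sets.\<close>

lemma AE_zero_if_box_integrals_zero:
  fixes f :: "'a::euclidean_space \<Rightarrow> real"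
  assumes f: "integrable lborel f"
    and box: "\<And>a b. (\<integral>x. indicator (box a b) x * f x \<partial>lborel) = 0"
  shows "AE x in lborel. f x = 0"
proof (rule sigma_finite_measure.density_zero[OF sigma_finite_lborel f])
  have [measurable]: "f \<in> borel_measurable borel"
    using borel_measurable_integrable[OF f] by simp
  have fi: "integrable lborel (\<lambda>x. indicator A x * f x)" if "A \<in> sets borel" for A
    using integrable_mult_indicator[OF _ f, of A] that by simp
  \<comment> \<open>The integral over the whole space is needed for complements; it is the limit
    over growing boxes.\<close>
  have UNIV: "(\<integral>x. f x \<partial>lborel) = 0"
  proof -
    have "(\<lambda>n. \<integral>x. indicator (box (- real n *\<^sub>R One) (real n *\<^sub>R One)) x * f x \<partial>lborel) \<longlonglongrightarrow> (\<integral>x. f x \<partial>lborel)"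
    proof (rule integral_dominated_convergence[where w = "\<lambda>x. \<bar>f x\<bar>"])
      show "integrable lborel (\<lambda>x. \<bar>f x\<bar>)" using f by simp
      show "AE x in lborel. (\<lambda>n. indicator (box (- real n *\<^sub>R One) (real n *\<^sub>R One)) x * f x) \<longlonglongrightarrow> f x"
      proof (rule AE_I2)
        fix x :: 'a
        obtain N where N: "real N > norm x" using reals_Archimedean2 by blast
        have "eventually (\<lambda>n. indicator (box (- real n *\<^sub>R One) (real n *\<^sub>R One)) x * f x = f x) sequentially"
          using eventually_ge_at_top[of N]
        proof eventually_elim
          case (elim n)
          have "\<bar>x \<bullet> i\<bar> < real n" if "i \<in> Basis" for i
            using Basis_le_norm[OF that, of x] N elim by linarith
          then have "x \<in> box (- real n *\<^sub>R One) (real n *\<^sub>R One)"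
            by (force simp: mem_box inner_simps abs_less_iff)
          then show ?case by simp
        qed
        then show "(\<lambda>n. indicator (box (- real n *\<^sub>R One) (real n *\<^sub>R One)) x * f x) \<longlonglongrightarrow> f x"
          by (rule tendsto_eventually)
      qed
    qed (auto simp: indicator_def)
    then show ?thesis by (simp add: box LIMSEQ_const_iff)
  qed
  fix A :: "'a set" assume "A \<in> sets lborel"
  then have A: "A \<in> sigma_sets UNIV (range (\<lambda>(a, b). box a b))"
    by (simp add: borel_eq_box)
  have stable: "Int_stable (range (\<lambda>(a, b). box a b :: 'a set))"
    by (auto simp: Int_stable_def box_Int_box)
  have sub: "range (\<lambda>(a, b). box a b) \<subseteq> Pow (UNIV :: 'a set)" by simp
  from stable sub A have "A \<in> sets borel \<and> (\<integral>x. indicator A x * f x \<partial>lborel) = 0"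
  proof (induction A rule: sigma_sets_induct_disjoint)
    case (compl A)
    then have [measurable]: "A \<in> sets borel" by simp
    have "(\<integral>x. indicator (UNIV - A) x * f x \<partial>lborel) = (\<integral>x. f x - indicator A x * f x \<partial>lborel)"
      by (intro Bochner_Integration.integral_cong) (auto simp: indicator_def)
    also have "\<dots> = 0" using compl UNIV f fi by (subst Bochner_Integration.integral_diff) auto
    finally show ?case by simp
  next
    case (union A)
    then have [measurable]: "A i \<in> sets borel" for i by auto
    have "set_lebesgue_integral lborel (\<Union>i. A i) f = (\<Sum>i. set_lebesgue_integral lborel (A i) f)"
      using union f fi
      by (intro lebesgue_integral_countable_add) (auto simp: disjoint_family_on_def set_integrable_def)
    then show ?case using union by (simp add: set_lebesgue_integral_def)
  qed (use box in auto)
  then show "set_lebesgue_integral lborel A f = 0" by (simp add: set_lebesgue_integral_def)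
qed

lemma flat_0_le_1: "flat 0 t \<le> 1"
  by (simp add: flat_def)

text \<open>The product is positive exactly in the open box, and \<open>flat 0 (n * p)\<close> tends
  to 1 for \<open>p > 0\<close>. So these are smooth approximations of the indicator, with values in
  [0, 1] and support in one fixed closed box.\<close>

definition box_bump :: "'a::euclidean_space \<Rightarrow> 'a \<Rightarrow> nat \<Rightarrow> 'a \<Rightarrow> real" where
  "box_bump a b n x =
     flat 0 (real n * (\<Prod>i\<in>Basis. flat 0 (x \<bullet> i - a \<bullet> i) * flat 0 (b \<bullet> i - x \<bullet> i)))"

lemma smooth_box_bump: "smooth (box_bump a b n)"
  unfolding box_bump_def
  by (intro smooth_flat smooth_mult smooth_prod smooth_diff) simp_all

lemma box_bump_outside: "x \<notin> box a b \<Longrightarrow> box_bump a b n x = 0"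
proof -
  assume "x \<notin> box a b"
  then obtain i where "i \<in> Basis" "flat 0 (x \<bullet> i - a \<bullet> i) * flat 0 (b \<bullet> i - x \<bullet> i) = 0"
    by (force simp: mem_box)
  then have "(\<Prod>i\<in>Basis. flat 0 (x \<bullet> i - a \<bullet> i) * flat 0 (b \<bullet> i - x \<bullet> i)) = 0"
    by (intro prod_zero) auto
  then show ?thesis by (simp only: box_bump_def mult_zero_right) simp
qed

lemma box_bump_tendsto: "(\<lambda>n. box_bump a b n x) \<longlonglongrightarrow> indicator (box a b) x"
proof (cases "x \<in> box a b")
  case True
  define p where "p = (\<Prod>i\<in>Basis. flat 0 (x \<bullet> i - a \<bullet> i) * flat 0 (b \<bullet> i - x \<bullet> i))"
  have p: "p > 0" unfolding p_def using True by (intro prod_pos) (auto simp: mem_box)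
  have "(\<lambda>n. exp (- 1 / (real n * p))) \<longlonglongrightarrow> exp 0"
  proof (rule tendsto_exp)
    have "(\<lambda>n. (- 1 / p) * (1 / real n)) \<longlonglongrightarrow> (- 1 / p) * 0"
      by (intro tendsto_intros lim_1_over_n)
    then show "(\<lambda>n. - 1 / (real n * p)) \<longlonglongrightarrow> 0" by (simp add: mult.commute)
  qed
  moreover have "eventually (\<lambda>n. exp (- 1 / (real n * p)) = box_bump a b n x) sequentially"
    using eventually_gt_at_top[of "0::nat"]
    by eventually_elim (use p in \<open>simp add: box_bump_def flip: p_def\<close>, simp add: flat_def)
  ultimately show ?thesis using True by (auto intro: Lim_transform_eventually)
next
  case False
  then show ?thesis by (simp add: box_bump_outside)
qed

lemma box_bump_test_function: "cbox a b \<subseteq> \<Omega> \<Longrightarrow> box_bump a b n \<in> test_functions \<Omega>"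
  unfolding test_functions_def using smooth_box_bump[of a b n] box_bump_outside[of _ a b n] box_subset_cbox[of a b]
  by (auto intro!: exI[of _ "cbox a b"])

lemma integral_lebesgue_on:
  fixes f :: "'a::euclidean_space \<Rightarrow> real"
  shows "\<Omega> \<in> sets borel \<Longrightarrow> integral\<^sup>L (lebesgue_on \<Omega>) f = (\<integral>x. indicator \<Omega> x * f x \<partial>lebesgue)"
  by (subst integral_restrict_space) auto

lemma integrable_lebesgue_on_iff:
  fixes f :: "'a::euclidean_space \<Rightarrow> real"
  shows "\<Omega> \<in> sets borel \<Longrightarrow> integrable (lebesgue_on \<Omega>) f \<longleftrightarrow> integrable lebesgue (\<lambda>x. indicator \<Omega> x * f x)"
  by (subst integrable_restrict_space) auto

text \<open>Testing with \<open>box_bump\<close> and passing to the limit shows that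
  \<open>f\<close> has zero integral over every box whose closure lies in \<open>\<Omega>\<close>.
  Hence \<open>f\<close> vanishes almost everywhere in each such box, and countably many of them
  cover \<open>\<Omega>\<close>.\<close>

lemma fundamental_lemma_variations:
  fixes f :: "'a::euclidean_space \<Rightarrow> real"
  assumes \<Omega>: "open \<Omega>"
    and fint: "\<And>a b. cbox a b \<subseteq> \<Omega> \<Longrightarrow> integrable (lebesgue_on (cbox a b)) f"
    and zero: "\<And>\<psi>. \<psi> \<in> test_functions \<Omega> \<Longrightarrow> (\<integral>x. f x * \<psi> x \<partial>lebesgue_on \<Omega>) = 0"
  shows "AE x in lebesgue_on \<Omega>. f x = 0"
proof -
  have box0: "(\<integral>x. indicator (box a b) x * f x \<partial>lebesgue) = 0" if ab: "cbox a b \<subseteq> \<Omega>" for a b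
  proof -
    have [measurable]: "(\<lambda>x. indicator (cbox a b) x * f x) \<in> borel_measurable lebesgue"
      using fint[OF ab] borel_measurable_integrable by (simp add: integrable_lebesgue_on_iff)
    have [measurable]: "indicat_real (box a b) \<in> borel_measurable lebesgue"
      by (rule borel_measurable_indicator) auto
    have bm [measurable]: "box_bump a b n \<in> borel_measurable lebesgue" for n
      using smooth_continuous_on[OF smooth_box_bump[of a b n], of UNIV]
      by (intro measurable_completion) (simp add: borel_measurable_continuous_onI)
    have ff: "indicator (cbox a b) x * f x * box_bump a b n x = f x * box_bump a b n x" for n x
      using box_bump_outside[of x a b n] box_subset_cbox[of a b] by (auto simp: indicator_def)
    have bb: "indicator (cbox a b) x * f x * indicator (box a b) x = indicator (box a b) x * f x" for x
      using box_subset_cbox[of a b] by (auto simp: indicator_def)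
    have "(\<lambda>n. \<integral>x. indicator (cbox a b) x * f x * box_bump a b n x \<partial>lebesgue)
        \<longlonglongrightarrow> (\<integral>x. indicator (cbox a b) x * f x * indicator (box a b) x \<partial>lebesgue)"
    proof (rule integral_dominated_convergence[where w = "\<lambda>x. \<bar>indicator (cbox a b) x * f x\<bar>"])
      show "integrable lebesgue (\<lambda>x. \<bar>indicator (cbox a b) x * f x\<bar>)"
        using fint[OF ab] by (simp add: integrable_lebesgue_on_iff)
      show "AE x in lebesgue. (\<lambda>n. indicator (cbox a b) x * f x * box_bump a b n x)
          \<longlonglongrightarrow> indicator (cbox a b) x * f x * indicator (box a b) x"
        by (intro AE_I2 tendsto_mult tendsto_const box_bump_tendsto)
      show "AE x in lebesgue. norm (indicator (cbox a b) x * f x * box_bump a b n x)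
          \<le> \<bar>indicator (cbox a b) x * f x\<bar>" for n
        by (intro AE_I2) (auto simp: abs_mult box_bump_def flat_0_le_1 intro!: mult_left_le mult_nonneg_nonneg)
    qed measurable
    moreover have "(\<integral>x. indicator (cbox a b) x * f x * box_bump a b n x \<partial>lebesgue) = 0" for n
    proof -
      have "(\<integral>x. f x * box_bump a b n x \<partial>lebesgue_on \<Omega>) = (\<integral>x. indicator (cbox a b) x * f x * box_bump a b n x \<partial>lebesgue)"
      proof -
        have e: "indicator \<Omega> x * (f x * box_bump a b n x) = f x * box_bump a b n x" for x
          using box_bump_outside[of x a b n] ab box_subset_cbox[of a b] by (cases "x \<in> box a b") auto
        show ?thesis unfolding ff using \<Omega> by (simp only: integral_lebesgue_on borel_open e)
      qed
      then show ?thesis using zero[OF box_bump_test_function[OF ab]] by simp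
    qed
    ultimately show ?thesis by (simp add: LIMSEQ_const_iff bb)
  qed
  have cb: "AE x in lebesgue. x \<in> cbox a b \<longrightarrow> f x = 0" if ab: "cbox a b \<subseteq> \<Omega>" for a b
  proof -
    have bound: "AE x in lebesgue. x \<notin> cbox a b - box a b"
      by (rule AE_not_in) (simp add: negligible_frontier_interval flip: negligible_iff_null_sets)
    have "integrable lebesgue (\<lambda>x. indicator (box a b) x *\<^sub>R (indicator (cbox a b) x * f x))"
      using fint[OF ab] by (intro integrable_mult_indicator) (auto simp: integrable_lebesgue_on_iff)
    moreover have "indicator (box a b) x *\<^sub>R (indicator (cbox a b) x * f x) = indicator (box a b) x * f x" for x
      using box_subset_cbox[of a b] by (auto simp: indicator_def)
    ultimately have gi: "integrable lebesgue (\<lambda>x. indicator (box a b) x * f x)"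
      by (simp only:)
    \<comment> \<open>The restricted function is only Lebesgue measurable, whereas the criterion
      with boxes concerns Borel functions; hence the Borel representative.\<close>
    obtain g where g [measurable]: "g \<in> borel_measurable lborel"
        and eq: "AE x in lborel. indicator (box a b) x * f x = g x"
      using completion_ex_borel_measurable_real[OF borel_measurable_integrable[OF gi]] by blast
    have fm: "(\<lambda>x. indicator (box a b) x * f x) \<in> borel_measurable lebesgue"
      using gi by (rule borel_measurable_integrable)
    have gm: "g \<in> borel_measurable lebesgue" using g by (rule measurable_completion)
    have "AE x in lborel. g x = 0"
    proof (rule AE_zero_if_box_integrals_zero)
      have "integrable lebesgue g"
        using gi AE_completion[OF eq] fm gm by (subst integrable_cong_AE[symmetric]) auto
      then show "integrable lborel g" using integrable_completion[OF g] by simp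
      fix c d :: 'a
      have im: "indicat_real (box c d) \<in> borel_measurable lebesgue"
        by (rule borel_measurable_indicator) auto
      obtain p q where pq: "box c d \<inter> box a b = box p q" using box_Int_box by blast
      have "(\<integral>x. indicator (box c d) x * g x \<partial>lborel) = (\<integral>x. indicator (box c d) x * g x \<partial>lebesgue)"
        using g by (intro integral_completion[symmetric]) measurable
      also have "\<dots> = (\<integral>x. indicator (box c d) x * (indicator (box a b) x * f x) \<partial>lebesgue)"
        using AE_completion[OF eq] by (intro integral_cong_AE borel_measurable_times[OF im fm] borel_measurable_times[OF im gm]) auto
      also have "\<dots> = (\<integral>x. indicator (box p q) x * f x \<partial>lebesgue)"
        unfolding pq[symmetric] by (simp add: indicator_inter_arith mult.assoc)
      also have "\<dots> = 0"
      proof (cases "box p q = {}")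
        case False
        have "closure (box p q) \<subseteq> closure (box a b)" using pq by (intro closure_mono) auto
        also have "\<dots> \<subseteq> cbox a b" by (intro closure_minimal box_subset_cbox closed_cbox)
        finally have "cbox p q \<subseteq> \<Omega>" using False ab by (simp add: closure_box)
        then show ?thesis by (rule box0)
      qed simp
      finally show "(\<integral>x. indicator (box c d) x * g x \<partial>lborel) = 0" .
    qed
    then have "AE x in lborel. indicator (box a b) x * f x = 0" using eq by eventually_elim simp
    then have "AE x in lebesgue. indicator (box a b) x * f x = 0" by (rule AE_completion)
    then show ?thesis using bound by eventually_elim (auto simp: indicator_def)
  qed
  \<comment> \<open>Boxes with rational corners, encoded by a pair of rationals for every basis
    vector.\<close>
  let ?a = "\<lambda>f :: 'a \<Rightarrow> real \<times> real. \<Sum>i\<in>Basis. fst (f i) *\<^sub>R i"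
  let ?b = "\<lambda>f :: 'a \<Rightarrow> real \<times> real. \<Sum>i\<in>Basis. snd (f i) *\<^sub>R i"
  let ?I = "{f\<in>Basis \<rightarrow>\<^sub>E \<rat> \<times> \<rat>. cbox (?a f) (?b f) \<subseteq> \<Omega>}"
  have "countable ?I"
    by (rule countable_subset[of _ "Basis \<rightarrow>\<^sub>E \<rat> \<times> \<rat>"]) (auto intro!: countable_PiE countable_rat)
  then have "AE x in lebesgue. \<forall>h\<in>?I. x \<in> cbox (?a h) (?b h) \<longrightarrow> f x = 0"
    using cb by (subst AE_ball_countable) auto
  then have "AE x in lebesgue. x \<in> \<Omega> \<longrightarrow> f x = 0"
  proof eventually_elim
    case (elim x)
    show ?case
    proof
      assume "x \<in> \<Omega>"
      then have "x \<in> (\<Union>h\<in>?I. cbox (?a h) (?b h))" using open_UNION_cbox[OF \<Omega>] by blast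
      then show "f x = 0" using elim by blast
    qed
  qed
  then show ?thesis using \<Omega> by (subst AE_restrict_space_iff) auto
qed

section \<open>Smooth functions as Sobolev functions\<close>

definition grad :: "('a::euclidean_space \<Rightarrow> real) \<Rightarrow> 'a \<Rightarrow> 'a" where
  "grad f x = (\<Sum>i\<in>Basis. pd i f x *\<^sub>R i)"

lemma grad_inner_Basis: "i \<in> Basis \<Longrightarrow> grad f x \<bullet> i = pd i f x"
  unfolding grad_def by (rule inner_sum_left_Basis)

lemma continuous_on_grad: "smooth f \<Longrightarrow> continuous_on S (grad f)"
  unfolding grad_def by (intro continuous_intros smooth_continuous_on smooth_pd)

lemma borel_measurable_continuous_lebesgue_on:
  fixes f :: "'a::euclidean_space \<Rightarrow> 'b::euclidean_space"
  assumes "continuous_on UNIV f"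
  shows "f \<in> borel_measurable (lebesgue_on \<Omega>)"
proof -
  have "f \<in> borel_measurable lebesgue"
    using assms by (intro measurable_completion) (simp add: borel_measurable_continuous_onI)
  then show ?thesis by (rule measurable_restrict_space1)
qed

lemma integrable_lebesgue_on_bounded:
  fixes f :: "'a::euclidean_space \<Rightarrow> 'b::euclidean_space"
  assumes "open \<Omega>" "bounded \<Omega>" "f \<in> borel_measurable (lebesgue_on \<Omega>)" "\<And>x. x \<in> \<Omega> \<Longrightarrow> norm (f x) \<le> B"
  shows "integrable (lebesgue_on \<Omega>) f"
proof -
  interpret finite_measure "lebesgue_on \<Omega>"
    using assms by (intro finite_measure_lebesgue_on) (auto intro: bounded_set_imp_lmeasurable)
  show ?thesis using assms by (intro integrable_const_bound[where B = B]) auto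
qed

lemma locally_integrable_continuous:
  fixes f :: "'a::euclidean_space \<Rightarrow> 'b::euclidean_space"
  assumes "continuous_on UNIV f"
  shows "locally_integrable \<Omega> f"
  unfolding locally_integrable_def
proof (intro allI impI)
  fix K assume K: "compact K \<and> K \<subseteq> \<Omega>"
  obtain B where B: "\<And>x. x \<in> K \<Longrightarrow> norm (f x) \<le> B"
    using K compact_imp_bounded[OF compact_continuous_image[OF continuous_on_subset[OF assms]], of K]
    by (auto simp: bounded_iff)
  interpret finite_measure "lebesgue_on K"
    using K by (intro finite_measure_lebesgue_on) (auto intro: lmeasurable_compact)
  show "integrable (lebesgue_on K) f"
    using borel_measurable_continuous_lebesgue_on[OF assms] B
    by (intro integrable_const_bound[where B = B]) auto
qed

lemma test_functionE:
  assumes "\<psi> \<in> test_functions \<Omega>"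
  obtains K where "smooth \<psi>" "compact K" "K \<subseteq> \<Omega>" "\<And>x. x \<notin> K \<Longrightarrow> \<psi> x = 0"
  using assms unfolding test_functions_def by blast

lemma locally_integrable_times_test:
  fixes f :: "'a::euclidean_space \<Rightarrow> real"
  assumes "open \<Omega>" "locally_integrable \<Omega> f" "\<psi> \<in> test_functions \<Omega>"
  shows "integrable (lebesgue_on \<Omega>) (\<lambda>x. f x * \<psi> x)"
proof -
  obtain K where K: "smooth \<psi>" "compact K" "K \<subseteq> \<Omega>" "\<And>x. x \<notin> K \<Longrightarrow> \<psi> x = 0"
    using test_functionE[OF assms(3)] by metis
  have c: "continuous_on UNIV \<psi>" using K(1) by (rule smooth_continuous_on)
  obtain M where M: "M > 0" "\<And>x. \<bar>\<psi> x\<bar> \<le> M"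
    using compact_support_bounded[OF c K(2,4)] by metis
  have Kb: "K \<in> sets borel" using K by (simp add: borel_compact)
  have \<psi>m: "\<psi> \<in> borel_measurable lebesgue"
    using borel_measurable_continuous_lebesgue_on[OF c, of UNIV] by (simp add: lebesgue_on_UNIV_eq)
  have i: "integrable lebesgue (\<lambda>x. indicator K x * f x)"
    using assms(2) K Kb by (simp add: locally_integrable_def integrable_lebesgue_on_iff[symmetric])
  have "integrable lebesgue (\<lambda>x. \<psi> x * (indicator K x * f x))"
  proof (rule Bochner_Integration.integrable_bound[OF integrable_mult_right[OF i, of M]])
    show "(\<lambda>x. \<psi> x * (indicator K x * f x)) \<in> borel_measurable lebesgue"
      using \<psi>m borel_measurable_integrable[OF i] by (rule borel_measurable_times)
    show "AE x in lebesgue. norm (\<psi> x * (indicator K x * f x)) \<le> norm (M * (indicator K x * f x))"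
      using M by (intro AE_I2) (simp only: norm_mult, simp add: mult_right_mono)
  qed
  moreover have "\<psi> x * (indicator K x * f x) = indicator \<Omega> x * (f x * \<psi> x)" for x
    using K(3,4) by (auto simp: indicator_def)
  ultimately show ?thesis
    using assms(1) by (simp only: integrable_lebesgue_on_iff borel_open)
qed

text \<open>Each component of the difference is orthogonal to all test functions, so the fundamental
  lemma applies.\<close>

lemma weak_gradient_unique:
  assumes \<Omega>: "open \<Omega>" and D1: "weak_gradient \<Omega> u D1" and D2: "weak_gradient \<Omega> u D2"
  shows "AE x in lebesgue_on \<Omega>. D1 x = D2 x"
proof -
  have "AE x in lebesgue_on \<Omega>. (D1 x - D2 x) \<bullet> i = 0" if i: "i \<in> Basis" for i
  proof (rule fundamental_lemma_variations[OF \<Omega>])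
    have loc: "locally_integrable \<Omega> (\<lambda>x. D x \<bullet> i)" if "weak_gradient \<Omega> u D" for D
      using that unfolding weak_gradient_def locally_integrable_def by (auto intro: integrable_inner_left)
    show "integrable (lebesgue_on (cbox a b)) (\<lambda>x. (D1 x - D2 x) \<bullet> i)" if "cbox a b \<subseteq> \<Omega>" for a b
      using loc[OF D1] loc[OF D2] that unfolding locally_integrable_def inner_diff_left
      by (intro Bochner_Integration.integrable_diff) auto
    fix \<psi> assume \<psi>: "\<psi> \<in> test_functions \<Omega>"
    have "(\<integral>x. (D1 x - D2 x) \<bullet> i * \<psi> x \<partial>lebesgue_on \<Omega>)
      = (\<integral>x. D1 x \<bullet> i * \<psi> x \<partial>lebesgue_on \<Omega>) - (\<integral>x. D2 x \<bullet> i * \<psi> x \<partial>lebesgue_on \<Omega>)"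
      unfolding inner_diff_left left_diff_distrib
      by (intro Bochner_Integration.integral_diff locally_integrable_times_test \<Omega> \<psi> loc D1 D2)
    also have "\<dots> = 0"
    proof -
      have "(\<integral>x. D x \<bullet> i * \<psi> x \<partial>lebesgue_on \<Omega>) = - (\<integral>x. u x * frechet_derivative \<psi> (at x) i \<partial>lebesgue_on \<Omega>)"
        if "weak_gradient \<Omega> u D" for D
        using that \<psi> i unfolding weak_gradient_def by auto
      then show ?thesis using D1 D2 by simp
    qed
    finally show "(\<integral>x. (D1 x - D2 x) \<bullet> i * \<psi> x \<partial>lebesgue_on \<Omega>) = 0" .
  qed
  then have "AE x in lebesgue_on \<Omega>. \<forall>i\<in>Basis. (D1 x - D2 x) \<bullet> i = 0"
    by (subst AE_ball_countable) (auto intro: countable_finite)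
  then show ?thesis
    by eventually_elim (auto intro: euclidean_eqI simp: inner_diff_left)
qed

lemma pd_mult:
  assumes "f differentiable (at x)" "g differentiable (at x)"
  shows "pd i (\<lambda>x. f x * g x) x = f x * pd i g x + pd i f x * g x"
  using has_derivative_mult[of f _ x UNIV g, OF assms[unfolded frechet_derivative_works]]
  by (rule pd_eq)

text \<open>The product \<open>f x * \<psi> x\<close> has compact support, so its partial
  derivatives have zero integral over the whole space; the product rule then gives the weak
  identity.\<close>

lemma weak_gradient_smooth:
  fixes f :: "'a::euclidean_space \<Rightarrow> real"
  assumes \<Omega>: "open \<Omega>" and f: "smooth f"
  shows "weak_gradient \<Omega> f (grad f)"
  unfolding weak_gradient_def
proof (intro conjI ballI)
  show lf: "locally_integrable \<Omega> f" "locally_integrable \<Omega> (grad f)"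
    using f by (auto intro!: locally_integrable_continuous smooth_continuous_on continuous_on_grad)
  fix \<psi> and i :: 'a assume \<psi>: "\<psi> \<in> test_functions \<Omega>" and i: "i \<in> Basis"
  obtain K where K: "smooth \<psi>" "compact K" "K \<subseteq> \<Omega>" "\<And>x. x \<notin> K \<Longrightarrow> \<psi> x = 0"
    using test_functionE[OF \<psi>] by metis
  have z: "pd i \<psi> x = 0" if "x \<notin> K" for x
    using K that by (intro pd_vanishes) (auto intro: compact_imp_closed)
  let ?F = "\<lambda>x. f x * \<psi> x"
  have F: "smooth ?F" using f K by (intro smooth_mult)
  have pdF: "pd i ?F x = f x * pd i \<psi> x + pd i f x * \<psi> x" for x
    using f K by (intro pd_mult smooth_differentiable)
  have int: "integrable lborel (\<lambda>x. f x * pd i \<psi> x)" "integrable lborel (\<lambda>x. pd i f x * \<psi> x)"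
    using K z f i by (auto intro!: integrable_continuous_compact_support[of _ K] smooth_continuous_on smooth_mult smooth_pd)
  have "0 = (\<integral>x. indicator UNIV x * pd i ?F x \<partial>lborel)"
    using K F i
    by (intro integral_pd_invariant[symmetric]) (auto intro!: smooth_continuous_on smooth_pd smooth_differentiable)
  also have "\<dots> = (\<integral>x. f x * pd i \<psi> x \<partial>lborel) + (\<integral>x. pd i f x * \<psi> x \<partial>lborel)"
    unfolding pdF using int by simp
  finally have eq: "(\<integral>x. f x * pd i \<psi> x \<partial>lborel) = - (\<integral>x. pd i f x * \<psi> x \<partial>lborel)" by simp
  have conv: "(\<integral>x. h x \<partial>lebesgue_on \<Omega>) = (\<integral>x. h x \<partial>lborel)"
    if "integrable lborel h" "\<And>x. x \<notin> K \<Longrightarrow> h x = 0" for h :: "'a \<Rightarrow> real"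
  proof -
    have "indicator \<Omega> x * h x = h x" for x using that(2) K(3) by (auto simp: indicator_def)
    then show ?thesis using \<Omega> that(1)
      by (simp only: integral_lebesgue_on borel_open) (auto intro: integral_completion)
  qed
  show "(\<integral>x. f x * frechet_derivative \<psi> (at x) i \<partial>lebesgue_on \<Omega>)
      = - (\<integral>x. grad f x \<bullet> i * \<psi> x \<partial>lebesgue_on \<Omega>)"
    using eq int K(4) z i by (simp add: grad_inner_Basis conv)
qed

lemma wgrad_weak_gradient: "u \<in> H1 \<Omega> \<Longrightarrow> weak_gradient \<Omega> u (wgrad \<Omega> u)"
  unfolding H1_def wgrad_def using someI[of "weak_gradient \<Omega> u"] by blast

text \<open>\<open>wgrad\<close> picks an arbitrary weak gradient, so it agrees with the classical
  gradient only up to a null set.\<close>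

lemma wgrad_smooth_AE:
  assumes "open \<Omega>" "smooth f"
  shows "AE x in lebesgue_on \<Omega>. wgrad \<Omega> f x = grad f x"
proof -
  have "weak_gradient \<Omega> f (grad f)" using assms by (rule weak_gradient_smooth)
  moreover from this have "weak_gradient \<Omega> f (wgrad \<Omega> f)"
    unfolding wgrad_def using someI[of "weak_gradient \<Omega> f"] by blast
  ultimately show ?thesis
    using assms(1) weak_gradient_unique by blast
qed

lemma borel_measurable_lebesgue_on_AE:
  fixes f g :: "'a::euclidean_space \<Rightarrow> 'b::euclidean_space"
  assumes "\<Omega> \<in> sets lebesgue" "f \<in> borel_measurable (lebesgue_on \<Omega>)" "AE x in lebesgue_on \<Omega>. f x = g x"
  shows "g \<in> borel_measurable (lebesgue_on \<Omega>)"
proof -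
  have "(\<lambda>x. if x \<in> \<Omega> then f x else 0) \<in> borel_measurable lebesgue"
    using assms(1,2) by (simp add: borel_measurable_if)
  moreover have "AE x in lebesgue. (if x \<in> \<Omega> then f x else 0) = (if x \<in> \<Omega> then g x else 0)"
  proof -
    have "AE x in lebesgue. x \<in> \<Omega> \<longrightarrow> f x = g x"
      using assms(1,3) by (subst (asm) AE_restrict_space_iff) auto
    then show ?thesis by eventually_elim simp
  qed
  ultimately have "(\<lambda>x. if x \<in> \<Omega> then g x else 0) \<in> borel_measurable lebesgue"
    by (rule borel_measurable_AE)
  then show ?thesis using assms(1) by (simp add: borel_measurable_if)
qed

lemma square_integrable_AE:
  fixes f g :: "'a::euclidean_space \<Rightarrow> 'b::euclidean_space"
  assumes "\<Omega> \<in> sets lebesgue" "square_integrable (lebesgue_on \<Omega>) f" "AE x in lebesgue_on \<Omega>. f x = g x"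
  shows "square_integrable (lebesgue_on \<Omega>) g"
proof -
  have g: "g \<in> borel_measurable (lebesgue_on \<Omega>)" and f: "f \<in> borel_measurable (lebesgue_on \<Omega>)"
    using borel_measurable_lebesgue_on_AE[OF assms(1) _ assms(3)] assms(2)
    by (auto simp: square_integrable_def)
  have "integrable (lebesgue_on \<Omega>) (\<lambda>x. (norm (f x))\<^sup>2) \<longleftrightarrow> integrable (lebesgue_on \<Omega>) (\<lambda>x. (norm (g x))\<^sup>2)"
    using f g assms(3) by (intro integrable_cong_AE) auto
  then show ?thesis using g assms(2) by (simp add: square_integrable_def)
qed

lemma square_integrable_wgrad:
  assumes "open \<Omega>" "u \<in> H1 \<Omega>"
  shows "square_integrable (lebesgue_on \<Omega>) (wgrad \<Omega> u)"
proof -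
  obtain D where "weak_gradient \<Omega> u D" "square_integrable (lebesgue_on \<Omega>) D"
    using assms(2) by (auto simp: H1_def)
  then show ?thesis
    using assms by (intro square_integrable_AE[OF _ _ weak_gradient_unique[OF assms(1) _ wgrad_weak_gradient]]) auto
qed

lemma smooth_in_H1:
  assumes "open \<Omega>" "bounded \<Omega>" "smooth f"
  shows "f \<in> H1 \<Omega>"
proof -
  have sq: "square_integrable (lebesgue_on \<Omega>) h" if c: "continuous_on UNIV h"
    for h :: "'a \<Rightarrow> 'b::euclidean_space"
  proof -
    have "compact (closure \<Omega>)" using assms(2) by simp
    moreover have "continuous_on (closure \<Omega>) (\<lambda>x. (norm (h x))\<^sup>2)"
      using c by (intro continuous_intros) (auto intro: continuous_on_subset)
    ultimately have "bounded ((\<lambda>x. (norm (h x))\<^sup>2) ` closure \<Omega>)"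
      by (intro compact_imp_bounded compact_continuous_image)
    then obtain B where B: "\<And>x. x \<in> closure \<Omega> \<Longrightarrow> norm ((norm (h x))\<^sup>2) \<le> B"
      unfolding bounded_iff by auto
    have "integrable (lebesgue_on \<Omega>) (\<lambda>x. (norm (h x))\<^sup>2)"
      using assms B c closure_subset
      by (intro integrable_lebesgue_on_bounded borel_measurable_continuous_lebesgue_on continuous_intros) blast+
    then show ?thesis
      using c by (simp add: square_integrable_def borel_measurable_continuous_lebesgue_on)
  qed
  show ?thesis
    using weak_gradient_smooth[OF assms(1,3)] sq[OF smooth_continuous_on[OF assms(3)]]
      sq[OF continuous_on_grad[OF assms(3)]]
    by (auto simp: H1_def)
qed

text \<open>Equality holds everywhere: both functions admit exactly the same weak gradients, so the
  choice operator is applied to the same predicate.\<close>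

lemma wgrad_cong_AE:
  assumes "u \<in> H1 \<Omega>" "v \<in> H1 \<Omega>" "AE x in lebesgue_on \<Omega>. u x = v x"
  shows "wgrad \<Omega> u = wgrad \<Omega> v"
proof -
  have meas: "u \<in> borel_measurable (lebesgue_on \<Omega>)" "v \<in> borel_measurable (lebesgue_on \<Omega>)"
    using assms by (auto simp: H1_def square_integrable_def)
  have loc: "locally_integrable \<Omega> u" "locally_integrable \<Omega> v"
    using assms by (auto simp: H1_def weak_gradient_def)
  have "(\<integral>x. u x * frechet_derivative \<psi> (at x) i \<partial>lebesgue_on \<Omega>)
    = (\<integral>x. v x * frechet_derivative \<psi> (at x) i \<partial>lebesgue_on \<Omega>)"
    if "\<psi> \<in> test_functions \<Omega>" "i \<in> Basis" for \<psi> i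
  proof -
    have "smooth \<psi>" using that(1) by (rule test_functionE)
    then have "pd i \<psi> \<in> borel_measurable (lebesgue_on \<Omega>)"
      using that(2) by (intro borel_measurable_continuous_lebesgue_on smooth_continuous_on smooth_pd)
    then show ?thesis using meas assms(3)
      by (intro integral_cong_AE borel_measurable_times) auto
  qed
  then have "weak_gradient \<Omega> u D \<longleftrightarrow> weak_gradient \<Omega> v D" for D
    using loc by (simp add: weak_gradient_def)
  then show ?thesis by (simp add: wgrad_def)
qed

section \<open>Flat boundary parts\<close>

lemma has_derivative_grad:
  assumes "f differentiable (at x)"
  shows "(f has_derivative (\<lambda>h. h \<bullet> grad f x)) (at x)"
proof -
  have "linear (frechet_derivative f (at x))" using assms by (rule linear_frechet_derivative)
  then have *: "frechet_derivative f (at x) (\<Sum>i\<in>Basis. (h \<bullet> i) *\<^sub>R i) = (\<Sum>i\<in>Basis. (h \<bullet> i) * pd i f x)" for h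
    by (simp add: linear_sum linear_cmul)
  have "frechet_derivative f (at x) h = h \<bullet> grad f x" for h
    using *[of h] by (simp only: euclidean_representation grad_def inner_sum_right inner_scaleR_right mult.commute)
  then have "frechet_derivative f (at x) = (\<lambda>h. h \<bullet> grad f x)" by (rule ext)
  then show ?thesis using assms frechet_derivative_works by metis
qed

lemma GDERIV_line:
  assumes "GDERIV \<psi> (x + t *\<^sub>R v) :> d"
  shows "((\<lambda>t. \<psi> (x + t *\<^sub>R v)) has_real_derivative v \<bullet> d) (at t)"
proof -
  have "((\<lambda>t. x + t *\<^sub>R v) has_derivative (\<lambda>h. h *\<^sub>R v)) (at t)"
    by (auto intro!: derivative_eq_intros)
  from has_derivative_compose[OF this assms[unfolded gderiv_def]]
  moreover have "(\<lambda>h. (h *\<^sub>R v) \<bullet> d) = (*) (v \<bullet> d)" by (simp add: fun_eq_iff mult.commute)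
  ultimately show ?thesis by (simp only: has_field_derivative_def)
qed

text \<open>\<open>local_graph\<close> does not say that its centre lies on the graph. A boundary
  point of the open set is not in it, which gives one inequality; it is a limit of points of the
  set, which by continuity gives the other.\<close>

lemma local_graph_frontier:
  assumes g: "local_graph \<Omega> x \<nu> \<psi>" and c: "isCont \<psi> x" and x: "x \<in> frontier \<Omega>" and o: "open \<Omega>"
  shows "x \<bullet> \<nu> = \<psi> x"
proof -
  obtain r where r: "r > 0" "\<Omega> \<inter> ball x r = {y \<in> ball x r. y \<bullet> \<nu> < \<psi> y}"
    using g by (auto simp: local_graph_def)
  have "x \<notin> \<Omega>" using x o by (simp add: frontier_def interior_open)
  moreover have "x \<in> ball x r" using r by simp
  ultimately have ge: "x \<bullet> \<nu> \<ge> \<psi> x" using r(2) by fastforce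
  have "x \<in> closure \<Omega>" using x by (simp add: frontier_def)
  then obtain s where s: "\<And>n. s n \<in> \<Omega>" "s \<longlonglongrightarrow> x" by (auto simp: closure_sequential)
  have "eventually (\<lambda>n. s n \<in> ball x r) sequentially"
    by (rule topological_tendstoD[OF s(2)]) (use r(1) in auto)
  then have "eventually (\<lambda>n. s n \<bullet> \<nu> \<le> \<psi> (s n)) sequentially"
  proof eventually_elim
    case (elim n)
    then have "s n \<in> {y \<in> ball x r. y \<bullet> \<nu> < \<psi> y}" using r(2) s(1) by blast
    then show ?case by simp
  qed
  moreover have "(\<lambda>n. s n \<bullet> \<nu>) \<longlonglongrightarrow> x \<bullet> \<nu>" by (intro tendsto_intros s(2))
  moreover have "(\<lambda>n. \<psi> (s n)) \<longlonglongrightarrow> \<psi> x" using c s(2) by (rule isCont_tendsto_compose)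
  ultimately have "x \<bullet> \<nu> \<le> \<psi> x" using tendsto_le[OF sequentially_bot] by blast
  with ge show ?thesis by simp
qed

text \<open>The defining function \<open>y \<bullet> \<nu> - \<psi> y\<close> vanishes at
  \<open>x\<close> and has derivative \<open>v \<bullet> (\<nu> - d)\<close> along \<open>v\<close>;
  its sign decides on which side of the boundary short steps end.\<close>

lemma local_graph_cone:
  assumes g: "local_graph \<Omega> x \<nu> \<psi>" and d: "GDERIV \<psi> x :> d" and x: "x \<bullet> \<nu> = \<psi> x"
  shows "v \<bullet> (\<nu> - d) < 0 \<Longrightarrow> eventually (\<lambda>t. x + t *\<^sub>R v \<in> \<Omega>) (at_right 0)"
    and "v \<bullet> (\<nu> - d) > 0 \<Longrightarrow> eventually (\<lambda>t. x + t *\<^sub>R v \<notin> \<Omega>) (at_right 0)"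
proof -
  obtain r where r: "r > 0" "\<Omega> \<inter> ball x r = {y \<in> ball x r. y \<bullet> \<nu> < \<psi> y}"
    using g by (auto simp: local_graph_def)
  let ?g = "\<lambda>t. (x + t *\<^sub>R v) \<bullet> \<nu> - \<psi> (x + t *\<^sub>R v)"
  have "((\<lambda>t. \<psi> (x + t *\<^sub>R v)) has_real_derivative v \<bullet> d) (at 0)"
    by (rule GDERIV_line) (use d in simp)
  moreover have "((\<lambda>t. (x + t *\<^sub>R v) \<bullet> \<nu>) has_real_derivative v \<bullet> \<nu>) (at 0)"
    unfolding inner_add_left inner_scaleR_left by (auto intro!: derivative_eq_intros)
  ultimately have D: "(?g has_real_derivative v \<bullet> (\<nu> - d)) (at 0)"
    unfolding inner_diff_right by (intro DERIV_diff)
  have "((\<lambda>t. x + t *\<^sub>R v) \<longlongrightarrow> x + 0 *\<^sub>R v) (at_right 0)" by (intro tendsto_intros)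
  then have near: "eventually (\<lambda>t. x + t *\<^sub>R v \<in> ball x r) (at_right 0)"
    by (rule topological_tendstoD) (use r(1) in auto)
  have mem: "x + t *\<^sub>R v \<in> \<Omega> \<longleftrightarrow> ?g t < 0" if "x + t *\<^sub>R v \<in> ball x r" for t
    using r(2) that by (auto simp: set_eq_iff)
  show "eventually (\<lambda>t. x + t *\<^sub>R v \<in> \<Omega>) (at_right 0)" if neg: "v \<bullet> (\<nu> - d) < 0"
  proof -
    obtain e where "e > 0" "\<And>h. 0 < h \<Longrightarrow> h < e \<Longrightarrow> ?g (0 + h) < ?g 0"
      using DERIV_neg_dec_right[OF D neg] by auto
    then have "eventually (\<lambda>t. ?g t < 0) (at_right 0)"
      using x by (auto simp: eventually_at_right_field intro!: exI[of _ e])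
    then show ?thesis using near by eventually_elim (simp add: mem)
  qed
  show "eventually (\<lambda>t. x + t *\<^sub>R v \<notin> \<Omega>) (at_right 0)" if pos: "v \<bullet> (\<nu> - d) > 0"
  proof -
    obtain e where "e > 0" "\<And>h. 0 < h \<Longrightarrow> h < e \<Longrightarrow> ?g (0 + h) > ?g 0"
      using DERIV_pos_inc_right[OF D pos] by auto
    then have "eventually (\<lambda>t. ?g t > 0) (at_right 0)"
      using x by (auto simp: eventually_at_right_field intro!: exI[of _ e])
    then show ?thesis using near by eventually_elim (simp add: mem)
  qed
qed

text \<open>The function \<open>\<psi>\<close> is constant along \<open>\<nu>\<close>.\<close>

lemma local_graph_gradient_orthogonal:
  assumes "local_graph \<Omega> x \<nu> \<psi>" "GDERIV \<psi> y :> d"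
  shows "\<nu> \<bullet> d = 0"
proof -
  have "((\<lambda>t. \<psi> (y + t *\<^sub>R \<nu>)) has_real_derivative \<nu> \<bullet> d) (at 0)"
    by (rule GDERIV_line) (use assms in simp)
  moreover have "(\<lambda>t. \<psi> (y + t *\<^sub>R \<nu>)) = (\<lambda>t. \<psi> y)" using assms(1) by (auto simp: local_graph_def)
  ultimately show ?thesis using DERIV_unique[OF _ DERIV_const] by metis
qed

lemma local_graph_normal_nonzero:
  assumes "local_graph \<Omega> x \<nu> \<psi>" "GDERIV \<psi> y :> d"
  shows "\<nu> - d \<noteq> 0"
  using local_graph_gradient_orthogonal[OF assms] assms(1)
  by (auto simp: local_graph_def norm_eq_1)

text \<open>If two graphs gave different unit normals \<open>n1\<close> and \<open>n2\<close>, short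
  steps along \<open>n2 - n1\<close> would lead into the domain according to the first graph and out
  of it according to the second. So the choice in \<open>outer_normal\<close> has a unique outcome
  wherever a differentiable graph exists.\<close>

lemma local_graph_normal_unique:
  assumes \<Omega>: "open \<Omega>" and x: "x \<in> frontier \<Omega>"
    and g1: "local_graph \<Omega> x \<nu>1 \<psi>1" "GDERIV \<psi>1 x :> d1"
    and g2: "local_graph \<Omega> x \<nu>2 \<psi>2" "GDERIV \<psi>2 x :> d2"
  shows "sgn (\<nu>1 - d1) = sgn (\<nu>2 - d2)"
proof (rule ccontr)
  assume ne: "sgn (\<nu>1 - d1) \<noteq> sgn (\<nu>2 - d2)"
  define n1 n2 where "n1 = sgn (\<nu>1 - d1)" and "n2 = sgn (\<nu>2 - d2)"
  have nz: "\<nu>1 - d1 \<noteq> 0" "\<nu>2 - d2 \<noteq> 0"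
    using local_graph_normal_nonzero g1 g2 by blast+
  then have n: "norm n1 = 1" "norm n2 = 1" by (auto simp: n1_def n2_def norm_sgn)
  have "n1 \<bullet> n2 \<noteq> 1"
  proof
    assume "n1 \<bullet> n2 = 1"
    then have "(norm (n1 - n2))\<^sup>2 = 0"
      using n by (simp add: power2_norm_eq_inner inner_diff_left inner_diff_right inner_commute norm_eq_1)
    then show False using ne by (simp add: n1_def n2_def)
  qed
  then have lt: "n1 \<bullet> n2 < 1" using norm_cauchy_schwarz[of n1 n2] n by simp
  have e1: "\<nu>1 - d1 = norm (\<nu>1 - d1) *\<^sub>R n1" and e2: "\<nu>2 - d2 = norm (\<nu>2 - d2) *\<^sub>R n2"
    using nz by (auto simp: n1_def n2_def sgn_div_norm)
  have c: "isCont \<psi>1 x" "isCont \<psi>2 x"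
    using g1 g2 by (auto simp: gderiv_def dest: has_derivative_continuous)
  have "(n2 - n1) \<bullet> (\<nu>1 - d1) < 0"
    using lt n nz by (subst e1) (simp add: inner_diff_left inner_diff_right norm_eq_1 inner_commute[of n2 n1] mult_less_0_iff)
  then have "eventually (\<lambda>t. x + t *\<^sub>R (n2 - n1) \<in> \<Omega>) (at_right 0)"
    by (intro local_graph_cone(1)[OF g1 local_graph_frontier[OF g1(1) c(1) x \<Omega>]])
  moreover have "(n2 - n1) \<bullet> (\<nu>2 - d2) > 0"
    using lt n nz by (subst e2) (simp add: inner_diff_left norm_eq_1 inner_commute[of n2 n1])
  then have "eventually (\<lambda>t. x + t *\<^sub>R (n2 - n1) \<notin> \<Omega>) (at_right 0)"
    by (intro local_graph_cone(2)[OF g2 local_graph_frontier[OF g2(1) c(2) x \<Omega>]])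
  ultimately have "eventually (\<lambda>t::real. False) (at_right 0)"
    by eventually_elim simp
  then show False by simp
qed

text \<open>Since the normal is constant, the local defining function \<open>y \<mapsto> y \<bullet> \<nu> - \<psi> y\<close> has a gradient
  that is a positive multiple of \<open>e\<close> near \<open>x\<close>; its sign is then read off from the mean value theorem.\<close>

lemma constant_normal_imp_halfspace:
  assumes \<Omega>: "open \<Omega>" and x: "x \<in> frontier \<Omega>"
    and g: "local_graph \<Omega> x \<nu> \<psi>" and diff: "\<And>y. \<psi> differentiable (at y)"
    and \<epsilon>: "\<epsilon> > 0" and normal: "\<And>y. y \<in> ball x \<epsilon> \<inter> frontier \<Omega> \<Longrightarrow> outer_normal \<Omega> y = e"
  obtains r where "r > 0" "r \<le> \<epsilon>" "\<Omega> \<inter> ball x r = {y \<in> ball x r. y \<bullet> e < x \<bullet> e}"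
proof -
  obtain r where r: "r > 0" "\<Omega> \<inter> ball x r = {y \<in> ball x r. y \<bullet> \<nu> < \<psi> y}"
    using g by (auto simp: local_graph_def)
  have \<nu>: "norm \<nu> = 1" "\<nu> \<bullet> \<nu> = 1" "\<And>y t. \<psi> (y + t *\<^sub>R \<nu>) = \<psi> y"
    using g by (auto simp: local_graph_def norm_eq_1)
  have gd: "GDERIV \<psi> y :> grad \<psi> y" for y
    using has_derivative_grad[OF diff] by (simp add: gderiv_def)
  have cont: "isCont \<psi> y" for y using diff by (rule differentiable_imp_continuous_within)
  \<comment> \<open>On the graph near \<open>x\<close>, the representation also serves as one
    centred at \<open>y\<close>, and \<open>y\<close> is a boundary point. Its normal is therefore
    both \<open>e\<close> and the normalised gradient of the defining function.\<close>
  have dir: "\<exists>l>0. \<nu> - grad \<psi> y = l *\<^sub>R e" if y: "y \<in> ball x (min r \<epsilon>)" "y \<bullet> \<nu> = \<psi> y" for y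
  proof -
    obtain s where s: "s > 0" "ball y s \<subseteq> ball x r"
      using openE[OF open_ball, of y x r] y(1) by auto
    have "\<Omega> \<inter> ball y s = {z \<in> ball y s. z \<bullet> \<nu> < \<psi> z}"
      using r(2) s(2) by (auto simp: set_eq_iff subset_eq)
    then have g': "local_graph \<Omega> y \<nu> \<psi>" using s(1) \<nu> by (auto simp: local_graph_def)
    have "y \<notin> \<Omega>"
    proof
      assume "y \<in> \<Omega>"
      then have "y \<in> {y \<in> ball x r. y \<bullet> \<nu> < \<psi> y}" using y(1) r(2) by fastforce
      then show False using y(2) by simp
    qed
    moreover have "y \<in> closure \<Omega>"
    proof -
      have "\<nu> \<bullet> grad \<psi> y = 0" using local_graph_gradient_orthogonal[OF g' gd] .
      then have "eventually (\<lambda>t. y + t *\<^sub>R (- \<nu>) \<in> \<Omega>) (at_right 0)"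
        using \<nu> by (intro local_graph_cone(1)[OF g' gd y(2)]) (simp add: inner_diff_right)
      moreover have "((\<lambda>t. y + t *\<^sub>R (- \<nu>)) \<longlongrightarrow> y + 0 *\<^sub>R (- \<nu>)) (at_right 0)"
        by (intro tendsto_intros)
      ultimately show ?thesis
        by (intro Lim_in_closed_set[of "closure \<Omega>" "\<lambda>t. y + t *\<^sub>R (- \<nu>)" "at_right (0::real)"])
          (auto elim!: eventually_mono simp: closure_subset[THEN subsetD])
    qed
    ultimately have fr: "y \<in> frontier \<Omega>" using \<Omega> by (simp add: frontier_def interior_open)
    let ?P = "\<lambda>n. \<exists>\<nu> \<psi> d. local_graph \<Omega> y \<nu> \<psi> \<and> GDERIV \<psi> y :> d \<and> n = sgn (\<nu> - d)"
    have "?P (sgn (\<nu> - grad \<psi> y))" using g' gd by blast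
    then have "?P (outer_normal \<Omega> y)" unfolding outer_normal_def by (rule someI)
    moreover have "outer_normal \<Omega> y = e" using normal fr y(1) by auto
    ultimately have "e = sgn (\<nu> - grad \<psi> y)"
      using local_graph_normal_unique[OF \<Omega> fr _ _ g' gd] by metis
    moreover have "\<nu> - grad \<psi> y \<noteq> 0" using local_graph_normal_nonzero[OF g' gd] .
    ultimately show ?thesis
      by (intro exI[of _ "norm (\<nu> - grad \<psi> y)"]) (simp add: sgn_div_norm)
  qed
  \<comment> \<open>\<open>P\<close> projects along \<open>\<nu>\<close> onto the graph. As the
    gradient of \<open>\<psi>\<close> does not change along \<open>\<nu>\<close>, what holds on the
    graph carries over to all points near \<open>x\<close>.\<close>
  define P where "P y = y + (\<psi> y - y \<bullet> \<nu>) *\<^sub>R \<nu>" for y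
  have x0: "x \<bullet> \<nu> = \<psi> x" by (rule local_graph_frontier[OF g cont x \<Omega>])
  have Px: "P x = x" using x0 by (simp add: P_def)
  have "isCont P x" unfolding P_def by (intro continuous_intros cont)
  moreover have "min r \<epsilon> > 0" using r(1) \<epsilon> by simp
  ultimately obtain \<delta> where \<delta>: "\<delta> > 0" "\<And>y. dist y x < \<delta> \<Longrightarrow> dist (P y) (P x) < min r \<epsilon>"
    unfolding continuous_at_eps_delta by metis
  have grad_shift: "grad \<psi> (y + t *\<^sub>R \<nu>) = grad \<psi> y" for y t
  proof -
    have "(\<psi> has_derivative (\<lambda>h. h \<bullet> grad \<psi> (y + t *\<^sub>R \<nu>))) (at (y + t *\<^sub>R \<nu>))"
      using has_derivative_grad[OF diff] .
    moreover have "((\<lambda>z. z + t *\<^sub>R \<nu>) has_derivative (\<lambda>h. h)) (at y)"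
      by (auto intro!: derivative_eq_intros)
    ultimately have "((\<lambda>z. \<psi> (z + t *\<^sub>R \<nu>)) has_derivative (\<lambda>h. h \<bullet> grad \<psi> (y + t *\<^sub>R \<nu>))) (at y)"
      using has_derivative_compose by blast
    then have "(\<psi> has_derivative (\<lambda>h. h \<bullet> grad \<psi> (y + t *\<^sub>R \<nu>))) (at y)" by (simp add: \<nu>)
    then have "(\<lambda>h. h \<bullet> grad \<psi> (y + t *\<^sub>R \<nu>)) = (\<lambda>h. h \<bullet> grad \<psi> y)"
      using has_derivative_unique has_derivative_grad[OF diff] by blast
    then show ?thesis by (metis vector_eq_ldot)
  qed
  have dir': "\<exists>l>0. \<nu> - grad \<psi> y = l *\<^sub>R e" if "y \<in> ball x \<delta>" for y
  proof -
    have "P y \<in> ball x (min r \<epsilon>)" using \<delta>(2)[of y] that Px by (simp add: dist_commute)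
    moreover have "P y \<bullet> \<nu> = \<psi> (P y)" by (simp add: P_def \<nu> inner_add_left)
    moreover have "grad \<psi> (P y) = grad \<psi> y" by (simp add: P_def grad_shift)
    ultimately show ?thesis using dir by metis
  qed
  define R where "R = min (min r \<epsilon>) \<delta>"
  \<comment> \<open>Mean value theorem on the segment from \<open>x\<close> to \<open>y\<close>: the
    gradient at the intermediate point is a positive multiple of \<open>e\<close>.\<close>
  have sign: "\<exists>l>0. y \<bullet> \<nu> - \<psi> y = l * ((y - x) \<bullet> e)" if y: "y \<in> ball x R" for y
  proof -
    let ?F = "\<lambda>t. (x + t *\<^sub>R (y - x)) \<bullet> \<nu> - \<psi> (x + t *\<^sub>R (y - x))"
    have D: "(?F has_real_derivative (y - x) \<bullet> (\<nu> - grad \<psi> (x + t *\<^sub>R (y - x)))) (at t)" for t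
    proof -
      have "((\<lambda>t. (x + t *\<^sub>R (y - x)) \<bullet> \<nu>) has_real_derivative (y - x) \<bullet> \<nu>) (at t)"
        unfolding inner_add_left inner_scaleR_left by (auto intro!: derivative_eq_intros)
      then show ?thesis
        unfolding inner_diff_right by (rule DERIV_diff) (rule GDERIV_line, rule gd)
    qed
    obtain t where t: "0 < t" "t < 1"
      "?F 1 - ?F 0 = (1 - 0) * ((y - x) \<bullet> (\<nu> - grad \<psi> (x + t *\<^sub>R (y - x))))"
      using MVT2[of 0 1 ?F, OF _ D] by auto
    have "norm (t *\<^sub>R (y - x)) \<le> norm (y - x)"
      using t by (simp add: mult_left_le_one_le)
    then have "x + t *\<^sub>R (y - x) \<in> ball x \<delta>"
      using y by (simp add: R_def dist_norm norm_minus_commute)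
    then obtain l where "l > 0" "\<nu> - grad \<psi> (x + t *\<^sub>R (y - x)) = l *\<^sub>R e" using dir' by blast
    then show ?thesis using t(3) x0 by (intro exI[of _ l]) simp
  qed
  show ?thesis
  proof (rule that[of R])
    show "R > 0" "R \<le> \<epsilon>" using r(1) \<epsilon> \<delta>(1) by (auto simp: R_def)
    have "y \<in> \<Omega> \<longleftrightarrow> y \<bullet> e < x \<bullet> e" if y: "y \<in> ball x R" for y
    proof -
      obtain l where l: "l > 0" "y \<bullet> \<nu> - \<psi> y = l * ((y - x) \<bullet> e)" using sign[OF y] by blast
      have "y \<in> ball x r" using y by (simp add: R_def)
      then have "y \<in> \<Omega> \<longleftrightarrow> y \<bullet> \<nu> - \<psi> y < 0" using r(2) by (auto simp: set_eq_iff)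
      also have "\<dots> \<longleftrightarrow> (y - x) \<bullet> e < 0" unfolding l(2) using l(1) by (simp add: mult_less_0_iff)
      finally show ?thesis by (simp add: inner_diff_left)
    qed
    then show "\<Omega> \<inter> ball x R = {y \<in> ball x R. y \<bullet> e < x \<bullet> e}" by auto
  qed
qed

section \<open>Hausdorff measure on hyperplanes\<close>

text \<open>The surface integral of \<open>f\<close> over the hyperplane \<open>x \<bullet> e = c\<close> is represented by the Lebesgue
  integral of \<open>f \<circ> slab_proj e c\<close> over the slab of unit thickness. Only one inequality between
  the resulting measure and the Hausdorff measure is needed, so that its normalisation is immaterial.\<close>

definition slab_proj :: "'a::euclidean_space \<Rightarrow> real \<Rightarrow> 'a \<Rightarrow> 'a" where
  "slab_proj e c x = x + (c - x \<bullet> e) *\<^sub>R e"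

definition slab :: "'a::euclidean_space \<Rightarrow> 'a set" where
  "slab e = {x. 0 \<le> x \<bullet> e \<and> x \<bullet> e < 1}"

lemma continuous_on_slab_proj: "continuous_on S (slab_proj e c)"
  unfolding slab_proj_def by (intro continuous_intros)

lemma borel_measurable_slab_proj [measurable]: "slab_proj e c \<in> borel_measurable borel"
  by (intro borel_measurable_continuous_onI continuous_on_slab_proj)

lemma slab_borel [measurable]: "slab e \<in> sets borel"
  unfolding slab_def by measurable

lemma slab_proj_inner: "e \<in> Basis \<Longrightarrow> slab_proj e c x \<bullet> e = c"
  by (simp add: slab_proj_def inner_add_left)

lemma slab_proj_inner_other: "e \<in> Basis \<Longrightarrow> i \<in> Basis \<Longrightarrow> i \<noteq> e \<Longrightarrow> slab_proj e c x \<bullet> i = x \<bullet> i"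
  by (simp add: slab_proj_def inner_add_left inner_not_same_Basis)

text \<open>If \<open>p\<close> is one point of the preimage, the others differ from it by at most
  the diameter in each coordinate orthogonal to \<open>e\<close>. So a box with sides twice the
  diameter, and side 1 along \<open>e\<close>, contains the preimage. The Borel set \<open>B\<close>
  is passed on because \<open>U\<close> need not be measurable.\<close>

lemma emeasure_slab_le_diameter:
  fixes U :: "'a::euclidean_space set"
  assumes e: "e \<in> Basis" and U: "bounded U"
  shows "\<exists>B\<in>sets borel. {x \<in> slab e. slab_proj e c x \<in> U} \<subseteq> B \<and>
    emeasure lborel B \<le> ennreal ((2 * diameter U) ^ (DIM('a) - 1))"
proof (cases "\<exists>p \<in> slab e. slab_proj e c p \<in> U")
  case False
  then show ?thesis by (intro bexI[of _ "{}"]) auto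
next
  case True
  then obtain p where p: "p \<in> slab e" "slab_proj e c p \<in> U" by blast
  let ?d = "diameter U"
  have d0: "?d \<ge> 0" using U by (rule diameter_ge_0)
  define l where "l = (\<Sum>i\<in>Basis. (if i = e then 0 else p \<bullet> i - ?d) *\<^sub>R i)"
  define u where "u = (\<Sum>i\<in>Basis. (if i = e then 1 else p \<bullet> i + ?d) *\<^sub>R i)"
  have lu: "l \<bullet> i = (if i = e then 0 else p \<bullet> i - ?d)" "u \<bullet> i = (if i = e then 1 else p \<bullet> i + ?d)" if "i \<in> Basis" for i
    unfolding l_def u_def using that by (simp_all only: inner_sum_left_Basis)
  have "{x \<in> slab e. slab_proj e c x \<in> U} \<subseteq> cbox l u"
  proof (intro subsetI)
    fix x assume x: "x \<in> {x \<in> slab e. slab_proj e c x \<in> U}"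
    have "l \<bullet> i \<le> x \<bullet> i \<and> x \<bullet> i \<le> u \<bullet> i" if i: "i \<in> Basis" for i
    proof (cases "i = e")
      case True
      then show ?thesis using x lu[OF i] by (auto simp: slab_def)
    next
      case False
      have "\<bar>(slab_proj e c x - slab_proj e c p) \<bullet> i\<bar> \<le> norm (slab_proj e c x - slab_proj e c p)"
        using i by (rule Basis_le_norm)
      also have "\<dots> \<le> ?d" using diameter_bounded_bound[OF U, of "slab_proj e c x" "slab_proj e c p"] x p
        by (simp add: dist_norm)
      finally have "\<bar>x \<bullet> i - p \<bullet> i\<bar> \<le> ?d"
        using False i e by (simp add: inner_diff_left slab_proj_inner_other)
      then show ?thesis using lu[OF i] False by auto
    qed
    then show "x \<in> cbox l u" by (simp add: mem_box)
  qed
  moreover have "emeasure lborel (cbox l u) = ennreal ((2 * ?d) ^ (DIM('a) - 1))"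
  proof -
    have "emeasure lborel (cbox l u) = ennreal (\<Prod>i\<in>Basis. (u - l) \<bullet> i)"
      using d0 by (intro emeasure_lborel_cbox) (simp add: lu)
    also have "(\<Prod>i\<in>Basis. (u - l) \<bullet> i) = (\<Prod>i\<in>Basis. if i = e then 1 else 2 * ?d)"
      by (intro prod.cong) (auto simp: inner_diff_left lu)
    also have "\<dots> = (\<Prod>i\<in>Basis - {e}. 2 * ?d)"
      using e by (subst prod.remove[of Basis e]) auto
    also have "\<dots> = (2 * ?d) ^ (DIM('a) - 1)" using e by simp
    finally show ?thesis .
  qed
  ultimately show ?thesis by (intro bexI[of _ "cbox l u"]) auto
qed

text \<open>Apply the box estimate to every member of a cover and sum. The constant compares
  \<open>(2 * diameter U) ^ d\<close> with the weight
  \<open>unit_ball_vol d * (diameter U / 2) ^ d\<close> used in the Hausdorff measure.\<close>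

lemma slab_measure_le_hausdorff:
  fixes A :: "'a::euclidean_space set"
  assumes e: "e \<in> Basis" and A: "A \<in> sets borel"
  shows "emeasure lborel {x \<in> slab e. slab_proj e c x \<in> A}
    \<le> ennreal (4 ^ (DIM('a) - 1) / unit_ball_vol (real (DIM('a) - 1))) * hausdorff_outer (DIM('a) - 1) A"
proof -
  let ?d = "DIM('a) - 1"
  let ?V = "unit_ball_vol (real ?d)"
  let ?C = "ennreal (4 ^ ?d / ?V)"
  have V: "?V > 0" by simp
  have Cfin: "?C \<noteq> top" by simp
  let ?C' = "ennreal (?V / 4 ^ ?d)"
  have "ennreal (a / v) * ennreal (v / a) = 1" if "v > 0" "a > 0" for a v :: real
    using that by (simp flip: ennreal_mult)
  then have CC: "?C * ?C' = 1" "?C' * ?C = 1" using V by (metis zero_less_numeral zero_less_power)+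
  have "emeasure lborel {x \<in> slab e. slab_proj e c x \<in> A} \<le> ?C * hausdorff_pre ?d 1 A"
  proof -
    \<comment> \<open>The constant is moved to the left, so that the right-hand side is a bare
      infimum over covers.\<close>
    have "?C' * emeasure lborel {x \<in> slab e. slab_proj e c x \<in> A} \<le> hausdorff_pre ?d 1 A"
      unfolding hausdorff_pre_def
    proof (rule INF_greatest)
      fix U :: "nat \<Rightarrow> 'a set"
      assume "U \<in> {U. A \<subseteq> (\<Union>i. U i) \<and> (\<forall>i. bounded (U i) \<and> diameter (U i) \<le> 1)}"
      then have U: "A \<subseteq> (\<Union>i. U i)" "\<And>i. bounded (U i)" by auto
      obtain B where B: "\<And>i. B i \<in> sets borel" "\<And>i. {x \<in> slab e. slab_proj e c x \<in> U i} \<subseteq> B i"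
        "\<And>i. emeasure lborel (B i) \<le> ennreal ((2 * diameter (U i)) ^ ?d)"
      proof -
        have "\<forall>i. \<exists>B. B \<in> sets borel \<and> {x \<in> slab e. slab_proj e c x \<in> U i} \<subseteq> B \<and>
            emeasure lborel B \<le> ennreal ((2 * diameter (U i)) ^ ?d)"
          using emeasure_slab_le_diameter[OF e U(2)] by blast
        from choice[OF this] show ?thesis using that by blast
      qed
      have "emeasure lborel {x \<in> slab e. slab_proj e c x \<in> A} \<le> emeasure lborel (\<Union>i. B i)"
      proof (rule emeasure_mono)
        show "{x \<in> slab e. slab_proj e c x \<in> A} \<subseteq> (\<Union>i. B i)"
          using U(1) B(2) by blast
        show "(\<Union>i. B i) \<in> sets lborel" using B(1) by simp
      qed
      also have "\<dots> \<le> (\<Sum>i. emeasure lborel (B i))"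
        using B(1) by (intro emeasure_subadditive_countably) auto
      also have "\<dots> \<le> (\<Sum>i. ennreal ((2 * diameter (U i)) ^ ?d))"
        by (intro suminf_le B) auto
      also have "\<dots> = (\<Sum>i. ?C * ennreal (?V * (diameter (U i) / 2) ^ ?d))"
      proof -
        have "(2 * diameter (U i)) ^ ?d = 4 ^ ?d / ?V * (?V * (diameter (U i) / 2) ^ ?d)" for i
        proof -
          have "4 ^ ?d / ?V * (?V * (diameter (U i) / 2) ^ ?d) = 4 ^ ?d * (diameter (U i) / 2) ^ ?d"
          proof -
            have "a / v * (v * b) = a * b" if "v > 0" for a v b :: real using that by simp
            from this[OF V] show ?thesis .
          qed
          also have "\<dots> = (4 * (diameter (U i) / 2)) ^ ?d" by (rule power_mult_distrib[symmetric])
          finally show ?thesis by simp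
        qed
        then have "ennreal ((2 * diameter (U i)) ^ ?d) = ?C * ennreal (?V * (diameter (U i) / 2) ^ ?d)" for i
          using V diameter_ge_0[OF U(2)] by (simp only: ennreal_mult[symmetric] divide_nonneg_nonneg
            mult_nonneg_nonneg zero_le_power zero_le_numeral less_imp_le)
        then show ?thesis by simp
      qed
      also have "\<dots> = ?C * (\<Sum>i. ennreal (?V * (diameter (U i) / 2) ^ ?d))"
        by (rule ennreal_suminf_cmult)
      finally have "?C' * emeasure lborel {x \<in> slab e. slab_proj e c x \<in> A}
        \<le> ?C' * (?C * (\<Sum>i. ennreal (?V * (diameter (U i) / 2) ^ ?d)))"
        by (rule mult_left_mono) simp
      then show "?C' * emeasure lborel {x \<in> slab e. slab_proj e c x \<in> A}
        \<le> (\<Sum>i. ennreal (?V * (diameter (U i) / 2) ^ ?d))"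
        unfolding mult.assoc[symmetric] CC by (simp only: mult_1_left)
    qed
    then have "?C * (?C' * emeasure lborel {x \<in> slab e. slab_proj e c x \<in> A}) \<le> ?C * hausdorff_pre ?d 1 A"
      by (rule mult_left_mono) simp
    then show ?thesis unfolding mult.assoc[symmetric] CC by (simp only: mult_1_left)
  qed
  also have "\<dots> \<le> ?C * hausdorff_outer ?d A"
    by (intro mult_left_mono hausdorff_pre_le_outer) auto
  finally show ?thesis .
qed

lemma
  fixes \<Omega> A :: "'a::euclidean_space set"
  assumes d: "DIM('a) \<ge> 2"
  shows space_surface_measure: "space (surface_measure \<Omega>) = frontier \<Omega>"
    and sets_surface_measure: "A \<in> sets borel \<Longrightarrow> A \<subseteq> frontier \<Omega> \<Longrightarrow> A \<in> sets (surface_measure \<Omega>)"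
    and emeasure_surface_measure: "A \<in> sets borel \<Longrightarrow> A \<subseteq> frontier \<Omega> \<Longrightarrow>
      emeasure (surface_measure \<Omega>) A = hausdorff_outer (DIM('a) - 1) A"
    and borel_measurable_surface_measure:
      "f \<in> borel_measurable borel \<Longrightarrow> f \<in> borel_measurable (surface_measure \<Omega>)"
proof -
  have d1: "DIM('a) - 1 \<ge> 1" using d by simp
  note sub = borel_subset_sets_hausdorff[OF d1]
  have fr: "frontier \<Omega> \<in> sets (hausdorff_measure (DIM('a) - 1))"
    using sub by (rule subsetD) simp
  have sp: "space (hausdorff_measure (DIM('a) - 1) :: 'a measure) = UNIV" by (rule space_hausdorff[OF d1])
  show "space (surface_measure \<Omega>) = frontier \<Omega>"
    unfolding surface_measure_def space_restrict_space sp by simp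
  show "A \<in> sets (surface_measure \<Omega>)" if "A \<in> sets borel" "A \<subseteq> frontier \<Omega>"
    unfolding surface_measure_def using fr sp subsetD[OF sub that(1)] that(2)
    by (subst sets_restrict_space_iff) simp_all
  show "emeasure (surface_measure \<Omega>) A = hausdorff_outer (DIM('a) - 1) A"
    if "A \<in> sets borel" "A \<subseteq> frontier \<Omega>"
    unfolding surface_measure_def using fr sp that(2) emeasure_hausdorff[OF d1 subsetD[OF sub that(1)]]
    by (subst emeasure_restrict_space) simp_all
  show "f \<in> borel_measurable (surface_measure \<Omega>)" if "f \<in> borel_measurable borel"
  proof -
    have "f \<in> borel_measurable (hausdorff_measure (DIM('a) - 1))"
      using measurable_mono[of borel borel borel "hausdorff_measure (DIM('a) - 1)"] that sub sp by auto
    then show ?thesis unfolding surface_measure_def by (rule measurable_restrict_space1)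
  qed
qed

text \<open>Extends the comparison from sets to nonnegative Borel functions by monotone classes. It
  turns \<open>L\<^sup>2\<close> convergence on the surface into \<open>L\<^sup>2\<close>
  convergence on the slab.\<close>

lemma slab_nn_integral_le_surface:
  fixes f :: "'a::euclidean_space \<Rightarrow> ennreal" and \<Omega> :: "'a set"
  assumes d: "DIM('a) \<ge> 2" and e: "e \<in> Basis" and f: "f \<in> borel_measurable borel"
    and D: "D \<in> sets borel" "D \<subseteq> frontier \<Omega>"
  shows "(\<integral>\<^sup>+x. f (slab_proj e c x) * indicator D (slab_proj e c x) * indicator (slab e) x \<partial>lborel)
    \<le> ennreal (4 ^ (DIM('a) - 1) / unit_ball_vol (real (DIM('a) - 1))) * (\<integral>\<^sup>+x. f x \<partial>surface_measure \<Omega>)"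
  (is "_ \<le> ?C * _")
  using f
proof (induction f)
  case (cong f g)
  then show ?case by simp
next
  case (set A)
  let ?d = "DIM('a) - 1"
  note set [measurable] D(1) [measurable]
  have "(\<integral>\<^sup>+x. indicator A (slab_proj e c x) * indicator D (slab_proj e c x) * indicator (slab e) x \<partial>lborel)
      = (\<integral>\<^sup>+x. indicator {x \<in> slab e. slab_proj e c x \<in> A \<inter> D} x \<partial>lborel)"
    by (intro nn_integral_cong) (auto simp: indicator_def)
  also have "\<dots> = emeasure lborel {x \<in> slab e. slab_proj e c x \<in> A \<inter> D}"
    by (intro nn_integral_indicator) measurable
  also have "\<dots> \<le> ?C * hausdorff_outer ?d (A \<inter> D)"
    by (rule slab_measure_le_hausdorff[OF e]) simp
  also have "\<dots> \<le> ?C * hausdorff_outer ?d (A \<inter> frontier \<Omega>)"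
    using D by (intro mult_left_mono hausdorff_outer_mono) auto
  also have "hausdorff_outer ?d (A \<inter> frontier \<Omega>) = emeasure (surface_measure \<Omega>) (A \<inter> frontier \<Omega>)"
    using set by (intro emeasure_surface_measure[OF d, symmetric]) auto
  also have "\<dots> = (\<integral>\<^sup>+x. indicator (A \<inter> frontier \<Omega>) x \<partial>surface_measure \<Omega>)"
    using set by (intro nn_integral_indicator[symmetric] sets_surface_measure[OF d]) auto
  also have "\<dots> \<le> (\<integral>\<^sup>+x. indicator A x \<partial>surface_measure \<Omega>)"
    by (intro nn_integral_mono) (auto simp: indicator_def)
  finally show ?case by (simp add: mult_left_mono)
next
  case (mult u k)
  have m: "u \<in> borel_measurable (surface_measure \<Omega>)"
    using d mult by (intro borel_measurable_surface_measure)
  note mult(2) [measurable] D(1) [measurable]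
  have "(\<integral>\<^sup>+x. k * u (slab_proj e c x) * indicator D (slab_proj e c x) * indicator (slab e) x \<partial>lborel)
      = k * (\<integral>\<^sup>+x. u (slab_proj e c x) * indicator D (slab_proj e c x) * indicator (slab e) x \<partial>lborel)"
    by (subst nn_integral_cmult[symmetric]) (auto simp: mult.assoc)
  also have "\<dots> \<le> k * (?C * (\<integral>\<^sup>+x. u x \<partial>surface_measure \<Omega>))"
    by (intro mult_left_mono mult.IH) auto
  also have "\<dots> = ?C * (\<integral>\<^sup>+x. k * u x \<partial>surface_measure \<Omega>)"
    using m by (simp add: nn_integral_cmult ac_simps)
  finally show ?case .
next
  case (add u v)
  have m: "u \<in> borel_measurable (surface_measure \<Omega>)" "v \<in> borel_measurable (surface_measure \<Omega>)"
    using d add by (auto intro: borel_measurable_surface_measure)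
  note add(1,3) [measurable] D(1) [measurable]
  have "(\<integral>\<^sup>+x. (v (slab_proj e c x) + u (slab_proj e c x)) * indicator D (slab_proj e c x) * indicator (slab e) x \<partial>lborel)
      = (\<integral>\<^sup>+x. v (slab_proj e c x) * indicator D (slab_proj e c x) * indicator (slab e) x \<partial>lborel)
      + (\<integral>\<^sup>+x. u (slab_proj e c x) * indicator D (slab_proj e c x) * indicator (slab e) x \<partial>lborel)"
    by (subst nn_integral_add[symmetric]) (auto simp: distrib_right)
  also have "\<dots> \<le> ?C * (\<integral>\<^sup>+x. v x \<partial>surface_measure \<Omega>) + ?C * (\<integral>\<^sup>+x. u x \<partial>surface_measure \<Omega>)"
    by (intro add_mono add.IH)
  also have "\<dots> = ?C * (\<integral>\<^sup>+x. v x + u x \<partial>surface_measure \<Omega>)"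
    using m by (simp add: nn_integral_add distrib_left)
  finally show ?case .
next
  case (seq U)
  note seq(1) [measurable] D(1) [measurable]
  have "(\<integral>\<^sup>+x. (SUP i. U i (slab_proj e c x)) * indicator D (slab_proj e c x) * indicator (slab e) x \<partial>lborel)
      = (\<integral>\<^sup>+x. (SUP i. U i (slab_proj e c x) * indicator D (slab_proj e c x) * indicator (slab e) x) \<partial>lborel)"
    by (simp add: SUP_mult_right_ennreal)
  also have "\<dots> = (SUP i. \<integral>\<^sup>+x. U i (slab_proj e c x) * indicator D (slab_proj e c x) * indicator (slab e) x \<partial>lborel)"
    using seq(3) by (intro nn_integral_monotone_convergence_SUP) (auto simp: incseq_def le_fun_def intro!: mult_right_mono)
  also have "\<dots> \<le> (SUP i. ?C * (\<integral>\<^sup>+x. U i x \<partial>surface_measure \<Omega>))"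
    by (intro SUP_mono' seq.IH)
  also have "\<dots> \<le> ?C * (\<integral>\<^sup>+x. (SUP i. U i x) \<partial>surface_measure \<Omega>)"
    by (intro SUP_least mult_left_mono nn_integral_mono SUP_upper) auto
  finally show ?case by (simp add: image_comp)
qed

section \<open>Green's identity and traces\<close>

definition lap :: "('a::euclidean_space \<Rightarrow> real) \<Rightarrow> 'a \<Rightarrow> real" where
  "lap f x = (\<Sum>i\<in>Basis. frechet_derivative (pd i f) (at x) i)"

lemma continuous_on_lap: "smooth f \<Longrightarrow> continuous_on S (lap f)"
  unfolding lap_def by (intro continuous_intros smooth_continuous_on smooth_pd)

text \<open>The left integrand is the divergence of \<open>v\<close> times the gradient of
  \<open>\<phi>\<close>. Derivatives tangential to the hyperplane integrate to zero, and the one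
  along \<open>e\<close> gives the slab integral.\<close>

lemma green_halfspace:
  fixes v \<phi> :: "'a::euclidean_space \<Rightarrow> real"
  assumes e: "e \<in> Basis"
    and v: "\<And>x. v differentiable (at x)" "\<And>i. i \<in> Basis \<Longrightarrow> continuous_on UNIV (pd i v)"
    and \<phi>: "smooth \<phi>" and K: "compact K" "\<And>x. x \<notin> K \<Longrightarrow> \<phi> x = 0"
  shows "(\<integral>x. indicator {x. x \<bullet> e < c} x * (grad v x \<bullet> grad \<phi> x + v x * lap \<phi> x) \<partial>lborel)
    = (\<integral>x. indicator (slab e) x * (v (slab_proj e c x) * pd e \<phi> (slab_proj e c x)) \<partial>lborel)"
proof -
  let ?S = "{x::'a. x \<bullet> e < c}"
  have S: "?S \<in> sets borel" by measurable
  have vc: "continuous_on UNIV v"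
    using v(1) by (simp add: continuous_at_imp_continuous_on differentiable_imp_continuous_within)
  let ?F = "\<lambda>i x. v x * pd i \<phi> x"
  have z: "pd i \<phi> x = 0" "frechet_derivative (pd i \<phi>) (at x) i = 0" if "x \<notin> K" for i x
  proof -
    have *: "pd i \<phi> x = 0" if "x \<notin> K" for x
      using K that by (intro pd_vanishes) (auto intro: compact_imp_closed)
    then show "pd i \<phi> x = 0" using that by blast
    show "frechet_derivative (pd i \<phi>) (at x) i = 0"
      using K(1) * that by (intro pd_vanishes[of K "pd i \<phi>"]) (auto intro: compact_imp_closed)
  qed
  have diff: "?F i differentiable (at x)" if "i \<in> Basis" for i x
    using that v(1) smooth_differentiable[OF smooth_pd[OF \<phi>]] by (intro differentiable_mult) auto
  have pdF: "pd i (?F i) = (\<lambda>x. v x * frechet_derivative (pd i \<phi>) (at x) i + pd i v x * pd i \<phi> x)"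
    if "i \<in> Basis" for i
    using that v(1) smooth_differentiable[OF smooth_pd[OF \<phi>]] by (intro ext pd_mult) auto
  have cont: "continuous_on UNIV (pd i (?F i))" if "i \<in> Basis" for i
    unfolding pdF[OF that] using smooth_continuous_on[OF smooth_pd[OF \<phi> that]]
      smooth_continuous_on[OF smooth_pd[OF smooth_pd[OF \<phi> that] that]] v(2)[OF that] vc
    by (intro continuous_on_add continuous_on_mult)
  have Fz: "?F i x = 0" if "x \<notin> K" for i x using z that by simp
  have int: "integrable lborel (\<lambda>x. indicator ?S x * pd i (?F i) x)" if "i \<in> Basis" for i
  proof -
    have "integrable lborel (pd i (?F i))"
      using cont[OF that] K(1) by (rule integrable_continuous_compact_support) (simp add: fun_cong[OF pdF[OF that]] z)
    from integrable_mult_indicator[OF _ this, of ?S] S show ?thesis by simp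
  qed
  have "indicator ?S x * (grad v x \<bullet> grad \<phi> x + v x * lap \<phi> x) = (\<Sum>i\<in>Basis. indicator ?S x * pd i (?F i) x)" for x
  proof -
    have "(\<Sum>i\<in>Basis. pd i (?F i) x) = (\<Sum>i\<in>Basis. v x * frechet_derivative (pd i \<phi>) (at x) i + pd i v x * pd i \<phi> x)"
      by (intro sum.cong refl) (rule fun_cong[OF pdF])
    also have "\<dots> = v x * lap \<phi> x + grad v x \<bullet> grad \<phi> x"
      by (subst euclidean_inner) (simp add: sum.distrib sum_distrib_left lap_def grad_inner_Basis)
    finally show ?thesis by (simp add: sum_distrib_left[symmetric])
  qed
  then have "(\<integral>x. indicator ?S x * (grad v x \<bullet> grad \<phi> x + v x * lap \<phi> x) \<partial>lborel)
      = (\<Sum>i\<in>Basis. \<integral>x. indicator ?S x * pd i (?F i) x \<partial>lborel)"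
    using int by (simp only:) (rule Bochner_Integration.integral_sum)
  also have "\<dots> = (\<integral>x. indicator ?S x * pd e (?F e) x \<partial>lborel)
      + (\<Sum>i\<in>Basis - {e}. \<integral>x. indicator ?S x * pd i (?F i) x \<partial>lborel)"
    using e by (intro sum.remove) auto
  also have "(\<Sum>i\<in>Basis - {e}. \<integral>x. indicator ?S x * pd i (?F i) x \<partial>lborel) = 0"
  proof (rule sum.neutral, rule ballI)
    fix i assume i: "i \<in> Basis - {e}"
    show "(\<integral>x. indicator ?S x * pd i (?F i) x \<partial>lborel) = 0"
    proof (rule integral_pd_invariant[OF _ _ _ K(1) Fz S])
      show "x + t *\<^sub>R i \<in> ?S \<longleftrightarrow> x \<in> ?S" for x t
        using i e by (simp add: inner_add_left inner_not_same_Basis)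
    qed (use i diff cont in auto)
  qed
  also have "(\<integral>x. indicator ?S x * pd e (?F e) x \<partial>lborel)
      = (\<integral>x. indicator (slab e) x * (v (slab_proj e c x) * pd e \<phi> (slab_proj e c x)) \<partial>lborel)"
    unfolding slab_def slab_proj_def
    by (rule integral_pd_halfspace[OF diff cont e K(1) Fz]) (use e in auto)
  finally show ?thesis by simp
qed

text \<open>Instead of the Cauchy-Schwarz inequality, the pointwise bound
  \<open>t \<le> \<delta> + t\<^sup>2 / \<delta>\<close> is integrated over the finite
  measure.\<close>

lemma L2_null_imp_L1_null:
  fixes h :: "nat \<Rightarrow> 'a \<Rightarrow> 'b::euclidean_space"
  assumes fin: "emeasure M (space M) < \<infinity>" and meas: "\<And>m. h m \<in> borel_measurable M"
    and lim: "(\<lambda>m. \<integral>\<^sup>+x. ennreal ((norm (h m x))\<^sup>2) \<partial>M) \<longlonglongrightarrow> 0"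
  shows "(\<lambda>m. \<integral>x. norm (h m x) \<partial>M) \<longlonglongrightarrow> 0"
proof -
  have "(\<lambda>m. \<integral>\<^sup>+x. ennreal (norm (h m x)) \<partial>M) \<longlonglongrightarrow> 0"
  proof (rule order_tendstoI)
    fix a :: ennreal assume "0 < a"
    then obtain a' where a': "0 < ennreal a'" "ennreal a' < a" "a' \<ge> 0"
      using dense[of 0 a] by (metis ennreal_cases less_top_ennreal not_less_iff_gr_or_eq order_less_trans top.not_eq_extremum)
    obtain \<mu> where \<mu>: "emeasure M (space M) = ennreal \<mu>" "\<mu> \<ge> 0"
      using fin by (cases "emeasure M (space M)") auto
    \<comment> \<open>With this \<open>\<delta>\<close> the constant term contributes at most
      \<open>a' / 2\<close>; the threshold \<open>\<delta> * (a' / 2)\<close> for the quadratic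
      integral makes the other term contribute at most \<open>a' / 2\<close> as well.\<close>
    define \<delta> where "\<delta> = a' / (2 * (\<mu> + 1))"
    have \<delta>: "\<delta> > 0" using a' \<mu> by (auto simp: \<delta>_def)
    have "eventually (\<lambda>m. (\<integral>\<^sup>+x. ennreal ((norm (h m x))\<^sup>2) \<partial>M) < ennreal (\<delta> * (a' / 2))) sequentially"
      using a' \<delta> by (intro order_tendstoD(2)[OF lim]) auto
    then show "eventually (\<lambda>m. (\<integral>\<^sup>+x. ennreal (norm (h m x)) \<partial>M) < a) sequentially"
    proof eventually_elim
      case (elim m)
      have pw: "ennreal (norm (h m x)) \<le> ennreal \<delta> + ennreal (1 / \<delta>) * ennreal ((norm (h m x))\<^sup>2)" for x
      proof -
        have "t \<le> \<delta> + 1 / \<delta> * t\<^sup>2" if "t \<ge> 0" for t :: real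
        proof (cases "t \<le> \<delta>")
          case True
          then show ?thesis using \<delta> by (simp add: add_increasing2)
        next
          case False
          then have "\<delta> * t \<le> t * t" using that by (intro mult_right_mono) auto
          then have "t \<le> 1 / \<delta> * t\<^sup>2" using \<delta> by (simp add: field_simps power2_eq_square)
          then show ?thesis using \<delta> by simp
        qed
        from this[of "norm (h m x)"] show ?thesis
          using \<delta> by (simp flip: ennreal_mult ennreal_plus)
      qed
      note meas [measurable]
      have "(\<integral>\<^sup>+x. ennreal (norm (h m x)) \<partial>M)
          \<le> (\<integral>\<^sup>+x. ennreal \<delta> + ennreal (1 / \<delta>) * ennreal ((norm (h m x))\<^sup>2) \<partial>M)"
        by (intro nn_integral_mono pw)
      also have "\<dots> = ennreal \<delta> * ennreal \<mu> + ennreal (1 / \<delta>) * (\<integral>\<^sup>+x. ennreal ((norm (h m x))\<^sup>2) \<partial>M)"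
        by (subst nn_integral_add) (auto simp: nn_integral_cmult \<mu>)
      also have "\<dots> \<le> ennreal \<delta> * ennreal \<mu> + ennreal (1 / \<delta>) * ennreal (\<delta> * (a' / 2))"
        using elim by (intro add_left_mono mult_left_mono) auto
      also have "\<dots> = ennreal (\<delta> * \<mu> + a' / 2)"
        using \<delta> \<mu> a' by (simp flip: ennreal_mult ennreal_plus)
      also have "\<dots> \<le> ennreal a'"
      proof (rule ennreal_leI)
        have "\<delta> * \<mu> \<le> \<delta> * (\<mu> + 1)" using \<delta> by simp
        also have "\<dots> = a' / 2" using \<mu> by (simp add: \<delta>_def field_simps)
        finally show "\<delta> * \<mu> + a' / 2 \<le> a'" by simp
      qed
      also have "\<dots> < a" by fact
      finally show ?case .
    qed
  qed simp
  then have "(\<lambda>m. enn2real (\<integral>\<^sup>+x. ennreal (norm (h m x)) \<partial>M)) \<longlonglongrightarrow> 0"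
    using tendsto_enn2real[of _ 0] by simp
  then show ?thesis using meas by (simp add: integral_eq_nn_integral)
qed

text \<open>Such points are approached from the domain along \<open>- e\<close>. This places the
  flat disc in the boundary, where surface and slab integrals can be compared.\<close>

lemma flat_part_frontier:
  fixes \<Omega> :: "'a::euclidean_space set"
  assumes half: "\<Omega> \<inter> ball x0 r = {y \<in> ball x0 r. y \<bullet> e < x0 \<bullet> e}" and e: "e \<in> Basis"
    and y: "y \<in> ball x0 r" "y \<bullet> e = x0 \<bullet> e" and \<Omega>: "open \<Omega>"
  shows "y \<in> frontier \<Omega>"
proof -
  have "y \<notin> \<Omega>" using half y by (metis (mono_tags, lifting) IntI less_irrefl mem_Collect_eq)
  moreover have "y \<in> closure \<Omega>"
  proof (rule Lim_in_closed_set[of "closure \<Omega>" "\<lambda>t. y + t *\<^sub>R (- e)" "at_right (0::real)"])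
    have lim: "((\<lambda>t. y + t *\<^sub>R (- e)) \<longlongrightarrow> y + 0 *\<^sub>R (- e)) (at_right 0)" by (intro tendsto_intros)
    then show "((\<lambda>t. y + t *\<^sub>R (- e)) \<longlongrightarrow> y) (at_right 0)" by simp
    have "eventually (\<lambda>t. y + t *\<^sub>R (- e) \<in> ball x0 r) (at_right 0)"
      by (rule topological_tendstoD[OF lim]) (use y in auto)
    moreover have "eventually (\<lambda>t::real. t > 0) (at_right 0)" by (simp add: eventually_at_right_less)
    ultimately show "eventually (\<lambda>t. y + t *\<^sub>R (- e) \<in> closure \<Omega>) (at_right 0)"
    proof eventually_elim
      case (elim t)
      then have "y + t *\<^sub>R (- e) \<in> {y \<in> ball x0 r. y \<bullet> e < x0 \<bullet> e}"
        using y e by (simp add: inner_diff_left)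
      then have "y + t *\<^sub>R (- e) \<in> \<Omega>" using half by blast
      then show ?case using closure_subset by blast
    qed
  qed auto
  ultimately show ?thesis using \<Omega> by (simp add: frontier_def interior_open)
qed

lemma slab_preimage_bounded:
  fixes x0 e :: "'a::euclidean_space"
  assumes "e \<in> Basis" "bounded K"
  obtains R where "{x \<in> slab e. slab_proj e c x \<in> K} \<subseteq> cball 0 R"
proof -
  obtain R where R: "\<And>x. x \<in> K \<Longrightarrow> norm x \<le> R" using assms(2) by (auto simp: bounded_iff)
  have "norm x \<le> R + \<bar>c\<bar> + 1" if x: "x \<in> slab e" "slab_proj e c x \<in> K" for x
  proof -
    have "norm x \<le> norm (slab_proj e c x) + norm ((c - x \<bullet> e) *\<^sub>R e)"
      unfolding slab_proj_def by (metis add_diff_cancel_right' norm_triangle_ineq4)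
    also have "norm ((c - x \<bullet> e) *\<^sub>R e) \<le> \<bar>c\<bar> + 1"
      using x(1) assms(1) by (auto simp: slab_def)
    finally show ?thesis using R[OF x(2)] by simp
  qed
  then have "{x \<in> slab e. slab_proj e c x \<in> K} \<subseteq> cball 0 (R + \<bar>c\<bar> + 1)" by auto
  then show ?thesis by (rule that)
qed

lemma slab_integrable:
  fixes k :: "'a::euclidean_space \<Rightarrow> real"
  assumes e: "e \<in> Basis" and k: "continuous_on UNIV k" and K: "compact K" "\<And>x. x \<notin> K \<Longrightarrow> k x = 0"
  shows "integrable lborel (\<lambda>x. indicator (slab e) x * k (slab_proj e c x))"
proof -
  obtain R where R: "{x \<in> slab e. slab_proj e c x \<in> K} \<subseteq> cball 0 R"
    using slab_preimage_bounded[OF e compact_imp_bounded[OF K(1)]] by blast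
  obtain B where B: "B > 0" "\<And>x. \<bar>k x\<bar> \<le> B"
    using compact_support_bounded[OF k K] by metis
  have [measurable]: "k \<in> borel_measurable borel" using k by (rule borel_measurable_continuous_onI)
  show ?thesis
  proof (rule Bochner_Integration.integrable_bound[where f = "\<lambda>x. B * indicator (cball 0 R) x"])
    show "integrable lborel (\<lambda>x::'a. B * indicator (cball 0 R) x)"
      by (intro integrable_mult_right integrable_real_indicator)
        (auto simp: emeasure_lborel_cball_finite[unfolded infinity_ennreal_def])
    show "AE x in lborel. norm (indicator (slab e) x * k (slab_proj e c x)) \<le> norm (B * indicator (cball 0 R) x)"
    proof (rule AE_I2)
      fix x
      show "norm (indicator (slab e) x * k (slab_proj e c x)) \<le> norm (B * indicator (cball 0 R) x)"
      proof (cases "x \<in> slab e \<and> slab_proj e c x \<in> K")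
        case True
        then have "x \<in> cball 0 R" using R by blast
        then show ?thesis using True B(2)[of "slab_proj e c x"] B(1) by simp
      next
        case False
        then show ?thesis using K(2)[of "slab_proj e c x"] by (auto simp: indicator_def)
      qed
    qed
  qed measurable
qed

lemma integrable_square_integrable:
  fixes h :: "'a::euclidean_space \<Rightarrow> 'b::euclidean_space"
  assumes \<Omega>: "open \<Omega>" "bounded \<Omega>" and h: "square_integrable (lebesgue_on \<Omega>) h"
  shows "integrable (lebesgue_on \<Omega>) h"
proof (rule Bochner_Integration.integrable_bound[where f = "\<lambda>x. 1 + (norm (h x))\<^sup>2"])
  have "integrable (lebesgue_on \<Omega>) (\<lambda>x. 1 :: real)"
    using \<Omega> by (intro integrable_lebesgue_on_bounded[where B = 1]) auto
  then show "integrable (lebesgue_on \<Omega>) (\<lambda>x. 1 + (norm (h x))\<^sup>2)"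
    using h by (intro Bochner_Integration.integrable_add) (auto simp: square_integrable_def)
  show "AE x in lebesgue_on \<Omega>. norm (h x) \<le> norm (1 + (norm (h x))\<^sup>2)"
  proof (rule AE_I2)
    fix x
    have "0 \<le> (norm (h x) - 1)\<^sup>2" by simp
    then have "2 * norm (h x) \<le> 1 + (norm (h x))\<^sup>2" by (simp add: power2_diff)
    moreover have "0 \<le> norm (h x)" by simp
    ultimately have "norm (h x) \<le> 1 + (norm (h x))\<^sup>2" by linarith
    then show "norm (h x) \<le> norm (1 + (norm (h x))\<^sup>2)" by simp
  qed
  show "h \<in> borel_measurable (lebesgue_on \<Omega>)" using h by (simp add: square_integrable_def)
qed

lemma has_real_derivative_compose:
  fixes f :: "'a::euclidean_space \<Rightarrow> real"
  assumes "(A has_real_derivative a) (at (f x))" "(f has_derivative f') (at x)"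
  shows "((\<lambda>x. A (f x)) has_derivative (\<lambda>h. a * f' h)) (at x)"
  using has_derivative_compose[OF assms(2) assms(1)[unfolded has_field_derivative_def]] by simp

section \<open>Green's identity for Sobolev functions with a continuous trace\<close>

context
  fixes \<Omega> :: "'a::euclidean_space set" and x0 e :: 'a and r :: real and K and \<phi> :: "'a \<Rightarrow> real"
    and A a :: "real \<Rightarrow> real" and M :: real
  assumes d: "DIM('a) \<ge> 2" and \<Omega>: "open \<Omega>" "bounded \<Omega>" and e: "e \<in> Basis"
    and half: "\<Omega> \<inter> ball x0 r = {y \<in> ball x0 r. y \<bullet> e < x0 \<bullet> e}"
    and \<phi>: "smooth \<phi>" and K: "compact K" "K \<subseteq> ball x0 r" "\<And>x. x \<notin> K \<Longrightarrow> \<phi> x = 0"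
    and A: "\<And>t. (A has_real_derivative a t) (at t)" and a: "continuous_on UNIV a" "\<And>t. \<bar>a t\<bar> \<le> M"
begin

private abbreviation (input) Q where "Q \<equiv> slab_proj e (x0 \<bullet> e)"

lemma pd_zero: "x \<notin> K \<Longrightarrow> pd i \<phi> x = 0"
  using K by (intro pd_vanishes) (auto intro: compact_imp_closed)

lemma grad_zero: "x \<notin> K \<Longrightarrow> grad \<phi> x = 0"
  by (simp add: grad_def pd_zero)

lemma lap_zero: "x \<notin> K \<Longrightarrow> lap \<phi> x = 0"
  unfolding lap_def using K pd_zero
  by (intro sum.neutral ballI pd_vanishes) (auto intro: compact_imp_closed)

text \<open>By the chain rule the gradient of \<open>A (f x)\<close> is \<open>a (f x)\<close> times
  that of \<open>f\<close>, and on the support of \<open>\<phi>\<close> the domain coincides with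
  the half space of \<open>green_halfspace\<close>.\<close>

lemma green_smooth_trace:
  assumes f: "smooth f"
  shows "(\<integral>x. a (f x) * (grad f x \<bullet> grad \<phi> x) + A (f x) * lap \<phi> x \<partial>lebesgue_on \<Omega>)
    = (\<integral>x. indicator (slab e) x * (A (f (Q x)) * pd e \<phi> (Q x)) \<partial>lborel)"
proof -
  let ?v = "\<lambda>x. A (f x)"
  have fc: "continuous_on UNIV f" using f by (rule smooth_continuous_on)
  have Ac: "continuous_on UNIV A"
    using A DERIV_isCont by (blast intro: continuous_at_imp_continuous_on)
  have D: "(?v has_derivative (\<lambda>h. a (f x) * frechet_derivative f (at x) h)) (at x)" for x
    using A smooth_has_derivative[OF f] by (rule has_real_derivative_compose)
  have pdv: "pd i ?v = (\<lambda>x. a (f x) * pd i f x)" for i using pd_eq[OF D] by (rule ext)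
  have gv: "grad ?v x = a (f x) *\<^sub>R grad f x" for x
    unfolding grad_def fun_cong[OF pdv] by (simp add: scaleR_sum_right)
  let ?h = "\<lambda>x. grad ?v x \<bullet> grad \<phi> x + ?v x * lap \<phi> x"
  have ac: "continuous_on UNIV (\<lambda>x. a (f x))" "continuous_on UNIV ?v"
    using a(1) Ac fc by (auto intro: continuous_on_compose2)
  have hc: "continuous_on UNIV ?h" unfolding gv
    using ac f \<phi> by (intro continuous_intros continuous_on_grad continuous_on_lap) auto
  have "(\<integral>x. indicator {x. x \<bullet> e < x0 \<bullet> e} x * ?h x \<partial>lborel)
    = (\<integral>x. indicator (slab e) x * (?v (Q x) * pd e \<phi> (Q x)) \<partial>lborel)"
  proof (rule green_halfspace[OF e _ _ \<phi> K(1,3)])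
    show "?v differentiable (at x)" for x using D by (rule differentiableI)
    show "continuous_on UNIV (pd i ?v)" if "i \<in> Basis" for i
      unfolding pdv using ac(1) smooth_continuous_on[OF smooth_pd[OF f that]] by (rule continuous_on_mult)
  qed
  moreover have "(\<integral>x. ?h x \<partial>lebesgue_on \<Omega>) = (\<integral>x. indicator {x. x \<bullet> e < x0 \<bullet> e} x * ?h x \<partial>lborel)"
  proof -
    have eq: "indicator \<Omega> x * ?h x = indicator {x. x \<bullet> e < x0 \<bullet> e} x * ?h x" for x
    proof (cases "x \<in> K")
      case True
      then have "x \<in> ball x0 r" using K(2) by blast
      then have "x \<in> \<Omega> \<longleftrightarrow> x \<bullet> e < x0 \<bullet> e" using half by blast
      then show ?thesis by (simp add: indicator_def)
    qed (simp add: grad_zero lap_zero)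
    have [measurable]: "?h \<in> borel_measurable borel" using hc by (rule borel_measurable_continuous_onI)
    have "(\<integral>x. ?h x \<partial>lebesgue_on \<Omega>) = (\<integral>x. indicator {x. x \<bullet> e < x0 \<bullet> e} x * ?h x \<partial>lebesgue)"
      using \<Omega>(1) by (simp only: integral_lebesgue_on borel_open eq)
    also have "\<dots> = (\<integral>x. indicator {x. x \<bullet> e < x0 \<bullet> e} x * ?h x \<partial>lborel)"
      by (rule integral_completion) measurable
    finally show ?thesis .
  qed
  ultimately show ?thesis by (simp add: gv)
qed

lemma A_lipschitz: "\<bar>A s - A t\<bar> \<le> M * \<bar>s - t\<bar>"
proof (cases "s = t")
  case False
  have *: "\<bar>A y - A x\<bar> \<le> M * \<bar>y - x\<bar>" if xy: "x < y" for x y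
  proof -
    obtain z where "A y - A x = (y - x) * a z" using MVT2[OF xy, of A a] A by blast
    then show ?thesis using a(2)[of z] by (simp add: abs_mult mult.commute mult_right_mono)
  qed
  show ?thesis using *[of s t] *[of t s] False
    by (cases "s < t") (auto simp: abs_minus_commute)
qed simp

text \<open>The part of the slab over the support of \<open>\<phi>\<close> has finite measure, so
  \<open>L\<^sup>2\<close> convergence on the surface yields \<open>L\<^sup>1\<close> convergence
  there; the Lipschitz bound on \<open>A\<close> and the bound on the derivative of
  \<open>\<phi>\<close> transfer it to the integrals.\<close>

lemma slab_trace_limit:
  fixes f :: "nat \<Rightarrow> 'a \<Rightarrow> real"
  assumes f: "\<And>m. continuous_on UNIV (f m)" and g: "continuous_on UNIV g"
    and lim: "L2_converges (surface_measure \<Omega>) f g"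
  shows "(\<lambda>m. \<integral>x. indicator (slab e) x * (A (f m (Q x)) * pd e \<phi> (Q x)) \<partial>lborel)
    \<longlonglongrightarrow> (\<integral>x. indicator (slab e) x * (A (g (Q x)) * pd e \<phi> (Q x)) \<partial>lborel)"
proof -
  \<comment> \<open>\<open>D\<close> is the flat piece of the boundary that carries the integral: on
    the rest of the hyperplane the derivative of \<open>\<phi>\<close> vanishes.\<close>
  define D where "D = K \<inter> {x. x \<bullet> e = x0 \<bullet> e}"
  have Dc: "compact D" unfolding D_def
    using K(1) closed_hyperplane[of e "x0 \<bullet> e"] by (simp add: compact_Int_closed inner_commute)
  then have D [measurable]: "D \<in> sets borel" by (rule borel_compact)
  have DF: "D \<subseteq> frontier \<Omega>"
    using flat_part_frontier[OF half e _ _ \<Omega>(1)] K(2) by (auto simp: D_def)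
  define T where "T = {x \<in> slab e. Q x \<in> D}"
  have T [measurable]: "T \<in> sets borel" unfolding T_def by measurable
  have QD: "Q x \<in> D \<longleftrightarrow> Q x \<in> K" for x using e by (simp add: D_def slab_proj_inner)
  obtain R where Tb: "T \<subseteq> cball 0 R"
    unfolding T_def using slab_preimage_bounded[OF e compact_imp_bounded[OF Dc]] by blast
  have Tfin: "emeasure lborel T < \<infinity>"
    using emeasure_mono[OF Tb, of lborel] emeasure_lborel_cball_finite[of "0::'a" R]
    by (auto intro: le_less_trans)
  let ?N = "restrict_space lborel T"
  have fm [measurable]: "f m \<in> borel_measurable borel" "g \<in> borel_measurable borel" for m
    using f g by (auto intro: borel_measurable_continuous_onI)
  have "(\<lambda>m. \<integral>x. norm (f m (Q x) - g (Q x)) \<partial>?N) \<longlonglongrightarrow> 0"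
  proof (rule L2_null_imp_L1_null)
    show "emeasure ?N (space ?N) < \<infinity>" using Tfin T by (simp add: space_restrict_space emeasure_restrict_space)
    show "(\<lambda>x. f m (Q x) - g (Q x)) \<in> borel_measurable ?N" for m
      by (intro measurable_restrict_space1) measurable
    let ?C = "ennreal (4 ^ (DIM('a) - 1) / unit_ball_vol (real (DIM('a) - 1)))"
    have "(\<lambda>m. ?C * (\<integral>\<^sup>+x. ennreal ((norm (f m x - g x))\<^sup>2) \<partial>surface_measure \<Omega>)) \<longlonglongrightarrow> ?C * 0"
      using lim unfolding L2_converges_def by (intro ennreal_tendsto_cmult) auto
    then have C0: "(\<lambda>m. ?C * (\<integral>\<^sup>+x. ennreal ((norm (f m x - g x))\<^sup>2) \<partial>surface_measure \<Omega>)) \<longlonglongrightarrow> 0"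
      by (simp only: mult_zero_right)
    have le: "(\<integral>\<^sup>+x. ennreal ((norm (f m (Q x) - g (Q x)))\<^sup>2) \<partial>?N)
        \<le> ?C * (\<integral>\<^sup>+x. ennreal ((norm (f m x - g x))\<^sup>2) \<partial>surface_measure \<Omega>)" for m
    proof -
      have "(\<integral>\<^sup>+x. ennreal ((norm (f m (Q x) - g (Q x)))\<^sup>2) \<partial>?N)
        = (\<integral>\<^sup>+x. ennreal ((norm (f m (Q x) - g (Q x)))\<^sup>2) * indicator D (Q x) * indicator (slab e) x \<partial>lborel)"
        using T by (subst nn_integral_restrict_space) (auto simp: T_def indicator_def intro!: nn_integral_cong)
      also have "\<dots> \<le> ?C * (\<integral>\<^sup>+x. ennreal ((norm (f m x - g x))\<^sup>2) \<partial>surface_measure \<Omega>)"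
        by (rule slab_nn_integral_le_surface[OF d e _ D DF]) measurable
      finally show ?thesis .
    qed
    show "(\<lambda>m. \<integral>\<^sup>+x. ennreal ((norm (f m (Q x) - g (Q x)))\<^sup>2) \<partial>?N) \<longlonglongrightarrow> 0"
      by (rule tendsto_sandwich[OF _ _ tendsto_const C0]) (intro always_eventually allI zero_le le)+
  qed
  then have L: "(\<lambda>m. \<integral>x. indicator T x * \<bar>f m (Q x) - g (Q x)\<bar> \<partial>lborel) \<longlonglongrightarrow> 0"
    using T by (simp add: integral_restrict_space)
  have pc: "continuous_on UNIV (pd e \<phi>)" using \<phi> e by (intro smooth_continuous_on smooth_pd)
  have [measurable]: "pd e \<phi> \<in> borel_measurable borel" using pc by (rule borel_measurable_continuous_onI)
  obtain B where B: "B > 0" "\<And>x. \<bar>pd e \<phi> x\<bar> \<le> B"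
    using compact_support_bounded[OF pc K(1) pd_zero] by metis
  have Ac: "continuous_on UNIV A"
    using A DERIV_isCont by (blast intro: continuous_at_imp_continuous_on)
  have [measurable]: "A \<in> borel_measurable borel" using Ac by (rule borel_measurable_continuous_onI)
  have QT: "indicator (slab e) x * (h * pd e \<phi> (Q x)) = indicator T x * (h * pd e \<phi> (Q x))" for x h
    using pd_zero[of "Q x" e] QD[of x] by (auto simp: T_def indicator_def)
  have bdd: "\<exists>b. \<forall>x\<in>K. \<bar>h x\<bar> \<le> b" if "continuous_on UNIV h" for h :: "'a \<Rightarrow> real"
    using compact_imp_bounded[OF compact_continuous_image[OF continuous_on_subset[OF that] K(1)]]
    by (auto simp: bounded_iff)
  have intT: "integrable lborel (\<lambda>x. indicator T x * h (Q x))" if hc: "continuous_on UNIV h" for h :: "'a \<Rightarrow> real"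
  proof -
    have [measurable]: "h \<in> borel_measurable borel" using hc by (rule borel_measurable_continuous_onI)
    obtain b where b: "\<And>x. x \<in> K \<Longrightarrow> \<bar>h x\<bar> \<le> b" using bdd[OF hc] by blast
    show ?thesis
    proof (rule Bochner_Integration.integrable_bound[where f = "\<lambda>x. indicator T x * b"])
      show "integrable lborel (\<lambda>x. indicator T x * b)"
        using Tfin by (intro integrable_mult_left integrable_real_indicator) auto
      show "AE x in lborel. norm (indicator T x * h (Q x)) \<le> norm (indicator T x * b)"
        using b QD by (intro AE_I2) (force simp: indicator_def T_def)
    qed measurable
  qed
  let ?I = "\<lambda>h. \<integral>x. indicator T x * (A (h (Q x)) * pd e \<phi> (Q x)) \<partial>lborel"
  have "(\<lambda>m. ?I (f m) - ?I g) \<longlonglongrightarrow> 0"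
  proof (rule Lim_null_comparison)
    show "(\<lambda>m. M * B * (\<integral>x. indicator T x * \<bar>f m (Q x) - g (Q x)\<bar> \<partial>lborel)) \<longlonglongrightarrow> 0"
      using tendsto_mult_left[OF L, of "M * B"] by simp
    show "eventually (\<lambda>m. norm (?I (f m) - ?I g) \<le> M * B * (\<integral>x. indicator T x * \<bar>f m (Q x) - g (Q x)\<bar> \<partial>lborel)) sequentially"
    proof (rule always_eventually, rule allI)
      fix m
      have c: "continuous_on UNIV (\<lambda>x. A (h x) * pd e \<phi> x)" if "continuous_on UNIV h" for h :: "'a \<Rightarrow> real"
        using that Ac pc by (intro continuous_intros) (auto intro: continuous_on_compose2)
      have eq: "?I (f m) - ?I g = (\<integral>x. indicator T x * (A (f m (Q x)) * pd e \<phi> (Q x)) - indicator T x * (A (g (Q x)) * pd e \<phi> (Q x)) \<partial>lborel)"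
        using intT[OF c[OF f[of m]]] intT[OF c[OF g]] by (rule Bochner_Integration.integral_diff[symmetric])
      have "norm (?I (f m) - ?I g) \<le> (\<integral>x. M * B * (indicator T x * \<bar>f m (Q x) - g (Q x)\<bar>) \<partial>lborel)"
        unfolding eq
      proof (rule Bochner_Integration.integral_norm_bound_integral)
        show "integrable lborel (\<lambda>x. indicator T x * (A (f m (Q x)) * pd e \<phi> (Q x)) - indicator T x * (A (g (Q x)) * pd e \<phi> (Q x)))"
          using intT[OF c[OF f[of m]]] intT[OF c[OF g]] by (rule Bochner_Integration.integrable_diff)
        show "integrable lborel (\<lambda>x. M * B * (indicator T x * \<bar>f m (Q x) - g (Q x)\<bar>))"
          using f g by (intro integrable_mult_right intT[of "\<lambda>x. \<bar>f m x - g x\<bar>"] continuous_intros)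
        fix x
        have "\<bar>(A (f m (Q x)) - A (g (Q x))) * pd e \<phi> (Q x)\<bar> \<le> (M * \<bar>f m (Q x) - g (Q x)\<bar>) * B"
          unfolding abs_mult using B A_lipschitz order_trans[OF abs_ge_zero A_lipschitz] by (intro mult_mono) auto
        then show "norm (indicator T x * (A (f m (Q x)) * pd e \<phi> (Q x)) - indicator T x * (A (g (Q x)) * pd e \<phi> (Q x)))
          \<le> M * B * (indicator T x * \<bar>f m (Q x) - g (Q x)\<bar>)"
          by (cases "x \<in> T") (simp_all add: left_diff_distrib mult.commute[of _ B] mult.left_commute[of M B])
      qed
      then show "norm (?I (f m) - ?I g) \<le> M * B * (\<integral>x. indicator T x * \<bar>f m (Q x) - g (Q x)\<bar> \<partial>lborel)"
        unfolding integral_mult_right_zero .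
    qed
  qed
  then have "(\<lambda>m. ?I (f m)) \<longlonglongrightarrow> ?I g" by (simp add: LIM_zero_iff)
  then show ?thesis by (simp only: QT)
qed

text \<open>The identity holds for the smooth functions that define the trace, and both sides pass
  to the limit. The Lipschitz function \<open>A\<close> needs only the convergence of
  \<open>f\<close>, the factor \<open>a (f m x)\<close> needs a subsequence.\<close>

lemma trace_identity:
  assumes tr: "has_trace \<Omega> u g" and g: "continuous_on UNIV g"
  shows "(\<integral>x. a (u x) * (wgrad \<Omega> u x \<bullet> grad \<phi> x) + A (u x) * lap \<phi> x \<partial>lebesgue_on \<Omega>)
    = (\<integral>x. indicator (slab e) x * (A (g (Q x)) * pd e \<phi> (Q x)) \<partial>lborel)"
proof -
  let ?L = "lebesgue_on \<Omega>" and ?w = "wgrad \<Omega> u"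
  obtain f where f: "\<And>m. smooth (f m)" and H1: "H1_converges \<Omega> f u"
    and L2: "L2_converges (surface_measure \<Omega>) f g"
    using tr by (auto simp: has_trace_def)
  have uH: "u \<in> H1 \<Omega>" using tr by (simp add: has_trace_def)
  have fin: "finite_measure ?L"
    using \<Omega> by (intro finite_measure_lebesgue_on) (auto intro: bounded_set_imp_lmeasurable)
  then have efin: "emeasure ?L (space ?L) < \<infinity>" by (simp add: finite_measure.emeasure_finite less_top[symmetric])
  note L1 = integrable_square_integrable[OF \<Omega>]
  have usq: "square_integrable ?L u" using uH by (simp add: H1_def)
  have fsq: "square_integrable ?L (f m)" for m
    using smooth_in_H1[OF \<Omega> f] by (simp add: H1_def)
  have wsq: "square_integrable ?L ?w" using square_integrable_wgrad[OF \<Omega>(1) uH] .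
  have Wsq: "square_integrable ?L (wgrad \<Omega> (f m))" for m
    using square_integrable_wgrad[OF \<Omega>(1) smooth_in_H1[OF \<Omega> f]] .
  note ints = L1[OF usq] L1[OF fsq] L1[OF wsq] L1[OF Wsq]
  note meas [measurable] = ints[THEN borel_measurable_integrable]
  have am [measurable]: "a \<in> borel_measurable borel" using a(1) by (rule borel_measurable_continuous_onI)
  have Ac: "continuous_on UNIV A"
    using A DERIV_isCont by (blast intro: continuous_at_imp_continuous_on)
  have Am [measurable]: "A \<in> borel_measurable borel" using Ac by (rule borel_measurable_continuous_onI)
  have gm [measurable]: "grad \<phi> \<in> borel_measurable ?L"
    by (intro borel_measurable_continuous_lebesgue_on continuous_on_grad \<phi>)
  have lm [measurable]: "lap \<phi> \<in> borel_measurable ?L"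
    by (intro borel_measurable_continuous_lebesgue_on continuous_on_lap \<phi>)
  obtain B1 where B1: "\<And>x. norm (grad \<phi> x) \<le> B1" "B1 > 0"
  proof -
    have "continuous_on UNIV (\<lambda>x. norm (grad \<phi> x))" by (intro continuous_intros continuous_on_grad \<phi>)
    moreover have "norm (grad \<phi> x) = 0" if "x \<notin> K" for x using grad_zero[OF that] by simp
    ultimately show ?thesis
      using compact_support_bounded[OF _ K(1), of "\<lambda>x. norm (grad \<phi> x)"] that by (metis abs_norm_cancel)
  qed
  obtain B2 where B2: "\<And>x. \<bar>lap \<phi> x\<bar> \<le> B2" "B2 > 0"
    using compact_support_bounded[OF continuous_on_lap[OF \<phi>] K(1) lap_zero] by metis
  have M0: "M \<ge> 0" using a(2)[of 0] by linarith
  have fu: "(\<lambda>m. \<integral>x. norm (f m x - u x) \<partial>?L) \<longlonglongrightarrow> 0"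
    using H1 unfolding H1_converges_def L2_converges_def
    by (intro L2_null_imp_L1_null efin) auto
  have Ww: "(\<lambda>m. \<integral>x. norm (wgrad \<Omega> (f m) x - ?w x) \<partial>?L) \<longlonglongrightarrow> 0"
    using H1 unfolding H1_converges_def L2_converges_def
    by (intro L2_null_imp_L1_null efin) auto
  \<comment> \<open>As \<open>a\<close> is merely continuous and bounded, \<open>a (f m x)\<close>
    converges only where \<open>f m x\<close> does; a subsequence provides this almost
    everywhere.\<close>
  obtain \<rho> :: "nat \<Rightarrow> nat" where \<rho>: "strict_mono \<rho>" "AE x in ?L. (\<lambda>n. f (\<rho> n) x - u x) \<longlonglongrightarrow> 0"
  proof -
    have "integrable ?L (\<lambda>x. f n x - u x)" for n by (intro Bochner_Integration.integrable_diff ints)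
    from tendsto_L1_AE_subseq[OF this fu] that show ?thesis by blast
  qed
  \<comment> \<open>\<open>?X\<close> collects the error of the gradients and \<open>?Z\<close> that
    of \<open>A\<close>; both tend to zero in \<open>L\<^sup>1\<close>. In \<open>?Y\<close> the
    limit gradient is fixed, so dominated convergence applies.\<close>
  let ?X = "\<lambda>m x. a (f m x) * ((wgrad \<Omega> (f m) x - ?w x) \<bullet> grad \<phi> x)"
  let ?Y = "\<lambda>m x. a (f m x) * (?w x \<bullet> grad \<phi> x)"
  let ?Z = "\<lambda>m x. (A (f m x) - A (u x)) * lap \<phi> x"
  have dot: "\<bar>a s * (v \<bullet> grad \<phi> x)\<bar> \<le> M * B1 * norm v" for s v x
  proof -
    have "\<bar>v \<bullet> grad \<phi> x\<bar> \<le> norm v * B1"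
      using order_trans[OF Cauchy_Schwarz_ineq2[of v "grad \<phi> x"] mult_left_mono[OF B1(1)[of x] norm_ge_zero[of v]]] .
    then have "\<bar>a s\<bar> * \<bar>v \<bullet> grad \<phi> x\<bar> \<le> M * (norm v * B1)"
      using a(2) M0 by (intro mult_mono) auto
    then show ?thesis by (simp add: abs_mult ac_simps)
  qed
  have intdot: "integrable ?L (\<lambda>x. a (k x) * (v x \<bullet> grad \<phi> x))"
    if "integrable ?L v" "k \<in> borel_measurable ?L" for k v
  proof (rule Bochner_Integration.integrable_bound[where f = "\<lambda>x. M * B1 * norm (v x)"])
    note that(2) [measurable] borel_measurable_integrable[OF that(1), measurable]
    show "(\<lambda>x. a (k x) * (v x \<bullet> grad \<phi> x)) \<in> borel_measurable ?L" by measurable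
    show "AE x in ?L. norm (a (k x) * (v x \<bullet> grad \<phi> x)) \<le> norm (M * B1 * norm (v x))"
      using dot order_trans[OF dot abs_ge_self] by (intro AE_I2) (simp only: real_norm_def)
  qed (use that in simp)
  have Zb: "\<bar>(A s - A t) * lap \<phi> x\<bar> \<le> M * B2 * \<bar>s - t\<bar>" for s t x
    using mult_mono[OF A_lipschitz[of s t] B2(1)[of x]] order_trans[OF abs_ge_zero A_lipschitz[of s t]]
    by (simp add: abs_mult ac_simps)
  have intA: "integrable ?L (\<lambda>x. A (k x) * lap \<phi> x)" if k: "integrable ?L k" for k
  proof -
    note borel_measurable_integrable[OF k, measurable]
    have i1: "integrable ?L (\<lambda>x. (A (k x) - A 0) * lap \<phi> x)"
    proof (rule Bochner_Integration.integrable_bound[where f = "\<lambda>x. M * B2 * \<bar>k x\<bar>"])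
      show "AE x in ?L. norm ((A (k x) - A 0) * lap \<phi> x) \<le> norm (M * B2 * \<bar>k x\<bar>)"
        using Zb[of _ 0] order_trans[OF Zb[of _ 0] abs_ge_self] by (intro AE_I2) simp
    qed (use k in \<open>simp, measurable\<close>)
    have "integrable ?L (\<lambda>x. A 0 * lap \<phi> x)"
      using \<Omega> B2 lm by (intro integrable_mult_right integrable_lebesgue_on_bounded[where B = B2]) auto
    from Bochner_Integration.integrable_add[OF i1 this] show ?thesis by (simp add: algebra_simps)
  qed
  let ?I = "\<lambda>m. \<integral>x. a (f m x) * (grad (f m) x \<bullet> grad \<phi> x) + A (f m x) * lap \<phi> x \<partial>?L"
  let ?J = "\<integral>x. a (u x) * (?w x \<bullet> grad \<phi> x) + A (u x) * lap \<phi> x \<partial>?L"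
  have split: "?I m = (\<integral>x. ?X m x \<partial>?L) + (\<integral>x. ?Y m x \<partial>?L) + (\<integral>x. ?Z m x \<partial>?L) + (\<integral>x. A (u x) * lap \<phi> x \<partial>?L)" for m
  proof -
    have "?I m = (\<integral>x. ?X m x + ?Y m x + ?Z m x + A (u x) * lap \<phi> x \<partial>?L)"
    proof (rule integral_cong_AE)
      have "grad (f m) \<in> borel_measurable ?L"
        by (intro borel_measurable_continuous_lebesgue_on continuous_on_grad f)
      note [measurable] = this
      show "(\<lambda>x. a (f m x) * (grad (f m) x \<bullet> grad \<phi> x) + A (f m x) * lap \<phi> x) \<in> borel_measurable ?L"
        by measurable
      show "AE x in ?L. a (f m x) * (grad (f m) x \<bullet> grad \<phi> x) + A (f m x) * lap \<phi> x
          = ?X m x + ?Y m x + ?Z m x + A (u x) * lap \<phi> x"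
        using wgrad_smooth_AE[OF \<Omega>(1) f[of m]]
        by eventually_elim (simp add: inner_diff_left algebra_simps)
    qed measurable
    moreover have "integrable ?L (?X m)" "integrable ?L (?Y m)"
      using ints by (auto intro!: intdot)
    moreover have "integrable ?L (?Z m)"
      using Bochner_Integration.integrable_diff[OF intA[OF L1[OF fsq]] intA[OF L1[OF usq]]]
      by (simp add: left_diff_distrib)
    ultimately show ?thesis using intA[OF L1[OF usq]] by simp
  qed
  have X0: "(\<lambda>m. \<integral>x. ?X m x \<partial>?L) \<longlonglongrightarrow> 0"
  proof (rule Lim_null_comparison)
    show "(\<lambda>m. M * B1 * (\<integral>x. norm (wgrad \<Omega> (f m) x - ?w x) \<partial>?L)) \<longlonglongrightarrow> 0"
      using tendsto_mult_left[OF Ww, of "M * B1"] by simp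
    have "norm (\<integral>x. ?X m x \<partial>?L) \<le> (\<integral>x. M * B1 * norm (wgrad \<Omega> (f m) x - ?w x) \<partial>?L)" for m
      using ints dot by (intro Bochner_Integration.integral_norm_bound_integral intdot) auto
    then show "eventually (\<lambda>m. norm (\<integral>x. ?X m x \<partial>?L) \<le> M * B1 * (\<integral>x. norm (wgrad \<Omega> (f m) x - ?w x) \<partial>?L)) sequentially"
      by (intro always_eventually) simp
  qed
  have Z0: "(\<lambda>m. \<integral>x. ?Z m x \<partial>?L) \<longlonglongrightarrow> 0"
  proof (rule Lim_null_comparison)
    show "(\<lambda>m. M * B2 * (\<integral>x. norm (f m x - u x) \<partial>?L)) \<longlonglongrightarrow> 0"
      using tendsto_mult_left[OF fu, of "M * B2"] by simp
    have "norm (\<integral>x. ?Z m x \<partial>?L) \<le> (\<integral>x. M * B2 * norm (f m x - u x) \<partial>?L)" for m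
    proof (rule Bochner_Integration.integral_norm_bound_integral)
      show "integrable ?L (?Z m)"
        using Bochner_Integration.integrable_diff[OF intA[OF L1[OF fsq]] intA[OF L1[OF usq]]]
        by (simp add: left_diff_distrib)
    qed (use ints Zb in auto)
    then show "eventually (\<lambda>m. norm (\<integral>x. ?Z m x \<partial>?L) \<le> M * B2 * (\<integral>x. norm (f m x - u x) \<partial>?L)) sequentially"
      by (intro always_eventually) simp
  qed
  have Y0: "(\<lambda>n. \<integral>x. ?Y (\<rho> n) x \<partial>?L) \<longlonglongrightarrow> (\<integral>x. a (u x) * (?w x \<bullet> grad \<phi> x) \<partial>?L)"
  proof (rule integral_dominated_convergence[where w = "\<lambda>x. M * B1 * norm (?w x)"])
    show "integrable ?L (\<lambda>x. M * B1 * norm (?w x))" using ints by simp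
    show "AE x in ?L. (\<lambda>n. ?Y (\<rho> n) x) \<longlonglongrightarrow> a (u x) * (?w x \<bullet> grad \<phi> x)"
      using \<rho>(2)
    proof eventually_elim
      case (elim x)
      then have "(\<lambda>n. f (\<rho> n) x) \<longlonglongrightarrow> u x" by (simp add: LIM_zero_iff)
      then have "(\<lambda>n. a (f (\<rho> n) x)) \<longlonglongrightarrow> a (u x)"
        using continuous_on_tendsto_compose[OF a(1)] by simp
      then show ?case by (rule tendsto_mult_right)
    qed
    show "AE x in ?L. norm (?Y (\<rho> n) x) \<le> M * B1 * norm (?w x)" for n
      using dot by (intro AE_I2) simp
  qed measurable
  have "(\<lambda>n. ?I (\<rho> n)) \<longlonglongrightarrow> 0 + (\<integral>x. a (u x) * (?w x \<bullet> grad \<phi> x) \<partial>?L) + 0 + (\<integral>x. A (u x) * lap \<phi> x \<partial>?L)"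
    unfolding split
    by (intro tendsto_add tendsto_const Y0 LIMSEQ_subseq_LIMSEQ[OF X0 \<rho>(1), unfolded comp_def]
      LIMSEQ_subseq_LIMSEQ[OF Z0 \<rho>(1), unfolded comp_def])
  also have "0 + (\<integral>x. a (u x) * (?w x \<bullet> grad \<phi> x) \<partial>?L) + 0 + (\<integral>x. A (u x) * lap \<phi> x \<partial>?L) = ?J"
    using intdot[OF L1[OF wsq] meas(1)] intA[OF L1[OF usq]] by simp
  finally have "(\<lambda>n. ?I (\<rho> n)) \<longlonglongrightarrow> ?J" .
  moreover have "(\<lambda>n. ?I (\<rho> n)) \<longlonglongrightarrow> (\<integral>x. indicator (slab e) x * (A (g (Q x)) * pd e \<phi> (Q x)) \<partial>lborel)"
    unfolding green_smooth_trace[OF f]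
    using LIMSEQ_subseq_LIMSEQ[OF slab_trace_limit[OF smooth_continuous_on[OF f] g L2] \<rho>(1)]
    by (simp add: comp_def)
  ultimately show ?thesis by (rule LIMSEQ_unique)
qed

end

section \<open>Singular harmonic test functions\<close>

text \<open>With s = 1/t the bound compares one term of the exponential series with its sum.\<close>

lemma flat_le_fact: "flat m t \<le> fact m"
proof (cases "t > 0")
  case True
  define s where "s = 1 / t"
  have s: "s > 0" using True by (simp add: s_def)
  have "s ^ m / fact m \<le> exp s"
  proof -
    have "(\<lambda>n. s ^ n /\<^sub>R fact n) sums exp s" by (rule exp_converges)
    then have "sum (\<lambda>n. s ^ n /\<^sub>R fact n) {m} \<le> exp s"
      using s by (intro sum_le_suminf[THEN order_trans, OF _ _ _ eq_refl]) (auto simp: sums_iff)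
    then show ?thesis by (simp add: divide_inverse mult.commute)
  qed
  then have "s ^ m * exp (- s) \<le> fact m"
    by (simp add: exp_minus field_simps)
  then show ?thesis using True by (simp add: flat_def s_def field_simps)
qed simp

lemma flat_0_has_derivative: "(flat 0 has_real_derivative flat 2 t) (at t)"
  using flat_has_derivative[of 0 t] by (simp add: numeral_2_eq_2)

lemma flat_2_has_derivative: "(flat 2 has_real_derivative flat 4 t - 2 * flat 3 t) (at t)"
  using flat_has_derivative[of 2 t] by (simp add: eval_nat_numeral)

lemma has_derivative_inner_diff:
  "((\<lambda>x. (x - a) \<bullet> b) has_derivative (\<lambda>h. h \<bullet> b)) (at x)"
  by (auto intro!: derivative_eq_intros)

lemma has_derivative_norm_sq_diff:
  fixes y :: "'a::euclidean_space"
  shows "((\<lambda>x. (norm (x - y))\<^sup>2) has_derivative (\<lambda>h. 2 * (h \<bullet> (x - y)))) (at x)"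
proof -
  have "((\<lambda>x. (x - y) \<bullet> (x - y)) has_derivative (\<lambda>h. 2 * (h \<bullet> (x - y)))) (at x)"
    by (auto intro!: derivative_eq_intros simp: inner_commute)
  then show ?thesis by (simp add: power2_norm_eq_inner)
qed

lemma pd_add:
  assumes "f differentiable (at x)" "g differentiable (at x)"
  shows "pd i (\<lambda>x. f x + g x) x = pd i f x + pd i g x"
  using has_derivative_add[of f _ "at x" g, OF assms[unfolded frechet_derivative_works]]
  by (rule pd_eq)

section \<open>The cut-off dipole and its estimates below the flat boundary\<close>

context
  fixes x0 e :: "'a::euclidean_space" and r \<epsilon> :: real
  assumes e: "e \<in> Basis" and \<epsilon>: "\<epsilon> > 0"
begin

definition pole where "pole = x0 + \<epsilon> *\<^sub>R e"
definition hgt where "hgt x = (x - x0) \<bullet> e"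
text \<open>A cut-off without plateau around \<open>x0\<close>. Its gradient is a multiple of
  \<open>x - x0\<close>, so it is small where the dipole is large, which does the work of a
  plateau.\<close>

definition bump where "bump x = flat 0 (r\<^sup>2 / 4 - (norm (x - x0))\<^sup>2)"

text \<open>In the half space \<open>hgt x \<le> 0\<close> this is the squared distance from the pole; the flat term
  removes the singularity at the pole.\<close>

definition rsq where "rsq x = (norm (x - pole))\<^sup>2 + flat 0 (hgt x)"

text \<open>For \<open>hgt x \<le> 0\<close> this is the dipole potential: up to a constant factor,
  the derivative along \<open>e\<close> of the fundamental solution of the Laplace equation centred
  at \<open>pole\<close>.\<close>

definition sing where "sing x = (\<epsilon> - hgt x) * rsq x powr (- real DIM('a) / 2)"
definition probe where "probe x = bump x * sing x"

lemma rsq_pos: "rsq x > 0"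
proof (cases "x = pole")
  case True
  then have "hgt x = \<epsilon>" using e by (simp add: hgt_def pole_def)
  then show ?thesis using \<epsilon> by (simp add: rsq_def add_nonneg_pos)
next
  case False
  then show ?thesis by (simp add: rsq_def add_pos_nonneg)
qed

lemma smooth_hgt: "smooth hgt"
  unfolding hgt_def inner_diff_left by (intro smooth_diff) simp_all

lemma smooth_bump: "smooth bump"
  unfolding bump_def by (intro smooth_flat smooth_diff smooth_norm_sq smooth_const)

lemma smooth_rsq: "smooth rsq"
  unfolding rsq_def by (intro smooth_add smooth_norm_sq smooth_flat smooth_hgt)

lemma smooth_sing: "smooth sing"
  unfolding sing_def
  by (intro smooth_mult smooth_diff smooth_const smooth_hgt smooth_powr smooth_rsq rsq_pos)

lemma smooth_probe: "smooth probe"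
  unfolding probe_def by (intro smooth_mult smooth_bump smooth_sing)

lemma bump_outside: "r \<ge> 0 \<Longrightarrow> norm (x - x0) \<ge> r / 2 \<Longrightarrow> bump x = 0"
proof -
  assume "r \<ge> 0" "norm (x - x0) \<ge> r / 2"
  then have "(r / 2)\<^sup>2 \<le> (norm (x - x0))\<^sup>2" by (intro power_mono) auto
  then show ?thesis by (simp add: bump_def power_divide)
qed

lemma probe_outside: "r \<ge> 0 \<Longrightarrow> x \<notin> cball x0 (r / 2) \<Longrightarrow> probe x = 0"
  using bump_outside[of x] by (simp add: probe_def dist_norm norm_minus_commute)

lemma hgt_derivative: "(hgt has_derivative (\<lambda>h. h \<bullet> e)) (at x)"
  unfolding hgt_def by (rule has_derivative_inner_diff)

lemma pd_bump: "pd i bump x = - 2 * flat 2 (r\<^sup>2 / 4 - (norm (x - x0))\<^sup>2) * ((x - x0) \<bullet> i)"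
proof -
  have "((\<lambda>x. r\<^sup>2 / 4 - (norm (x - x0))\<^sup>2) has_derivative (\<lambda>h. - (2 * (h \<bullet> (x - x0))))) (at x)"
    using has_derivative_diff[OF has_derivative_const has_derivative_norm_sq_diff] by simp
  note D = has_real_derivative_compose[OF flat_0_has_derivative this]
  show ?thesis
    unfolding bump_def[abs_def] pd_eq[OF D] by (simp add: inner_commute)
qed

lemma pd2_bump: "frechet_derivative (pd i bump) (at x) i
  = 4 * (flat 4 (r\<^sup>2 / 4 - (norm (x - x0))\<^sup>2) - 2 * flat 3 (r\<^sup>2 / 4 - (norm (x - x0))\<^sup>2)) * ((x - x0) \<bullet> i)\<^sup>2
    - 2 * flat 2 (r\<^sup>2 / 4 - (norm (x - x0))\<^sup>2) * (i \<bullet> i)"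
proof -
  have "((\<lambda>x. r\<^sup>2 / 4 - (norm (x - x0))\<^sup>2) has_derivative (\<lambda>h. - (2 * (h \<bullet> (x - x0))))) (at x)"
    using has_derivative_diff[OF has_derivative_const has_derivative_norm_sq_diff] by simp
  note D = has_real_derivative_compose[OF flat_2_has_derivative this]
  note D2 = has_derivative_mult[OF has_derivative_mult_right[OF D, of "-2"] has_derivative_inner_diff[of x0 i x]]
  show ?thesis
    unfolding pd_bump[abs_def] pd_eq[OF D2] by (simp add: algebra_simps power2_eq_square inner_commute)
qed

lemma pd_rsq: "pd i rsq x = 2 * ((x - pole) \<bullet> i) + flat 2 (hgt x) * (i \<bullet> e)"
proof -
  note D = has_derivative_add[OF has_derivative_norm_sq_diff[of pole x]
      has_real_derivative_compose[OF flat_0_has_derivative hgt_derivative]]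
  show ?thesis unfolding rsq_def[abs_def] pd_eq[OF D] by (simp add: inner_commute)
qed

lemma pd2_rsq: "frechet_derivative (pd i rsq) (at x) i
  = 2 * (i \<bullet> i) + (flat 4 (hgt x) - 2 * flat 3 (hgt x)) * (i \<bullet> e)\<^sup>2"
proof -
  note D = has_derivative_add[OF has_derivative_mult_right[OF has_derivative_inner_diff[of pole i x], of 2]
      has_derivative_mult_left[OF has_real_derivative_compose[OF flat_2_has_derivative hgt_derivative], of "i \<bullet> e"]]
  show ?thesis unfolding pd_rsq[abs_def] pd_eq[OF D] by (simp add: power2_eq_square)
qed

lemma rsq_powr_derivative:
  "((\<lambda>x. rsq x powr m) has_derivative (\<lambda>h. m * rsq x powr (m - 1) * frechet_derivative rsq (at x) h)) (at x)"
proof -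
  have "((\<lambda>t. t powr m) has_real_derivative m * rsq x powr (m - 1)) (at (rsq x))"
    using rsq_pos by (auto intro!: derivative_eq_intros)
  from has_real_derivative_compose[OF this smooth_has_derivative[OF smooth_rsq]] show ?thesis .
qed

lemma pd_sing: "pd i sing x = - (i \<bullet> e) * rsq x powr (- real DIM('a) / 2)
    + (\<epsilon> - hgt x) * (- real DIM('a) / 2 * rsq x powr (- real DIM('a) / 2 - 1) * pd i rsq x)"
proof -
  have "((\<lambda>x. \<epsilon> - hgt x) has_derivative (\<lambda>h. - (h \<bullet> e))) (at x)"
    using has_derivative_diff[OF has_derivative_const hgt_derivative] by simp
  note D = has_derivative_mult[OF this rsq_powr_derivative]
  show ?thesis unfolding sing_def[abs_def] pd_eq[OF D] by simp
qed

lemma pd2_sing: "i \<in> Basis \<Longrightarrow> frechet_derivative (pd i sing) (at x) i =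
    - 2 * (i \<bullet> e) * (- real DIM('a) / 2 * rsq x powr (- real DIM('a) / 2 - 1) * pd i rsq x)
    + (\<epsilon> - hgt x) * (- real DIM('a) / 2) *
      ((- real DIM('a) / 2 - 1) * rsq x powr (- real DIM('a) / 2 - 2) * (pd i rsq x)\<^sup>2
        + rsq x powr (- real DIM('a) / 2 - 1) * frechet_derivative (pd i rsq) (at x) i)"
proof -
  assume i: "i \<in> Basis"
  let ?\<alpha> = "- real DIM('a) / 2"
  have P: "((\<lambda>x. \<epsilon> - hgt x) has_derivative (\<lambda>h. - (h \<bullet> e))) (at x)"
    using has_derivative_diff[OF has_derivative_const hgt_derivative] by simp
  have R: "(pd i rsq has_derivative frechet_derivative (pd i rsq) (at x)) (at x)"
    using i by (intro smooth_has_derivative smooth_pd smooth_rsq)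
  have "?\<alpha> - 1 - 1 = ?\<alpha> - 2" by simp
  note D = has_derivative_add[OF has_derivative_mult_right[OF rsq_powr_derivative[of ?\<alpha> x], of "- (i \<bullet> e)"]
    has_derivative_mult[OF P has_derivative_mult[OF has_derivative_mult_right[OF rsq_powr_derivative[of "?\<alpha> - 1" x], of ?\<alpha>] R]]]
  show ?thesis
    unfolding pd_sing[abs_def] pd_eq[OF D] \<open>?\<alpha> - 1 - 1 = ?\<alpha> - 2\<close>
    by (simp add: algebra_simps power2_eq_square)
qed

context
  fixes x
  assumes x: "hgt x \<le> 0"
begin

private abbreviation (input) "\<rho> \<equiv> norm (x - pole)"

lemma hgt_pole: "(x - pole) \<bullet> e = hgt x - \<epsilon>"
  using e by (simp add: hgt_def pole_def inner_diff_left inner_add_left)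

lemma rho_ge: "\<epsilon> - hgt x \<le> \<rho>" "\<epsilon> \<le> \<rho>" "\<rho> > 0"
proof -
  show *: "\<epsilon> - hgt x \<le> \<rho>" using Basis_le_norm[OF e, of "x - pole"] hgt_pole by simp
  then show "\<epsilon> \<le> \<rho>" using x by simp
  then show "\<rho> > 0" using \<epsilon> by linarith
qed

lemma norm_x0_le: "norm (x - x0) \<le> 2 * \<rho>"
proof -
  have "x - x0 = (x - pole) + \<epsilon> *\<^sub>R e" by (simp add: pole_def)
  then have "norm (x - x0) \<le> \<rho> + norm (\<epsilon> *\<^sub>R e)" by (metis norm_triangle_ineq)
  then show ?thesis using rho_ge e \<epsilon> by simp
qed

lemma rsq_eq: "rsq x = \<rho>\<^sup>2"
  using x by (simp add: rsq_def)

lemma rsq_powr: "rsq x powr (- real DIM('a) / 2 - real k) = 1 / \<rho> ^ (DIM('a) + 2 * k)"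
proof -
  have "\<rho>\<^sup>2 = \<rho> powr 2" using rho_ge by (simp add: powr_numeral)
  then have "rsq x powr (- real DIM('a) / 2 - real k) = \<rho> powr (2 * (- real DIM('a) / 2 - real k))"
    unfolding rsq_eq by (simp only: powr_powr)
  also have "2 * (- real DIM('a) / 2 - real k) = - real (DIM('a) + 2 * k)" by simp
  also have "\<rho> powr (- real (DIM('a) + 2 * k)) = 1 / \<rho> ^ (DIM('a) + 2 * k)"
    using rho_ge by (simp only: powr_minus powr_realpow inverse_eq_divide)
  finally show ?thesis .
qed

lemma rsq_powrs:
  "rsq x powr (- real DIM('a) / 2) = 1 / \<rho> ^ DIM('a)"
  "rsq x powr (- real DIM('a) / 2 - 1) = 1 / \<rho> ^ (DIM('a) + 2)"
  "rsq x powr (- real DIM('a) / 2 - 2) = 1 / \<rho> ^ (DIM('a) + 4)"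
  using rsq_powr[of 0] rsq_powr[of 1] rsq_powr[of 2] by simp_all

lemma pd_rsq_below: "pd i rsq x = 2 * ((x - pole) \<bullet> i)"
  using x by (simp add: pd_rsq)

text \<open>The dipole is harmonic away from its pole. With \<open>p = \<epsilon> - hgt x\<close>,
  the mixed, radial and trace terms have the coefficients \<open>- 2 * n\<close>,
  \<open>n * (n + 2)\<close> and \<open>- n\<^sup>2\<close> in front of the same
  \<open>p * ?A\<close>.\<close>

lemma lap_sing: "lap sing x = 0"
proof -
  define n p where "n = real DIM('a)" and "p = \<epsilon> - hgt x"
  let ?A = "1 / \<rho> ^ (DIM('a) + 2)"
  have B: "1 / \<rho> ^ (DIM('a) + 4) = ?A / \<rho>\<^sup>2" by (simp add: power_add eval_nat_numeral)
  have "lap sing x = (\<Sum>i\<in>Basis. n * (i \<bullet> e) * ?A * (2 * ((x - pole) \<bullet> i))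
      + p * (- n / 2) * ((- n / 2 - 1) * (?A / \<rho>\<^sup>2) * (4 * ((x - pole) \<bullet> i)\<^sup>2) + ?A * 2))"
    unfolding lap_def
  proof (intro sum.cong refl)
    fix i :: 'a assume i: "i \<in> Basis"
    show "frechet_derivative (pd i sing) (at x) i = n * (i \<bullet> e) * ?A * (2 * ((x - pole) \<bullet> i))
      + p * (- n / 2) * ((- n / 2 - 1) * (?A / \<rho>\<^sup>2) * (4 * ((x - pole) \<bullet> i)\<^sup>2) + ?A * 2)"
      unfolding pd2_sing[OF i] pd2_rsq pd_rsq_below rsq_powrs B
      using x i by (simp add: n_def p_def power_mult_distrib)
  qed
  also have "\<dots> = (\<Sum>i\<in>Basis. 2 * n * ?A * (((x - pole) \<bullet> i) * (e \<bullet> i))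
      + (p * (- n / 2) * ((- n / 2 - 1) * (?A / \<rho>\<^sup>2) * 4)) * ((x - pole) \<bullet> i)\<^sup>2 + p * (- n / 2) * (?A * 2))"
    by (intro sum.cong refl) (simp only: distrib_left mult.assoc mult.left_commute mult.commute inner_commute)
  also have "\<dots> = 2 * n * ?A * (\<Sum>i\<in>Basis. ((x - pole) \<bullet> i) * (e \<bullet> i))
      + (p * (- n / 2) * ((- n / 2 - 1) * (?A / \<rho>\<^sup>2) * 4)) * (\<Sum>i\<in>Basis. ((x - pole) \<bullet> i)\<^sup>2)
      + real DIM('a) * (p * (- n / 2) * (?A * 2))"
    by (simp only: sum.distrib sum_distrib_left sum_constant)
  also have "(\<Sum>i\<in>Basis. ((x - pole) \<bullet> i) * (e \<bullet> i)) = - p"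
    using hgt_pole by (simp add: euclidean_inner[symmetric] p_def)
  also have "(\<Sum>i\<in>Basis. ((x - pole) \<bullet> i)\<^sup>2) = \<rho>\<^sup>2"
    unfolding power2_norm_eq_inner by (subst euclidean_inner) (simp add: power2_eq_square)
  also have "2 * n * ?A * - p + (p * (- n / 2) * ((- n / 2 - 1) * (?A / \<rho>\<^sup>2) * 4)) * \<rho>\<^sup>2
      + real DIM('a) * (p * (- n / 2) * (?A * 2)) = 0"
  proof -
    have "?A / \<rho>\<^sup>2 * \<rho>\<^sup>2 = ?A" using rho_ge by simp
    then have "(p * (- n / 2) * ((- n / 2 - 1) * (?A / \<rho>\<^sup>2) * 4)) * \<rho>\<^sup>2 = p * (- n / 2) * ((- n / 2 - 1) * ?A * 4)"
      by (metis (no_types, lifting) mult.assoc mult.commute)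
    moreover have "2 * n * A * - p + p * (- n / 2) * ((- n / 2 - 1) * A * 4) + n * (p * (- n / 2) * (A * 2)) = 0" for A
      by (simp add: algebra_simps)
    ultimately show ?thesis by (simp only: n_def)
  qed
  finally show ?thesis .
qed

lemma sing_le: "\<bar>sing x\<bar> \<le> \<rho> / \<rho> ^ DIM('a)"
  using rho_ge x \<epsilon> unfolding sing_def rsq_powrs by (simp add: abs_mult divide_right_mono)

lemma pd_sing_le: "i \<in> Basis \<Longrightarrow> \<bar>pd i sing x\<bar> \<le> (1 + real DIM('a)) / \<rho> ^ DIM('a)"
proof -
  assume i: "i \<in> Basis"
  have ie: "\<bar>i \<bullet> e\<bar> \<le> 1" using i e by (simp add: inner_Basis)
  have p: "0 \<le> \<epsilon> - hgt x" "\<epsilon> - hgt x \<le> \<rho>" using x \<epsilon> rho_ge by auto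
  have "\<bar>(\<epsilon> - hgt x) * (- real DIM('a) / 2 * (1 / \<rho> ^ (DIM('a) + 2)) * (2 * ((x - pole) \<bullet> i)))\<bar>
    = real DIM('a) / \<rho> ^ (DIM('a) + 2) * ((\<epsilon> - hgt x) * \<bar>(x - pole) \<bullet> i\<bar>)"
    using p rho_ge by (simp add: abs_mult)
  also have "\<dots> \<le> real DIM('a) / \<rho> ^ (DIM('a) + 2) * (\<rho> * \<rho>)"
    using p rho_ge Basis_le_norm[OF i, of "x - pole"]
    by (intro mult_left_mono mult_mono) auto
  also have "\<dots> = real DIM('a) / \<rho> ^ DIM('a)" using rho_ge by (simp add: power_add power2_eq_square)
  finally have *: "\<bar>(\<epsilon> - hgt x) * (- real DIM('a) / 2 * (1 / \<rho> ^ (DIM('a) + 2)) * (2 * ((x - pole) \<bullet> i)))\<bar>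
      \<le> real DIM('a) / \<rho> ^ DIM('a)" .
  have "\<bar>- (i \<bullet> e) * (1 / \<rho> ^ DIM('a))\<bar> \<le> 1 / \<rho> ^ DIM('a)"
    using ie rho_ge by (simp add: abs_mult divide_right_mono)
  then show ?thesis
    unfolding pd_sing rsq_powrs pd_rsq_below add_divide_distrib
    using * by (rule order_trans[OF abs_triangle_ineq add_mono])
qed

text \<open>The constant is the product of 2 from the chain rule, 2 = \<open>fact 2\<close> for
  \<open>flat 2\<close>, and the bound \<open>2 * \<rho>\<close> for the distance from
  \<open>x0\<close>. The factor \<open>\<rho>\<close> is what the estimate of the Laplacian lives
  on.\<close>

lemma pd_bump_le: "i \<in> Basis \<Longrightarrow> \<bar>pd i bump x\<bar> \<le> 8 * \<rho>"
proof -
  assume i: "i \<in> Basis"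
  have "\<bar>flat 2 (r\<^sup>2 / 4 - (norm (x - x0))\<^sup>2)\<bar> \<le> 2"
    using flat_le_fact[of 2 "r\<^sup>2 / 4 - (norm (x - x0))\<^sup>2"] by (simp add: eval_nat_numeral)
  moreover have "\<bar>(x - x0) \<bullet> i\<bar> \<le> 2 * \<rho>" using Basis_le_norm[OF i, of "x - x0"] norm_x0_le by linarith
  ultimately have "\<bar>flat 2 (r\<^sup>2 / 4 - (norm (x - x0))\<^sup>2)\<bar> * \<bar>(x - x0) \<bullet> i\<bar> \<le> 2 * (2 * \<rho>)"
    by (intro mult_mono) auto
  then show ?thesis unfolding pd_bump abs_mult by (simp add: mult.commute)
qed

lemma probe_le: "\<bar>probe x\<bar> \<le> \<rho> / \<rho> ^ DIM('a)"
proof -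
  have "\<bar>bump x\<bar> \<le> 1" by (simp add: bump_def flat_0_le_1)
  then have "\<bar>bump x\<bar> * \<bar>sing x\<bar> \<le> 1 * (\<rho> / \<rho> ^ DIM('a))" using sing_le by (intro mult_mono) auto
  then show ?thesis by (simp add: probe_def abs_mult)
qed

lemma pd_probe: "pd i probe x = bump x * pd i sing x + pd i bump x * sing x"
  unfolding probe_def[abs_def]
  by (intro pd_mult smooth_differentiable smooth_bump smooth_sing)

lemma pd_probe_le: "i \<in> Basis \<Longrightarrow> \<rho> \<le> r \<Longrightarrow> \<bar>pd i probe x\<bar> \<le> (1 + real DIM('a) + 8 * r\<^sup>2) / \<rho> ^ DIM('a)"
proof -
  assume i: "i \<in> Basis" and r: "\<rho> \<le> r"
  have "\<bar>bump x\<bar> \<le> 1" by (simp add: bump_def flat_0_le_1)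
  then have "\<bar>bump x\<bar> * \<bar>pd i sing x\<bar> \<le> 1 * ((1 + real DIM('a)) / \<rho> ^ DIM('a))"
    using pd_sing_le[OF i] by (intro mult_mono) auto
  moreover have "\<bar>pd i bump x\<bar> * \<bar>sing x\<bar> \<le> (8 * \<rho>) * (\<rho> / \<rho> ^ DIM('a))"
    using pd_bump_le[OF i] sing_le by (intro mult_mono) auto
  moreover have "(8 * \<rho>) * (\<rho> / \<rho> ^ DIM('a)) \<le> 8 * r\<^sup>2 / \<rho> ^ DIM('a)"
  proof -
    have "\<rho> * \<rho> \<le> r * r" using r by (intro mult_mono) (auto intro: order_trans[OF norm_ge_zero r])
    then show ?thesis using rho_ge by (simp add: power2_eq_square divide_right_mono)
  qed
  ultimately show ?thesis
    unfolding pd_probe add_divide_distrib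
    using abs_triangle_ineq[of "bump x * pd i sing x" "pd i bump x * sing x"] by (simp add: abs_mult)
qed

text \<open>The bounds 24, 6 and 2 for \<open>flat 4\<close>, \<open>flat 3\<close> and
  \<open>flat 2\<close> give 4 * (24 + 2 * 6) = 144, which with \<open>(r / 2)\<^sup>2\<close>
  becomes \<open>36 * r\<^sup>2\<close>, and 2 * 2 = 4 for the last term.\<close>

lemma lap_bump_le: "r \<ge> 0 \<Longrightarrow> norm (x - x0) \<le> r / 2 \<Longrightarrow> \<bar>lap bump x\<bar> \<le> real DIM('a) * (36 * r\<^sup>2 + 4)"
proof -
  assume r: "r \<ge> 0" "norm (x - x0) \<le> r / 2"
  have "\<bar>frechet_derivative (pd i bump) (at x) i\<bar> \<le> 36 * r\<^sup>2 + 4" if i: "i \<in> Basis" for i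
  proof -
    define s where "s = r\<^sup>2 / 4 - (norm (x - x0))\<^sup>2"
    have b: "flat 4 s \<le> 24" "flat 3 s \<le> 6" "flat 2 s \<le> 2"
      using flat_le_fact[of 4 s] flat_le_fact[of 3 s] flat_le_fact[of 2 s] by (simp_all add: eval_nat_numeral)
    then have "\<bar>4 * (flat 4 s - 2 * flat 3 s)\<bar> \<le> 144"
      using flat_nonneg[of 4 s] flat_nonneg[of 3 s] unfolding abs_le_iff right_diff_distrib by linarith
    moreover have "((x - x0) \<bullet> i)\<^sup>2 \<le> (r / 2)\<^sup>2"
      using Basis_le_norm[OF i, of "x - x0"] r by (intro abs_le_square_iff[THEN iffD1]) auto
    ultimately have "\<bar>4 * (flat 4 s - 2 * flat 3 s)\<bar> * ((x - x0) \<bullet> i)\<^sup>2 \<le> 144 * (r / 2)\<^sup>2"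
      by (intro mult_mono) auto
    moreover have "\<bar>2 * flat 2 s * (i \<bullet> i)\<bar> \<le> 4" using b i by simp
    ultimately have "\<bar>4 * (flat 4 s - 2 * flat 3 s) * ((x - x0) \<bullet> i)\<^sup>2 - 2 * flat 2 s * (i \<bullet> i)\<bar> \<le> 144 * (r / 2)\<^sup>2 + 4"
      by (intro order_trans[OF abs_triangle_ineq4 add_mono]) (simp_all only: abs_mult[of "4 * (flat 4 s - 2 * flat 3 s)"] abs_power2)
    then show ?thesis by (simp add: pd2_bump s_def power_divide)
  qed
  then have "(\<Sum>i\<in>Basis. \<bar>frechet_derivative (pd i bump) (at x) i\<bar>) \<le> (\<Sum>i\<in>(Basis::'a set). 36 * r\<^sup>2 + 4)"
    by (intro sum_mono) auto
  then show ?thesis unfolding lap_def by (intro order_trans[OF sum_abs]) simp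
qed

text \<open>Product rule; the term in which both derivatives fall on the dipole vanishes by
  harmonicity.\<close>

lemma lap_probe: "lap probe x = 2 * (\<Sum>i\<in>Basis. pd i bump x * pd i sing x) + lap bump x * sing x"
proof -
  have "frechet_derivative (pd i probe) (at x) i = bump x * frechet_derivative (pd i sing) (at x) i
     + 2 * (pd i bump x * pd i sing x) + frechet_derivative (pd i bump) (at x) i * sing x" if i: "i \<in> Basis" for i
  proof -
    have *: "pd i probe = (\<lambda>y. bump y * pd i sing y + pd i bump y * sing y)"
      unfolding probe_def[abs_def]
      by (intro ext pd_mult smooth_differentiable smooth_bump smooth_sing)
    note S = smooth_differentiable[OF smooth_bump] smooth_differentiable[OF smooth_sing]
      smooth_differentiable[OF smooth_pd[OF smooth_bump i]] smooth_differentiable[OF smooth_pd[OF smooth_sing i]]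
    show ?thesis
      unfolding *
      by (subst pd_add) (auto intro!: differentiable_mult S simp: pd_mult[OF S(1) S(4)] pd_mult[OF S(3) S(2)])
  qed
  then have "lap probe x = bump x * lap sing x + 2 * (\<Sum>i\<in>Basis. pd i bump x * pd i sing x) + lap bump x * sing x"
    by (simp add: lap_def[of probe] lap_def[of sing] lap_def[of bump] sum.distrib sum_distrib_left sum_distrib_right)
  then show ?thesis by (simp add: lap_sing)
qed

text \<open>The order is that of the dipole itself, although single second derivatives are more
  singular by two powers of \<open>\<rho>\<close>: in the mixed term the gradient of the cut-off
  supplies a factor \<open>\<rho>\<close>.\<close>

lemma lap_probe_le: "r \<ge> 0 \<Longrightarrow> norm (x - x0) \<le> r / 2 \<Longrightarrow>
  \<bar>lap probe x\<bar> \<le> real DIM('a) * (16 * (1 + real DIM('a)) + 36 * r\<^sup>2 + 4) * (\<rho> / \<rho> ^ DIM('a))"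
proof -
  assume r: "r \<ge> 0" "norm (x - x0) \<le> r / 2"
  have "\<bar>pd i bump x * pd i sing x\<bar> \<le> (8 * \<rho>) * ((1 + real DIM('a)) / \<rho> ^ DIM('a))" if "i \<in> Basis" for i
    unfolding abs_mult using pd_bump_le[OF that] pd_sing_le[OF that] by (intro mult_mono) auto
  then have "(\<Sum>i\<in>Basis. \<bar>pd i bump x * pd i sing x\<bar>)
      \<le> (\<Sum>i\<in>(Basis::'a set). (8 * \<rho>) * ((1 + real DIM('a)) / \<rho> ^ DIM('a)))"
    by (intro sum_mono) auto
  then have 1: "\<bar>2 * (\<Sum>i\<in>Basis. pd i bump x * pd i sing x)\<bar>
      \<le> 2 * (real DIM('a) * ((8 * \<rho>) * ((1 + real DIM('a)) / \<rho> ^ DIM('a))))"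
    using sum_abs[of "\<lambda>i. pd i bump x * pd i sing x" Basis] by (simp add: abs_mult)
  have 2: "\<bar>lap bump x * sing x\<bar> \<le> (real DIM('a) * (36 * r\<^sup>2 + 4)) * (\<rho> / \<rho> ^ DIM('a))"
    unfolding abs_mult using lap_bump_le[OF r] sing_le by (intro mult_mono) auto
  have "\<bar>lap probe x\<bar> \<le> 2 * (real DIM('a) * ((8 * \<rho>) * ((1 + real DIM('a)) / \<rho> ^ DIM('a))))
      + (real DIM('a) * (36 * r\<^sup>2 + 4)) * (\<rho> / \<rho> ^ DIM('a))"
    unfolding lap_probe using 1 2 by (rule order_trans[OF abs_triangle_ineq add_mono])
  also have "\<dots> = real DIM('a) * (16 * (1 + real DIM('a)) + 36 * r\<^sup>2 + 4) * (\<rho> / \<rho> ^ DIM('a))"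
    by (simp add: algebra_simps add_divide_distrib)
  finally show ?thesis .
qed

end

text \<open>On the hyperplane \<open>x - x0\<close> is orthogonal to \<open>e\<close>, so the
  cut-off has no normal derivative and the distance to the pole follows from Pythagoras.\<close>

lemma pd_probe_flat:
  assumes x: "hgt x = 0"
  shows "pd e probe x = bump x * (((real DIM('a) - 1) * \<epsilon>\<^sup>2 - (norm (x - x0))\<^sup>2) / norm (x - pole) ^ (DIM('a) + 2))"
    and "(norm (x - pole))\<^sup>2 = (norm (x - x0))\<^sup>2 + \<epsilon>\<^sup>2"
proof -
  let ?\<rho> = "norm (x - pole)"
  have xx: "hgt x \<le> 0" using x by simp
  have eq: "x - pole = (x - x0) - \<epsilon> *\<^sub>R e" by (simp add: pole_def)
  show n: "?\<rho>\<^sup>2 = (norm (x - x0))\<^sup>2 + \<epsilon>\<^sup>2"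
    using x e unfolding eq power2_norm_eq_inner
    by (simp add: inner_diff_left inner_diff_right hgt_def inner_commute power2_eq_square)
  have "pd e bump x = 0" using x by (simp add: pd_bump hgt_def)
  moreover have "pd e sing x = (real DIM('a) * \<epsilon>\<^sup>2 - ?\<rho>\<^sup>2) / ?\<rho> ^ (DIM('a) + 2)"
  proof -
    have "1 / ?\<rho> ^ DIM('a) = ?\<rho>\<^sup>2 / ?\<rho> ^ (DIM('a) + 2)"
      using rho_ge[OF xx] by (simp add: power_add power2_eq_square)
    then show ?thesis
      unfolding pd_sing rsq_powrs[OF xx] pd_rsq_below[OF xx] hgt_pole[OF xx]
      using x e by (simp add: power2_eq_square diff_divide_distrib)
  qed
  ultimately show "pd e probe x = bump x * (((real DIM('a) - 1) * \<epsilon>\<^sup>2 - (norm (x - x0))\<^sup>2) / ?\<rho> ^ (DIM('a) + 2))"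
    unfolding pd_probe[OF xx] n by (simp add: algebra_simps)
qed

text \<open>The numerator is \<open>(N - 1) * \<epsilon>\<^sup>2\<close> minus the squared distance
  from \<open>x0\<close>; for \<open>N \<ge> 2\<close> it keeps its sign up to distance
  \<open>\<epsilon>\<close>, exactly the support of the peak.\<close>

lemma pd_probe_flat_nonneg:
  assumes x: "hgt x = 0" "norm (x - x0) \<le> \<epsilon>" and d: "DIM('a) \<ge> 2"
  shows "pd e probe x \<ge> 0"
proof -
  have "(norm (x - x0))\<^sup>2 \<le> \<epsilon>\<^sup>2" using x(2) by (intro power_mono) auto
  moreover have "1 * \<epsilon>\<^sup>2 \<le> (real DIM('a) - 1) * \<epsilon>\<^sup>2" using d by (intro mult_right_mono) auto
  ultimately show ?thesis
    unfolding pd_probe_flat(1)[OF x(1)] by (intro mult_nonneg_nonneg divide_nonneg_nonneg) (auto simp: bump_def)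
qed

text \<open>On the inner disc the numerator is at least
  \<open>\<epsilon>\<^sup>2 - \<epsilon>\<^sup>2 / 4\<close>, the distance to the pole at most
  \<open>2 * \<epsilon>\<close>, and the argument of the cut-off at least
  \<open>r\<^sup>2 / 8\<close> because \<open>\<epsilon> \<le> r / 2\<close>.\<close>

lemma pd_probe_flat_ge:
  assumes x: "hgt x = 0" "norm (x - x0) \<le> \<epsilon> / 2" and d: "DIM('a) \<ge> 2" and r: "\<epsilon> \<le> r / 2"
  shows "pd e probe x \<ge> flat 0 (r\<^sup>2 / 8) * (3 / 4) / 2 ^ (DIM('a) + 2) / \<epsilon> ^ DIM('a)"
proof -
  let ?\<rho> = "norm (x - pole)"
  have n: "(norm (x - x0))\<^sup>2 \<le> \<epsilon>\<^sup>2 / 4" using power_mono[OF x(2), of 2] by (simp add: power_divide)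
  have er: "\<epsilon>\<^sup>2 \<le> r\<^sup>2 / 4" using power_mono[OF r, of 2] \<epsilon> by (simp add: power_divide)
  have "bump x \<ge> flat 0 (r\<^sup>2 / 8)"
  proof -
    have pos: "r\<^sup>2 / 8 > 0" using r \<epsilon> by simp
    moreover have le: "r\<^sup>2 / 8 \<le> r\<^sup>2 / 4 - (norm (x - x0))\<^sup>2" using n er zero_le_power2[of r] by linarith
    moreover have "flat 0 s \<le> flat 0 t" if "0 < s" "s \<le> t" for s t :: real
      using that by (simp add: flat_def frac_le)
    ultimately show ?thesis unfolding bump_def by blast
  qed
  moreover have "(3 / 4) * \<epsilon>\<^sup>2 / (2 * \<epsilon>) ^ (DIM('a) + 2)
      \<le> ((real DIM('a) - 1) * \<epsilon>\<^sup>2 - (norm (x - x0))\<^sup>2) / ?\<rho> ^ (DIM('a) + 2)"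
  proof (rule frac_le)
    have "1 * \<epsilon>\<^sup>2 \<le> (real DIM('a) - 1) * \<epsilon>\<^sup>2" using d by (intro mult_right_mono) auto
    then show "(3 / 4) * \<epsilon>\<^sup>2 \<le> (real DIM('a) - 1) * \<epsilon>\<^sup>2 - (norm (x - x0))\<^sup>2"
      using n by simp
    then show "0 \<le> (real DIM('a) - 1) * \<epsilon>\<^sup>2 - (norm (x - x0))\<^sup>2" by (rule order_trans[rotated]) simp
    show "0 < ?\<rho> ^ (DIM('a) + 2)" using rho_ge(3) x(1) by simp
    have "?\<rho>\<^sup>2 \<le> (2 * \<epsilon>)\<^sup>2"
    proof -
      have "?\<rho>\<^sup>2 \<le> 4 * \<epsilon>\<^sup>2"
        unfolding pd_probe_flat(2)[OF x(1)] using n zero_le_power2[of \<epsilon>] by linarith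
      then show ?thesis by (simp add: power_mult_distrib)
    qed
    then have "?\<rho> \<le> 2 * \<epsilon>" using \<epsilon> by (auto intro: power2_le_imp_le)
    then show "?\<rho> ^ (DIM('a) + 2) \<le> (2 * \<epsilon>) ^ (DIM('a) + 2)" by (intro power_mono) auto
  qed
  ultimately have A: "flat 0 (r\<^sup>2 / 8) * ((3 / 4) * \<epsilon>\<^sup>2 / (2 * \<epsilon>) ^ (DIM('a) + 2)) \<le> pd e probe x"
    unfolding pd_probe_flat(1)[OF x(1)] using \<epsilon> by (intro mult_mono) (auto simp: bump_def)
  have B: "(3 / 4) * \<epsilon>\<^sup>2 / (2 * \<epsilon>) ^ (DIM('a) + 2) = (3 / 4) / 2 ^ (DIM('a) + 2) / \<epsilon> ^ DIM('a)"
    using \<epsilon> by (simp add: power_mult_distrib power_add power2_eq_square)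
  show ?thesis using A unfolding B by (simp only: times_divide_eq_right)
qed

end

section \<open>Integrals of the singular kernel and areas of flat discs\<close>

text \<open>Dyadic decomposition: on the shell with outer radius \<open>R / 2 ^ k\<close> the kernel
  is bounded by its value at the inner radius, and multiplied by the volume of the ball this gives a
  geometric series with ratio \<open>2 powr (- 1 / 4)\<close>.\<close>

lemma nn_integral_riesz_kernel_finite:
  assumes R: "R > 0"
  shows "(\<integral>\<^sup>+x. indicator (cball 0 R) x * ennreal (norm x powr (1 / 4 - real DIM('a))) \<partial>(lborel :: 'a::euclidean_space measure)) < \<infinity>"
proof -
  let ?N = "real DIM('a)"
  let ?s = "1 / 4 - ?N"
  let ?R = "\<lambda>k::nat. R / 2 ^ k"
  let ?a = "\<lambda>k. ?R (Suc k) powr ?s"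
  have "1 \<le> ?N" using DIM_positive[where 'a = 'a] by linarith
  then have s: "?s < 0" by linarith
  have pw: "indicator (cball 0 R) x * ennreal (norm x powr ?s) \<le> (\<Sum>k. ennreal (?a k) * indicator (cball 0 (?R k)) x)" for x :: 'a
  proof (cases "x \<in> cball 0 R \<and> x \<noteq> 0")
    case True
    then have x: "norm x > 0" "norm x \<le> R" by auto
    define P where "P k = (norm x \<le> ?R k)" for k
    have "\<exists>k. \<not> P k"
    proof -
      obtain k where "R / norm x < 2 ^ k" using real_arch_pow[of 2 "R / norm x"] by auto
      then show ?thesis using x by (intro exI[of _ k]) (simp add: P_def field_simps)
    qed
    moreover have "P 0" using x by (simp add: P_def)
    ultimately obtain k where k: "P k" "\<not> P (Suc k)"
      by (metis nat_induct)
    have "norm x powr ?s \<le> ?a k"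
      using k(2) x s R by (intro powr_mono2') (auto simp: P_def)
    then have "indicator (cball 0 R) x * ennreal (norm x powr ?s) \<le> ennreal (?a k) * indicator (cball 0 (?R k)) x"
      using True k(1) by (simp add: P_def ennreal_leI)
    also have "\<dots> \<le> (\<Sum>k. ennreal (?a k) * indicator (cball 0 (?R k)) x)"
    proof -
      have "F k \<le> suminf F" for F :: "nat \<Rightarrow> ennreal"
        using sum_le_suminf[of F "{k}"] by simp
      then show ?thesis .
    qed
    finally show ?thesis .
  \<comment> \<open>At the origin \<open>0 powr s\<close> is 0, and outside the ball the indicator
    vanishes.\<close>
  qed auto
  have "(\<integral>\<^sup>+x. indicator (cball 0 R) x * ennreal (norm x powr ?s) \<partial>(lborel :: 'a measure))
      \<le> (\<integral>\<^sup>+x. (\<Sum>k. ennreal (?a k) * indicator (cball 0 (?R k)) x) \<partial>(lborel :: 'a measure))"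
    by (intro nn_integral_mono pw)
  also have "\<dots> = (\<Sum>k. \<integral>\<^sup>+x. ennreal (?a k) * indicator (cball 0 (?R k)) x \<partial>(lborel :: 'a measure))"
  proof (rule nn_integral_suminf)
    fix k
    have "cball (0::'a) (?R k) \<in> sets lborel" by simp
    then show "(\<lambda>x::'a. ennreal (?a k) * indicator (cball 0 (?R k)) x) \<in> borel_measurable lborel"
      by (intro borel_measurable_times_ennreal borel_measurable_const borel_measurable_indicator)
  qed
  also have "\<dots> = (\<Sum>k. ennreal (?a k * (unit_ball_vol ?N * ?R k ^ DIM('a))))"
  proof (rule arg_cong[where f = suminf], rule ext)
    fix k
    have "(\<integral>\<^sup>+x. ennreal (?a k) * indicator (cball 0 (?R k)) x \<partial>(lborel :: 'a measure))
        = ennreal (?a k) * emeasure (lborel :: 'a measure) (cball 0 (?R k))"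
      by (rule nn_integral_cmult_indicator) simp
    also have "emeasure (lborel :: 'a measure) (cball 0 (?R k)) = ennreal (unit_ball_vol ?N * ?R k ^ DIM('a))"
      by (rule emeasure_cball) (use R in simp)
    finally show "(\<integral>\<^sup>+x. ennreal (?a k) * indicator (cball 0 (?R k)) x \<partial>(lborel :: 'a measure))
        = ennreal (?a k * (unit_ball_vol ?N * ?R k ^ DIM('a)))"
      using R by (subst ennreal_mult) (simp_all add: mult_nonneg_nonneg)
  qed
  also have "\<dots> < \<infinity>"
  proof -
    have "?a k * (unit_ball_vol ?N * ?R k ^ DIM('a))
        = unit_ball_vol ?N * R powr (1 / 4) * 2 powr (?N - 1 / 4) * (2 powr (- 1 / 4)) ^ k" for k
    proof -
      have e1: "?R k ^ DIM('a) = R powr ?N * 2 powr (- (real k * ?N))"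
      proof -
        have "?R k ^ DIM('a) = (R * 2 powr (- real k)) powr ?N"
          using R by (subst powr_realpow) (auto simp: powr_minus powr_realpow divide_inverse)
        also have "\<dots> = R powr ?N * 2 powr (- (real k * ?N))" using R by (simp add: powr_mult powr_powr)
        finally show ?thesis .
      qed
      have e2: "?a k = R powr ?s * 2 powr (- (real (Suc k) * ?s))"
      proof -
        have "?R (Suc k) = R * 2 powr (- real (Suc k))"
          using R by (simp add: powr_minus powr_realpow divide_inverse del: of_nat_Suc power_Suc)
        then have "?a k = (R * 2 powr (- real (Suc k))) powr ?s" by (simp only:)
        also have "\<dots> = R powr ?s * 2 powr (- (real (Suc k) * ?s))" using R by (simp add: powr_mult powr_powr del: of_nat_Suc)
        finally show ?thesis .
      qed
      have "(2 powr (- 1 / 4)) ^ k = 2 powr (- real k / 4)" by (simp add: powr_powr flip: powr_realpow)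
      moreover have "R powr ?s * R powr ?N = R powr (1 / 4)" by (simp flip: powr_add)
      moreover have "2 powr (- (real (Suc k) * ?s)) * 2 powr (- (real k * ?N)) = 2 powr (?N - 1 / 4) * 2 powr (- real k / 4)"
        unfolding powr_add[symmetric] by (simp add: algebra_simps add_divide_distrib)
      ultimately show ?thesis unfolding e1 e2 by (simp add: ac_simps)
    qed
    moreover have "summable (\<lambda>k. unit_ball_vol ?N * R powr (1 / 4) * 2 powr (?N - 1 / 4) * (2 powr (- 1 / 4 :: real)) ^ k)"
    proof (intro summable_mult summable_geometric)
      have "2 powr (- 1 / 4 :: real) < 2 powr 0" by (intro powr_less_mono) auto
      then show "norm (2 powr (- 1 / 4 :: real)) < 1" by simp
    qed
    ultimately have "summable (\<lambda>k. ?a k * (unit_ball_vol ?N * ?R k ^ DIM('a)))" by (simp only:)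
    then show ?thesis using R by (subst suminf_ennreal2) (auto intro!: mult_nonneg_nonneg)
  qed
  finally show ?thesis .
qed

definition half_ball :: "'a::euclidean_space \<Rightarrow> 'a \<Rightarrow> real \<Rightarrow> 'a set" where
  "half_ball x0 e r = {x. norm (x - x0) \<le> r / 2 \<and> (x - x0) \<bullet> e \<le> 0}"

text \<open>Up to factors, the common majorant of the gradient, the values and the squared Laplacian
  of the probe in \<open>\<Omega>\<close>, so that one integral estimate serves all error
  terms.\<close>

definition kern :: "'a::euclidean_space \<Rightarrow> 'a \<Rightarrow> real \<Rightarrow> real \<Rightarrow> 'a \<Rightarrow> real" where
  "kern x0 e r \<epsilon> x = indicator (half_ball x0 e r) x / norm (x - (x0 + \<epsilon> *\<^sub>R e)) ^ DIM('a)"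

lemma kern_measurable [measurable]: "kern x0 e r \<epsilon> \<in> borel_measurable borel"
proof -
  have [measurable]: "half_ball x0 e r \<in> sets borel" unfolding half_ball_def by measurable
  show ?thesis unfolding kern_def by measurable
qed

lemma kern_nonneg: "kern x0 e r \<epsilon> x \<ge> 0"
  by (simp add: kern_def)

lemma half_ball_rho_le:
  assumes "e \<in> Basis" "x \<in> half_ball x0 e r" "0 \<le> \<epsilon>" "\<epsilon> \<le> r / 2"
  shows "norm (x - (x0 + \<epsilon> *\<^sub>R e)) \<le> r"
proof -
  have "norm ((x - x0) - \<epsilon> *\<^sub>R e) \<le> norm (x - x0) + norm (\<epsilon> *\<^sub>R e)" by (rule norm_triangle_ineq4)
  then show ?thesis using assms by (simp add: half_ball_def diff_diff_eq)
qed

text \<open>The distance to the pole is at least \<open>\<epsilon>\<close> on the half ball, so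
  \<open>\<epsilon> powr (- 1 / 4)\<close> can be split off; the remaining kernel has exponent
  \<open>1 / 4 - N\<close> and, after translation, a finite integral independent of
  \<open>\<epsilon>\<close>.\<close>

lemma kern_integral:
  fixes x0 e :: "'a::euclidean_space"
  assumes e: "e \<in> Basis" and r: "r > 0"
  obtains C where "C > 0"
    "\<And>\<epsilon>. 0 < \<epsilon> \<Longrightarrow> \<epsilon> \<le> r / 2 \<Longrightarrow> integrable lborel (kern x0 e r \<epsilon>)"
    "\<And>\<epsilon>. 0 < \<epsilon> \<Longrightarrow> \<epsilon> \<le> r / 2 \<Longrightarrow> (\<integral>x. kern x0 e r \<epsilon> x \<partial>lborel) \<le> C * \<epsilon> powr (- 1 / 4)"
proof -
  let ?N = "real DIM('a)"
  let ?J = "\<integral>\<^sup>+x. indicator (cball 0 r) x * ennreal (norm x powr (1 / 4 - ?N)) \<partial>(lborel :: 'a measure)"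
  obtain C where C: "?J = ennreal C" "C \<ge> 0"
    using nn_integral_riesz_kernel_finite[OF r, where 'a = 'a] by (cases ?J) auto
  have *: "(\<integral>\<^sup>+x. ennreal (kern x0 e r \<epsilon> x) \<partial>lborel) \<le> ennreal (C * \<epsilon> powr (- 1 / 4))"
    if \<epsilon>: "0 < \<epsilon>" "\<epsilon> \<le> r / 2" for \<epsilon>
  proof -
    let ?y = "x0 + \<epsilon> *\<^sub>R e"
    let ?f = "\<lambda>x::'a. indicator (cball 0 r) x * ennreal (norm x powr (1 / 4 - ?N))"
    have fm: "?f \<in> borel_measurable borel"
    proof -
      have "cball (0::'a) r \<in> sets borel" by simp
      moreover have "(\<lambda>x::'a. norm x powr (1 / 4 - ?N)) \<in> borel_measurable borel"
        by (intro powr_real_measurable) measurable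
      ultimately show ?thesis
        by (intro borel_measurable_times_ennreal borel_measurable_indicator measurable_compose[OF _ measurable_ennreal])
    qed
    have "ennreal (kern x0 e r \<epsilon> x) \<le> ennreal (\<epsilon> powr (- 1 / 4)) * ?f (x - ?y)" for x
    proof (cases "x \<in> half_ball x0 e r")
      case True
      then have \<rho>: "\<epsilon> \<le> norm (x - ?y)" "norm (x - ?y) \<le> r"
        using rho_ge(2)[OF e \<epsilon>(1), of x0 x] half_ball_rho_le[OF e True] \<epsilon>
        by (auto simp: half_ball_def hgt_def[OF e \<epsilon>(1)] pole_def[OF e \<epsilon>(1)])
      then have pos: "norm (x - ?y) > 0" using \<epsilon> by linarith
      have "1 / norm (x - ?y) ^ DIM('a) = norm (x - ?y) powr (- ?N)"
        using pos by (simp add: powr_minus powr_realpow inverse_eq_divide)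
      also have "\<dots> = norm (x - ?y) powr (- 1 / 4) * norm (x - ?y) powr (1 / 4 - ?N)"
        by (simp flip: powr_add)
      also have "\<dots> \<le> \<epsilon> powr (- 1 / 4) * norm (x - ?y) powr (1 / 4 - ?N)"
        using \<rho> \<epsilon> by (intro mult_right_mono powr_mono2') auto
      finally have "ennreal (1 / norm (x - ?y) ^ DIM('a)) \<le> ennreal (\<epsilon> powr (- 1 / 4) * norm (x - ?y) powr (1 / 4 - ?N))"
        by (rule ennreal_leI)
      then show ?thesis using True \<rho> by (simp add: kern_def ennreal_mult)
    qed (simp add: kern_def)
    then have "(\<integral>\<^sup>+x. ennreal (kern x0 e r \<epsilon> x) \<partial>lborel) \<le> (\<integral>\<^sup>+x. ennreal (\<epsilon> powr (- 1 / 4)) * ?f (x - ?y) \<partial>lborel)"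
      by (intro nn_integral_mono)
    also have "\<dots> = ennreal (\<epsilon> powr (- 1 / 4)) * (\<integral>\<^sup>+x. ?f (x - ?y) \<partial>lborel)"
    proof (rule nn_integral_cmult)
      have "(\<lambda>x. x - ?y) \<in> borel_measurable borel" by measurable
      then have "(\<lambda>x. ?f (x - ?y)) \<in> borel_measurable borel" using fm by (rule measurable_compose)
      then show "(\<lambda>x. ?f (x - ?y)) \<in> borel_measurable lborel" by simp
    qed
    also have "(\<integral>\<^sup>+x. ?f (x - ?y) \<partial>lborel) = (\<integral>\<^sup>+x. ?f (x - ?y) \<partial>distr lborel borel ((+) ?y))"
      by (simp only: lborel_distr_plus)
    also have "\<dots> = ?J" by (subst nn_integral_distr) (use fm in \<open>auto simp: algebra_simps\<close>)
    also have "ennreal (\<epsilon> powr (- 1 / 4)) * ?J = ennreal (C * \<epsilon> powr (- 1 / 4))"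
      unfolding C(1) using C(2) by (simp add: ennreal_mult[symmetric] mult.commute)
    finally show ?thesis .
  qed
  show ?thesis
  proof (rule that[of "C + 1"])
    show "C + 1 > 0" using C by simp
    fix \<epsilon> :: real assume \<epsilon>: "0 < \<epsilon>" "\<epsilon> \<le> r / 2"
    show i: "integrable lborel (kern x0 e r \<epsilon>)"
      using le_less_trans[OF *[OF \<epsilon>]] by (intro integrableI_nonneg) (auto simp: kern_nonneg)
    have "ennreal (\<integral>x. kern x0 e r \<epsilon> x \<partial>lborel) \<le> ennreal (C * \<epsilon> powr (- 1 / 4))"
      using *[OF \<epsilon>] nn_integral_eq_integral[OF i] by (simp add: kern_nonneg)
    then have "(\<integral>x. kern x0 e r \<epsilon> x \<partial>lborel) \<le> C * \<epsilon> powr (- 1 / 4)"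
      using C by (subst (asm) ennreal_le_iff) auto
    also have "\<dots> \<le> (C + 1) * \<epsilon> powr (- 1 / 4)" by (intro mult_right_mono) auto
    finally show "(\<integral>x. kern x0 e r \<epsilon> x \<partial>lborel) \<le> (C + 1) * \<epsilon> powr (- 1 / 4)" .
  qed
qed

text \<open>The disc contains a cube of half side \<open>\<delta> / DIM('a)\<close>, since the norm
  is at most the sum of the absolute coordinates; the slab adds a side of length 1.\<close>

lemma slab_disc_measure_ge:
  fixes x0 e :: "'a::euclidean_space"
  assumes e: "e \<in> Basis" and \<delta>: "\<delta> > 0"
  shows "emeasure lborel {x \<in> slab e. norm (slab_proj e (x0 \<bullet> e) x - x0) \<le> \<delta>}
    \<ge> ennreal ((2 * \<delta> / DIM('a)) ^ (DIM('a) - 1))"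
proof -
  let ?d = "\<delta> / DIM('a)"
  define l where "l = (\<Sum>i\<in>Basis. (if i = e then 0 else x0 \<bullet> i - ?d) *\<^sub>R i)"
  define u where "u = (\<Sum>i\<in>Basis. (if i = e then 1 else x0 \<bullet> i + ?d) *\<^sub>R i)"
  have lu: "l \<bullet> i = (if i = e then 0 else x0 \<bullet> i - ?d)" "u \<bullet> i = (if i = e then 1 else x0 \<bullet> i + ?d)" if "i \<in> Basis" for i
    unfolding l_def u_def using that by (simp_all only: inner_sum_left_Basis)
  have d0: "?d > 0" using \<delta> by simp
  have "ennreal ((2 * \<delta> / DIM('a)) ^ (DIM('a) - 1)) = emeasure lborel (box l u)"
  proof -
    have "emeasure lborel (box l u) = ennreal (\<Prod>i\<in>Basis. (u - l) \<bullet> i)"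
      using d0 by (intro emeasure_lborel_box) (auto simp: lu intro: less_imp_le)
    also have "(\<Prod>i\<in>Basis. (u - l) \<bullet> i) = (\<Prod>i\<in>Basis. if i = e then 1 else 2 * ?d)"
      by (intro prod.cong) (auto simp: inner_diff_left lu)
    also have "\<dots> = (\<Prod>i\<in>Basis - {e}. 2 * ?d)"
      using e by (subst prod.remove[of Basis e]) auto
    also have "\<dots> = (2 * \<delta> / DIM('a)) ^ (DIM('a) - 1)" using e by simp
    finally show ?thesis by simp
  qed
  also have "\<dots> \<le> emeasure lborel {x \<in> slab e. norm (slab_proj e (x0 \<bullet> e) x - x0) \<le> \<delta>}"
  proof (rule emeasure_mono)
    show "box l u \<subseteq> {x \<in> slab e. norm (slab_proj e (x0 \<bullet> e) x - x0) \<le> \<delta>}"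
    proof
      fix x assume "x \<in> box l u"
      then have x: "l \<bullet> i < x \<bullet> i" "x \<bullet> i < u \<bullet> i" if "i \<in> Basis" for i using that by (auto simp: mem_box)
      have "norm (slab_proj e (x0 \<bullet> e) x - x0) \<le> (\<Sum>i\<in>Basis. \<bar>(slab_proj e (x0 \<bullet> e) x - x0) \<bullet> i\<bar>)"
        by (rule norm_le_l1)
      also have "\<dots> \<le> (\<Sum>i\<in>(Basis::'a set). ?d)"
      proof (rule sum_mono)
        fix i :: 'a assume i: "i \<in> Basis"
        show "\<bar>(slab_proj e (x0 \<bullet> e) x - x0) \<bullet> i\<bar> \<le> ?d"
        proof (cases "i = e")
          case True
          then show ?thesis using e d0 by (simp add: inner_diff_left slab_proj_inner)
        next
          case False
          then show ?thesis using x[OF i] lu[OF i] i e by (simp add: inner_diff_left slab_proj_inner_other abs_le_iff)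
        qed
      qed
      also have "\<dots> = \<delta>" by simp
      finally show "x \<in> {x \<in> slab e. norm (slab_proj e (x0 \<bullet> e) x - x0) \<le> \<delta>}"
        using x[OF e] lu[OF e] by (simp add: slab_def)
    qed
  qed measurable
  finally show ?thesis .
qed

section \<open>Localised Neumann fluxes\<close>

lemma integrable_bounded_inner:
  fixes f g :: "'a \<Rightarrow> 'b::euclidean_space"
  assumes f: "integrable M f" and g: "g \<in> borel_measurable M" "\<And>x. x \<in> space M \<Longrightarrow> norm (g x) \<le> B"
  shows "integrable M (\<lambda>x. f x \<bullet> g x)"
proof (rule Bochner_Integration.integrable_bound[where f = "\<lambda>x. B * norm (f x)"])
  show "integrable M (\<lambda>x. B * norm (f x))" using f by simp
  note [measurable] = g(1) borel_measurable_integrable[OF f]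
  show "(\<lambda>x. f x \<bullet> g x) \<in> borel_measurable M" by measurable
  show "AE x in M. norm (f x \<bullet> g x) \<le> norm (B * norm (f x))"
  proof (rule AE_I2)
    fix x assume "x \<in> space M"
    then have "norm (f x) * norm (g x) \<le> norm (f x) * B" using g(2) by (intro mult_left_mono) auto
    then show "norm (f x \<bullet> g x) \<le> norm (B * norm (f x))"
      using Cauchy_Schwarz_ineq2[of "f x" "g x"] by (simp add: mult.commute)
  qed
qed

section \<open>The Neumann flux tested with the dipole\<close>

context
  fixes \<Omega> :: "'a::euclidean_space set" and x0 e :: 'a and r \<epsilon> :: real
  assumes d: "DIM('a) \<ge> 2" and \<Omega>: "open \<Omega>" "bounded \<Omega>" and e: "e \<in> Basis" and r: "r > 0"
    and half: "\<Omega> \<inter> ball x0 r = {y \<in> ball x0 r. y \<bullet> e < x0 \<bullet> e}"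
    and \<epsilon>: "0 < \<epsilon>" "\<epsilon> \<le> r / 2"
begin

private abbreviation (input) "\<phi> \<equiv> probe x0 e r \<epsilon>"
private abbreviation (input) "\<kappa> \<equiv> kern x0 e r \<epsilon>"
private abbreviation (input) "rad x \<equiv> norm (x - (x0 + \<epsilon> *\<^sub>R e))"

lemma probe_smooth: "smooth \<phi>" by (rule smooth_probe[OF e \<epsilon>(1)])

lemma probe_support: "x \<notin> cball x0 (r / 2) \<Longrightarrow> \<phi> x = 0"
  using probe_outside[OF e \<epsilon>(1)] r by auto

text \<open>For the Laplacian, the square of \<open>\<rho> / \<rho> ^ N\<close> is
  \<open>1 / \<rho> ^ (N - 2)\<close> times the kernel, and \<open>\<rho> \<ge> \<epsilon>\<close>
  bounds the first factor. Outside the cut-off all left-hand sides are zero.\<close>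

lemma
  assumes x: "x \<in> \<Omega>"
  shows grad_probe_kern: "norm (grad \<phi> x) \<le> real DIM('a) * (1 + real DIM('a) + 8 * r\<^sup>2) * \<kappa> x"
    and probe_kern: "\<bar>\<phi> x\<bar> \<le> r * \<kappa> x"
    and lap_probe_kern: "(lap \<phi> x)\<^sup>2 \<le> (real DIM('a) * (16 * (1 + real DIM('a)) + 36 * r\<^sup>2 + 4))\<^sup>2 / \<epsilon> ^ (DIM('a) - 2) * \<kappa> x"
proof -
  have "norm (grad \<phi> x) \<le> real DIM('a) * (1 + real DIM('a) + 8 * r\<^sup>2) * \<kappa> x \<and> \<bar>\<phi> x\<bar> \<le> r * \<kappa> x
    \<and> (lap \<phi> x)\<^sup>2 \<le> (real DIM('a) * (16 * (1 + real DIM('a)) + 36 * r\<^sup>2 + 4))\<^sup>2 / \<epsilon> ^ (DIM('a) - 2) * \<kappa> x"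
  proof (cases "x \<in> cball x0 (r / 2)")
    case False
    have z: "pd i \<phi> y = 0" if "y \<notin> cball x0 (r / 2)" for i y
      using probe_support that by (intro pd_vanishes[of "cball x0 (r / 2)" \<phi>]) auto
    then have "frechet_derivative (pd i \<phi>) (at x) i = 0" for i
      using False by (intro pd_vanishes[of "cball x0 (r / 2)" "pd i \<phi>"]) auto
    then have "lap \<phi> x = 0" "grad \<phi> x = 0" "\<phi> x = 0"
      using z False probe_support by (auto simp: lap_def grad_def)
    then show ?thesis using kern_nonneg[of x0 e r \<epsilon> x] r \<epsilon> by simp
  next
    case True
    then have xb: "x \<in> ball x0 r" using r by auto
    then have "x \<bullet> e < x0 \<bullet> e" using half x by blast
    then have h: "(x - x0) \<bullet> e \<le> 0" by (simp add: inner_diff_left)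
    have n: "norm (x - x0) \<le> r / 2" using True by (simp add: dist_norm norm_minus_commute)
    have hb: "x \<in> half_ball x0 e r" using h n by (simp add: half_ball_def)
    have hg: "hgt x0 e x \<le> 0" using h by (simp add: hgt_def[OF e \<epsilon>(1)])
    have po: "pole x0 e \<epsilon> = x0 + \<epsilon> *\<^sub>R e" by (simp add: pole_def[OF e \<epsilon>(1)])
    note B = rho_ge[OF e \<epsilon>(1) hg, unfolded po]
    have rad_r: "rad x \<le> r" using half_ball_rho_le[OF e hb] \<epsilon> by simp
    have \<kappa>: "\<kappa> x = 1 / rad x ^ DIM('a)" using hb by (simp add: kern_def)
    have "norm (grad \<phi> x) \<le> (\<Sum>i\<in>Basis. \<bar>grad \<phi> x \<bullet> i\<bar>)" by (rule norm_le_l1)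
    also have "\<dots> \<le> (\<Sum>i\<in>(Basis::'a set). (1 + real DIM('a) + 8 * r\<^sup>2) / rad x ^ DIM('a))"
    proof (rule sum_mono)
      fix i :: 'a assume i: "i \<in> Basis"
      show "\<bar>grad \<phi> x \<bullet> i\<bar> \<le> (1 + real DIM('a) + 8 * r\<^sup>2) / rad x ^ DIM('a)"
        using pd_probe_le[OF e \<epsilon>(1) hg i, unfolded po, OF rad_r] by (simp add: grad_inner_Basis[OF i])
    qed
    also have "\<dots> = real DIM('a) * (1 + real DIM('a) + 8 * r\<^sup>2) * \<kappa> x" by (simp add: \<kappa>)
    finally have 1: "norm (grad \<phi> x) \<le> real DIM('a) * (1 + real DIM('a) + 8 * r\<^sup>2) * \<kappa> x" .
    have "\<bar>\<phi> x\<bar> \<le> rad x / rad x ^ DIM('a)" using probe_le[OF e \<epsilon>(1) hg, unfolded po] .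
    also have "\<dots> \<le> r * \<kappa> x" unfolding \<kappa> using rad_r B(3) by (simp add: divide_right_mono)
    finally have 2: "\<bar>\<phi> x\<bar> \<le> r * \<kappa> x" .
    let ?C = "real DIM('a) * (16 * (1 + real DIM('a)) + 36 * r\<^sup>2 + 4)"
    have "\<bar>lap \<phi> x\<bar> \<le> ?C * (rad x / rad x ^ DIM('a))"
      using lap_probe_le[OF e \<epsilon>(1) hg _ n, unfolded po] r by simp
    then have "(lap \<phi> x)\<^sup>2 \<le> (?C * (rad x / rad x ^ DIM('a)))\<^sup>2"
      by (metis abs_ge_zero power2_abs power_mono)
    also have "\<dots> = ?C\<^sup>2 * (rad x / rad x ^ DIM('a))\<^sup>2" by (rule power_mult_distrib)
    also have "(rad x / rad x ^ DIM('a))\<^sup>2 = 1 / rad x ^ (DIM('a) - 2) * \<kappa> x"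
    proof -
      have "rad x ^ DIM('a) = rad x ^ (DIM('a) - 2) * (rad x)\<^sup>2" using power_add[of "rad x" "DIM('a) - 2" 2] d by (simp only: le_add_diff_inverse2)
      then show ?thesis unfolding \<kappa> using B(3) by (simp add: power_divide power2_eq_square)
    qed
    also have "?C\<^sup>2 * (1 / rad x ^ (DIM('a) - 2) * \<kappa> x) \<le> ?C\<^sup>2 * (1 / \<epsilon> ^ (DIM('a) - 2) * \<kappa> x)"
      using B \<epsilon> kern_nonneg[of x0 e r \<epsilon> x]
      by (intro mult_left_mono mult_right_mono divide_left_mono power_mono) auto
    finally have 3: "(lap \<phi> x)\<^sup>2 \<le> ?C\<^sup>2 / \<epsilon> ^ (DIM('a) - 2) * \<kappa> x" by simp
    show ?thesis using 1 2 3 by simp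
  qed
  then show "norm (grad \<phi> x) \<le> real DIM('a) * (1 + real DIM('a) + 8 * r\<^sup>2) * \<kappa> x"
    and "\<bar>\<phi> x\<bar> \<le> r * \<kappa> x"
    and "(lap \<phi> x)\<^sup>2 \<le> (real DIM('a) * (16 * (1 + real DIM('a)) + 36 * r\<^sup>2 + 4))\<^sup>2 / \<epsilon> ^ (DIM('a) - 2) * \<kappa> x"
    by auto
qed

text \<open>By \<open>trace_identity\<close> the leading part of the flux is the boundary integral
  minus the integral of \<open>A (u) * lap \<phi>\<close>. That integral is split by Young's
  inequality with a free weight \<open>t\<close>, to be balanced later; the terms with
  \<open>B\<close> and \<open>c\<close> are bounded directly by the kernel.\<close>

lemma flux_close:
  fixes A a :: "real \<Rightarrow> real" and B :: "'a \<Rightarrow> 'a" and c :: "'a \<Rightarrow> real"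
  assumes A: "\<And>s. (A has_real_derivative a s) (at s)" "A g1 = 0" and a: "continuous_on UNIV a" "\<And>s. \<bar>a s\<bar> \<le> M"
    and tr: "has_trace \<Omega> u g" and g: "continuous_on UNIV g"
    and B: "B \<in> borel_measurable (lebesgue_on \<Omega>)" "\<And>x. x \<in> \<Omega> \<Longrightarrow> norm (B x) \<le> \<beta>" "\<beta> \<ge> 0"
    and c: "c \<in> borel_measurable (lebesgue_on \<Omega>)" "\<And>x. x \<in> \<Omega> \<Longrightarrow> \<bar>c x\<bar> \<le> \<gamma>" "\<gamma> \<ge> 0"
    and U: "(\<integral>x. (u x)\<^sup>2 \<partial>lebesgue_on \<Omega>) \<le> U" and t: "t > 0"
    and \<kappa>: "integrable lborel \<kappa>" "(\<integral>x. \<kappa> x \<partial>lborel) \<le> J"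
  shows "\<bar>(\<integral>x. a (u x) * (wgrad \<Omega> u x \<bullet> wgrad \<Omega> \<phi> x) + B x \<bullet> wgrad \<Omega> \<phi> x + c x * \<phi> x \<partial>lebesgue_on \<Omega>)
      - (\<integral>x. indicator (slab e) x * (A (g (slab_proj e (x0 \<bullet> e) x)) * pd e \<phi> (slab_proj e (x0 \<bullet> e) x)) \<partial>lborel)\<bar>
    \<le> t / 2 * (2 * M\<^sup>2 * (U + g1\<^sup>2 * measure lebesgue \<Omega>))
      + ((real DIM('a) * (16 * (1 + real DIM('a)) + 36 * r\<^sup>2 + 4))\<^sup>2 / \<epsilon> ^ (DIM('a) - 2) / (2 * t)
        + \<beta> * (real DIM('a) * (1 + real DIM('a) + 8 * r\<^sup>2)) + \<gamma> * r) * J"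
proof -
  let ?L = "lebesgue_on \<Omega>" and ?w = "wgrad \<Omega> u"
  let ?C1 = "real DIM('a) * (1 + real DIM('a) + 8 * r\<^sup>2)"
  let ?C2 = "(real DIM('a) * (16 * (1 + real DIM('a)) + 36 * r\<^sup>2 + 4))\<^sup>2 / \<epsilon> ^ (DIM('a) - 2)"
  let ?Q = "slab_proj e (x0 \<bullet> e)"
  let ?S = "\<integral>x. indicator (slab e) x * (A (g (?Q x)) * pd e \<phi> (?Q x)) \<partial>lborel"
  have \<phi>: "smooth \<phi>" by (rule probe_smooth)
  have K: "compact (cball x0 (r / 2))" "cball x0 (r / 2) \<subseteq> ball x0 r" using r by auto
  have S: "(\<integral>x. a (u x) * (?w x \<bullet> grad \<phi> x) + A (u x) * lap \<phi> x \<partial>?L) = ?S"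
    by (rule trace_identity[OF d \<Omega> e half \<phi> K probe_support A(1) a tr g])
  have uH: "u \<in> H1 \<Omega>" using tr by (simp add: has_trace_def)
  then have usq: "square_integrable ?L u" by (simp add: H1_def)
  have ui: "integrable ?L u" using \<Omega> usq by (rule integrable_square_integrable)
  have u2: "integrable ?L (\<lambda>x. (u x)\<^sup>2)" using usq by (simp add: square_integrable_def)
  have wi: "integrable ?L ?w" using \<Omega> square_integrable_wgrad[OF \<Omega>(1) uH] by (rule integrable_square_integrable)
  have Ac: "continuous_on UNIV A"
    using A(1) DERIV_isCont by (blast intro: continuous_at_imp_continuous_on)
  have M0: "M \<ge> 0" using a(2)[of 0] by linarith
  note [measurable] = borel_measurable_integrable[OF ui] borel_measurable_integrable[OF wi] B(1) c(1)
    borel_measurable_continuous_onI[OF a(1)] borel_measurable_continuous_onI[OF Ac]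
  have gm [measurable]: "grad \<phi> \<in> borel_measurable ?L" "lap \<phi> \<in> borel_measurable ?L" "\<phi> \<in> borel_measurable ?L"
    by (intro borel_measurable_continuous_lebesgue_on continuous_on_grad continuous_on_lap smooth_continuous_on \<phi>)+
  \<comment> \<open>As \<open>A g1 = 0\<close>, the Lipschitz bound controls \<open>A\<close> by the
    distance from \<open>g1\<close>, and the factor 2 comes from the square of a difference.\<close>
  have Alip: "(A s)\<^sup>2 \<le> 2 * M\<^sup>2 * (s\<^sup>2 + g1\<^sup>2)" for s
  proof -
    have "\<bar>A s - A g1\<bar> \<le> M * \<bar>s - g1\<bar>"
      by (rule A_lipschitz[OF d \<Omega> e half \<phi> K probe_support A(1) a])
    then have "\<bar>A s\<bar>\<^sup>2 \<le> (M * \<bar>s - g1\<bar>)\<^sup>2" using A(2) by (intro power_mono) auto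
    also have "\<dots> = M\<^sup>2 * (s - g1)\<^sup>2" by (simp add: power_mult_distrib)
    also have "\<dots> \<le> M\<^sup>2 * (2 * (s\<^sup>2 + g1\<^sup>2))"
    proof (rule mult_left_mono)
      have "0 \<le> (s + g1)\<^sup>2" by simp
      then show "(s - g1)\<^sup>2 \<le> 2 * (s\<^sup>2 + g1\<^sup>2)" by (simp add: power2_diff power2_sum)
    qed simp
    finally show ?thesis by (simp only: mult.left_commute[of "M\<^sup>2" 2] mult.assoc power2_abs)
  qed
  have one: "integrable ?L (\<lambda>x. 1 :: real)"
    using \<Omega> by (intro integrable_lebesgue_on_bounded[where B = 1]) auto
  have ib: "integrable ?L (\<lambda>x. 2 * M\<^sup>2 * ((u x)\<^sup>2 + g1\<^sup>2))"
    using u2 integrable_mult_right[OF one, of "g1\<^sup>2"] by simp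
  have Asq: "integrable ?L (\<lambda>x. (A (u x))\<^sup>2)"
    by (rule Bochner_Integration.integrable_bound[OF ib])
      (measurable, use Alip order_trans[OF Alip abs_ge_self] in \<open>auto intro!: AE_I2\<close>)
  have Aint: "(\<integral>x. (A (u x))\<^sup>2 \<partial>?L) \<le> 2 * M\<^sup>2 * (U + g1\<^sup>2 * measure lebesgue \<Omega>)"
  proof -
    have "(\<integral>x. (A (u x))\<^sup>2 \<partial>?L) \<le> (\<integral>x. 2 * M\<^sup>2 * ((u x)\<^sup>2 + g1\<^sup>2) \<partial>?L)"
      using Asq ib Alip by (intro integral_mono) auto
    also have "\<dots> = 2 * M\<^sup>2 * ((\<integral>x. (u x)\<^sup>2 \<partial>?L) + g1\<^sup>2 * measure lebesgue \<Omega>)"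
    proof -
      have "measure ?L \<Omega> = measure lebesgue \<Omega>" using \<Omega> by (simp add: measure_restrict_space)
      then show ?thesis using u2 integrable_mult_right[OF one, of "g1\<^sup>2"] by simp
    qed
    also have "\<dots> \<le> 2 * M\<^sup>2 * (U + g1\<^sup>2 * measure lebesgue \<Omega>)"
      using U by (intro mult_left_mono) auto
    finally show ?thesis .
  qed
  have \<kappa>L: "integrable ?L \<kappa>"
  proof -
    have "integrable lebesgue \<kappa>" using \<kappa>(1) by (simp add: integrable_completion)
    from integrable_mult_indicator[OF _ this, of \<Omega>] show ?thesis
      using \<Omega> by (simp add: integrable_lebesgue_on_iff)
  qed
  have \<kappa>J: "(\<integral>x. \<kappa> x \<partial>?L) \<le> J"
  proof -
    have i: "integrable lebesgue \<kappa>" using \<kappa>(1) by (simp add: integrable_completion)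
    have "(\<integral>x. \<kappa> x \<partial>?L) = (\<integral>x. indicator \<Omega> x * \<kappa> x \<partial>lebesgue)" using \<Omega> by (simp add: integral_lebesgue_on)
    also have "\<dots> \<le> (\<integral>x. \<kappa> x \<partial>lebesgue)"
      using integrable_mult_indicator[OF _ i, of \<Omega>] \<Omega> i kern_nonneg[of x0 e r \<epsilon>]
      by (intro integral_mono) (auto simp: indicator_def)
    also have "\<dots> = (\<integral>x. \<kappa> x \<partial>lborel)" by (rule integral_completion) simp
    finally show ?thesis using \<kappa>(2) by simp
  qed
  obtain b1 where b1: "\<And>x. x \<in> \<Omega> \<Longrightarrow> norm (grad \<phi> x) \<le> b1"
    using compact_imp_bounded[OF compact_continuous_image[OF continuous_on_grad[OF \<phi>], of "closure \<Omega>"]] \<Omega>(2)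
      closure_subset[of \<Omega>] by (auto simp: bounded_iff)
  \<comment> \<open>\<open>?X\<close> is the integrand of \<open>trace_identity\<close>;
    \<open>?Y\<close> contains the lower-order terms and takes the Laplacian term away again;
    \<open>?F\<close> is its majorant.\<close>
  let ?X = "\<lambda>x. a (u x) * (?w x \<bullet> grad \<phi> x) + A (u x) * lap \<phi> x"
  let ?Y = "\<lambda>x. B x \<bullet> grad \<phi> x + c x * \<phi> x - A (u x) * lap \<phi> x"
  let ?F = "\<lambda>x. t / 2 * (A (u x))\<^sup>2 + (?C2 / (2 * t) + \<beta> * ?C1 + \<gamma> * r) * \<kappa> x"
  have Fi: "integrable ?L ?F" using Asq \<kappa>L by simp
  have young: "\<bar>A s * l\<bar> \<le> t / 2 * (A s)\<^sup>2 + l\<^sup>2 / (2 * t)" for s l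
  proof -
    have "0 \<le> (t * \<bar>A s\<bar> - \<bar>l\<bar>)\<^sup>2" by simp
    then have "2 * t * (\<bar>A s\<bar> * \<bar>l\<bar>) \<le> t\<^sup>2 * (A s)\<^sup>2 + l\<^sup>2" by (simp add: power2_diff power_mult_distrib)
    then have "\<bar>A s\<bar> * \<bar>l\<bar> \<le> (t\<^sup>2 * (A s)\<^sup>2 + l\<^sup>2) / (2 * t)" using t by (simp add: field_simps)
    also have "\<dots> = t / 2 * (A s)\<^sup>2 + l\<^sup>2 / (2 * t)" using t by (simp add: add_divide_distrib power2_eq_square)
    finally show ?thesis by (simp add: abs_mult)
  qed
  have lapF: "\<bar>A (u x) * lap \<phi> x\<bar> \<le> t / 2 * (A (u x))\<^sup>2 + ?C2 / (2 * t) * \<kappa> x" if "x \<in> \<Omega>" for x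
  proof -
    have "(lap \<phi> x)\<^sup>2 / (2 * t) \<le> (?C2 * \<kappa> x) / (2 * t)"
      using lap_probe_kern[OF that] t by (intro divide_right_mono) auto
    then show ?thesis using young[of "u x" "lap \<phi> x"] by simp
  qed
  have YF: "norm (?Y x) \<le> ?F x" if x: "x \<in> \<Omega>" for x
  proof -
    have "\<bar>B x \<bullet> grad \<phi> x\<bar> \<le> norm (B x) * norm (grad \<phi> x)" by (rule Cauchy_Schwarz_ineq2)
    also have "\<dots> \<le> \<beta> * (?C1 * \<kappa> x)"
      using B(2)[OF x] B(3) grad_probe_kern[OF x] by (intro mult_mono) auto
    finally have "\<bar>B x \<bullet> grad \<phi> x\<bar> \<le> \<beta> * ?C1 * \<kappa> x" by (simp add: mult.assoc)
    moreover have "\<bar>c x * \<phi> x\<bar> \<le> \<gamma> * (r * \<kappa> x)"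
      unfolding abs_mult using c(2)[OF x] c(3) probe_kern[OF x] by (intro mult_mono) auto
    moreover have "(?C2 / (2 * t) + \<beta> * ?C1 + \<gamma> * r) * \<kappa> x = ?C2 / (2 * t) * \<kappa> x + \<beta> * ?C1 * \<kappa> x + \<gamma> * (r * \<kappa> x)"
      by (simp only: distrib_right mult.assoc)
    ultimately show ?thesis using lapF[OF x] unfolding real_norm_def by linarith
  qed
  have Alap: "integrable ?L (\<lambda>x. A (u x) * lap \<phi> x)"
  proof (rule Bochner_Integration.integrable_bound)
    show "integrable ?L (\<lambda>x. t / 2 * (A (u x))\<^sup>2 + ?C2 / (2 * t) * \<kappa> x)" using Asq \<kappa>L by simp
    show "AE x in ?L. norm (A (u x) * lap \<phi> x) \<le> norm (t / 2 * (A (u x))\<^sup>2 + ?C2 / (2 * t) * \<kappa> x)"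
      using lapF by (intro AE_I2) (auto intro: order_trans[OF _ abs_ge_self])
  qed measurable
  have Xi: "integrable ?L ?X"
  proof (rule Bochner_Integration.integrable_add[OF _ Alap])
    have "integrable ?L (\<lambda>x. ?w x \<bullet> (a (u x) *\<^sub>R grad \<phi> x))"
    proof (rule integrable_bounded_inner[OF wi])
      fix x assume "x \<in> space ?L"
      then show "norm (a (u x) *\<^sub>R grad \<phi> x) \<le> M * b1"
        using b1 a(2) M0 by (auto intro!: mult_mono)
    qed measurable
    then show "integrable ?L (\<lambda>x. a (u x) * (?w x \<bullet> grad \<phi> x))" by simp
  qed
  have Yi: "integrable ?L ?Y"
    by (rule Bochner_Integration.integrable_bound[OF Fi])
      (measurable, use YF in \<open>auto intro!: AE_I2 order_trans[OF _ abs_ge_self]\<close>)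
  have "(\<integral>x. a (u x) * (?w x \<bullet> wgrad \<Omega> \<phi> x) + B x \<bullet> wgrad \<Omega> \<phi> x + c x * \<phi> x \<partial>?L) = (\<integral>x. ?X x + ?Y x \<partial>?L)"
  proof (rule integral_cong_AE)
    have "integrable ?L (wgrad \<Omega> \<phi>)"
      using \<Omega> square_integrable_wgrad[OF \<Omega>(1) smooth_in_H1[OF \<Omega> \<phi>]] by (rule integrable_square_integrable)
    note [measurable] = borel_measurable_integrable[OF this]
    show "(\<lambda>x. a (u x) * (?w x \<bullet> wgrad \<Omega> \<phi> x) + B x \<bullet> wgrad \<Omega> \<phi> x + c x * \<phi> x) \<in> borel_measurable ?L"
      by measurable
    show "AE x in ?L. a (u x) * (?w x \<bullet> wgrad \<Omega> \<phi> x) + B x \<bullet> wgrad \<Omega> \<phi> x + c x * \<phi> x = ?X x + ?Y x"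
      using wgrad_smooth_AE[OF \<Omega>(1) \<phi>] by eventually_elim simp
  qed measurable
  also have "\<dots> = ?S + (\<integral>x. ?Y x \<partial>?L)"
    using Bochner_Integration.integral_add[OF Xi Yi] S by (simp only:)
  finally have "\<bar>(\<integral>x. a (u x) * (?w x \<bullet> wgrad \<Omega> \<phi> x) + B x \<bullet> wgrad \<Omega> \<phi> x + c x * \<phi> x \<partial>?L) - ?S\<bar> = norm (\<integral>x. ?Y x \<partial>?L)"
    by simp
  also have "\<dots> \<le> (\<integral>x. ?F x \<partial>?L)"
    using YF by (intro Bochner_Integration.integral_norm_bound_integral[OF Yi Fi]) auto
  also have "\<dots> = t / 2 * (\<integral>x. (A (u x))\<^sup>2 \<partial>?L) + (?C2 / (2 * t) + \<beta> * ?C1 + \<gamma> * r) * (\<integral>x. \<kappa> x \<partial>?L)"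
    using Asq \<kappa>L by simp
  also have "\<dots> \<le> t / 2 * (2 * M\<^sup>2 * (U + g1\<^sup>2 * measure lebesgue \<Omega>)) + (?C2 / (2 * t) + \<beta> * ?C1 + \<gamma> * r) * J"
    using t Aint \<kappa>J B(3) c(3) r \<epsilon> by (intro add_mono mult_left_mono) (auto intro!: add_nonneg_nonneg mult_nonneg_nonneg)
  finally show ?thesis .
qed

text \<open>The integrand is nonnegative everywhere, by the sign of the normal derivative on the
  support of \<open>k\<close>, so the integral over the inner disc, where both factors are bounded
  below, is a lower bound.\<close>

lemma slab_main_term_ge:
  assumes k: "continuous_on UNIV k"
    and k0: "\<And>x. \<epsilon> \<le> norm (x - x0) \<Longrightarrow> k x = 0" "\<And>x. 0 \<le> k x" "\<And>x. norm (x - x0) \<le> \<epsilon> / 2 \<Longrightarrow> m \<le> k x" and m: "m \<ge> 0"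
  shows "(\<integral>x. indicator (slab e) x * (k (slab_proj e (x0 \<bullet> e) x) * pd e \<phi> (slab_proj e (x0 \<bullet> e) x)) \<partial>lborel)
    \<ge> m * (flat 0 (r\<^sup>2 / 8) * (3 / 4) / 2 ^ (DIM('a) + 2) / \<epsilon> ^ DIM('a)) * (\<epsilon> / DIM('a)) ^ (DIM('a) - 1)"
proof -
  let ?Q = "slab_proj e (x0 \<bullet> e)"
  let ?T = "{x \<in> slab e. norm (?Q x - x0) \<le> \<epsilon> / 2}"
  let ?m = "m * (flat 0 (r\<^sup>2 / 8) * (3 / 4) / 2 ^ (DIM('a) + 2) / \<epsilon> ^ DIM('a))"
  have T: "?T \<in> sets borel" by measurable
  have Tc: "?T = {x \<in> slab e. ?Q x \<in> cball x0 (\<epsilon> / 2)}" by (auto simp: dist_norm norm_minus_commute)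
  obtain R where "?T \<subseteq> cball 0 R" unfolding Tc using slab_preimage_bounded[OF e bounded_cball] by blast
  then have fin: "emeasure lborel ?T < \<infinity>"
    using emeasure_mono[of ?T "cball 0 R" lborel] emeasure_lborel_cball_finite[of "0::'a" R]
    by (auto intro: le_less_trans)
  have meas: "(\<epsilon> / DIM('a)) ^ (DIM('a) - 1) \<le> measure lborel ?T"
  proof -
    have "ennreal ((2 * (\<epsilon> / 2) / DIM('a)) ^ (DIM('a) - 1)) \<le> emeasure lborel ?T"
      using slab_disc_measure_ge[OF e, of "\<epsilon> / 2" x0] \<epsilon> by simp
    also have "\<dots> = ennreal (measure lborel ?T)" using fin by (intro emeasure_eq_ennreal_measure) auto
    finally show ?thesis by (subst (asm) ennreal_le_iff) auto
  qed
  have hgt: "hgt x0 e (?Q x) = 0" for x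
    using e by (simp add: hgt_def[OF e \<epsilon>(1)] inner_diff_left slab_proj_inner)
  have m0: "?m \<ge> 0" using m \<epsilon> by (intro mult_nonneg_nonneg divide_nonneg_nonneg) auto
  have "?m * (\<epsilon> / DIM('a)) ^ (DIM('a) - 1) \<le> ?m * measure lborel ?T"
    using meas m0 by (rule mult_left_mono)
  also have "\<dots> = (\<integral>x. ?m * indicator ?T x \<partial>lborel)" using T by simp
  also have "\<dots> \<le> (\<integral>x. indicator (slab e) x * (k (?Q x) * pd e \<phi> (?Q x)) \<partial>lborel)"
  proof (rule integral_mono)
    show "integrable lborel (\<lambda>x. ?m * indicator ?T x)"
      using T fin by (intro integrable_mult_right integrable_real_indicator) auto
    show "integrable lborel (\<lambda>x. indicator (slab e) x * (k (?Q x) * pd e \<phi> (?Q x)))"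
    proof (rule slab_integrable[OF e, of "\<lambda>x. k x * pd e \<phi> x" "cball x0 \<epsilon>"])
      show "continuous_on UNIV (\<lambda>x. k x * pd e \<phi> x)"
        using k smooth_continuous_on[OF smooth_pd[OF probe_smooth e]] by (rule continuous_on_mult)
      show "k x * pd e \<phi> x = 0" if "x \<notin> cball x0 \<epsilon>" for x
        using k0(1)[of x] that by (simp add: dist_norm norm_minus_commute)
    qed simp
    fix x
    show "?m * indicator ?T x \<le> indicator (slab e) x * (k (?Q x) * pd e \<phi> (?Q x))"
    proof (cases "x \<in> ?T")
      case True
      then have n: "norm (?Q x - x0) \<le> \<epsilon> / 2" by simp
      have "?m \<le> k (?Q x) * pd e \<phi> (?Q x)"
        using k0(3)[OF n] k0(2) pd_probe_flat_ge[OF e \<epsilon>(1) hgt n d \<epsilon>(2)] \<epsilon>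
        by (intro mult_mono) (auto intro!: divide_nonneg_nonneg mult_nonneg_nonneg)
      then show ?thesis using True by simp
    next
      case False
      have "0 \<le> k (?Q x) * pd e \<phi> (?Q x)"
      proof (cases "norm (?Q x - x0) \<le> \<epsilon>")
        case True
        then show ?thesis using k0(2) pd_probe_flat_nonneg[OF e \<epsilon>(1) hgt True d] by simp
      next
        case False
        then show ?thesis using k0(1) by simp
      qed
      then show ?thesis using False by simp
    qed
  qed
  finally show ?thesis .
qed

end

section \<open>The boundary value problem\<close>

text \<open>By continuity the set where the bound fails is open, and a nonempty open set is not
  negligible.\<close>

lemma W1inf_bounded_le:
  fixes f :: "'a::euclidean_space \<Rightarrow> real"
  assumes D: "open D" and f: "W1inf_bounded D C f" and x: "x \<in> D"
  shows "\<bar>f x\<bar> \<le> C"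
proof (rule ccontr)
  assume "\<not> \<bar>f x\<bar> \<le> C"
  define S where "S = D \<inter> (\<lambda>x. \<bar>f x\<bar>) -` {C<..}"
  have c: "continuous_on D (\<lambda>x. \<bar>f x\<bar>)"
    using f by (intro continuous_intros) (simp add: W1inf_bounded_def)
  have "open S" unfolding S_def using c D by (intro continuous_open_preimage) auto
  moreover have "S \<noteq> {}" using x \<open>\<not> \<bar>f x\<bar> \<le> C\<close> by (auto simp: S_def)
  ultimately have "\<not> negligible S" by (rule open_not_negligible)
  moreover have "negligible S"
  proof -
    have "AE x in lebesgue_on D. \<bar>f x\<bar> \<le> C" using f by (simp add: W1inf_bounded_def)
    then have "AE x in lebesgue. x \<in> D \<longrightarrow> \<bar>f x\<bar> \<le> C"
      using D by (subst (asm) AE_restrict_space_iff) auto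
    then have "AE x in lebesgue. x \<notin> S" by eventually_elim (auto simp: S_def)
    then show ?thesis using \<open>open S\<close> by (simp add: negligible_iff_null_sets AE_iff_null_sets)
  qed
  ultimately show False by simp
qed

lemma borel_measurable_superposition:
  fixes F :: "'a::euclidean_space \<times> 'b::euclidean_space \<Rightarrow> 'c::euclidean_space"
  assumes F: "continuous_on (\<Omega> \<times> UNIV) F" and v: "v \<in> borel_measurable (lebesgue_on \<Omega>)"
  shows "(\<lambda>x. F (x, v x)) \<in> borel_measurable (lebesgue_on \<Omega>)"
proof -
  have "(\<lambda>x. x) \<in> borel_measurable (lebesgue_on \<Omega>)"
    by (intro borel_measurable_continuous_lebesgue_on continuous_intros)
  then have "(\<lambda>x. (x, v x)) \<in> borel_measurable (lebesgue_on \<Omega>)" using v by (rule borel_measurable_Pair)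
  then have "(\<lambda>x. (x, v x)) \<in> measurable (lebesgue_on \<Omega>) (restrict_space borel (\<Omega> \<times> UNIV))"
    by (intro measurable_restrict_space2) auto
  then show ?thesis using borel_measurable_continuous_on_restrict[OF F] by (rule measurable_compose)
qed

text \<open>The bound on \<open>b\<close> carries the factor \<open>CARD('n)\<close> because
  \<open>b\<close> is bounded componentwise and the norm is at most the sum of the components. The
  bounds hold at every point of \<open>\<Omega>\<close>, hence also along a solution.\<close>

lemma
  fixes \<Omega> :: "(real^'n) set" and x :: "real^'n"
  assumes co: "coefficient_assumption \<Omega> C_A alo ahi a b c" and \<Omega>: "open \<Omega>"
  shows coefficient_a_continuous: "continuous_on UNIV a"
    and coefficient_b_measurable: "v \<in> borel_measurable (lebesgue_on \<Omega>) \<Longrightarrow>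
      (\<lambda>x. b x (v x)) \<in> borel_measurable (lebesgue_on \<Omega>)"
    and coefficient_c_measurable: "v \<in> borel_measurable (lebesgue_on \<Omega>) \<Longrightarrow>
      p \<in> borel_measurable (lebesgue_on \<Omega>) \<Longrightarrow>
      (\<lambda>x. c x (v x) (p x)) \<in> borel_measurable (lebesgue_on \<Omega>)"
    and coefficient_b_le: "x \<in> \<Omega> \<Longrightarrow> norm (b x s) \<le> real CARD('n) * C_A"
    and coefficient_c_le: "x \<in> \<Omega> \<Longrightarrow> \<bar>c x s q\<bar> \<le> C_A"
proof -
  show "continuous_on UNIV a" using co by (simp add: coefficient_assumption_def W1inf_bounded_def)
  have b: "W1inf_bounded (\<Omega> \<times> UNIV) C_A (\<lambda>(x, s). b x s $ i)" for i
    using co by (simp add: coefficient_assumption_def)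
  have c: "W1inf_bounded (\<Omega> \<times> UNIV) C_A (\<lambda>(x, s, p). c x s p)"
    using co by (simp add: coefficient_assumption_def)
  have op: "open (\<Omega> \<times> (UNIV :: real set))" "open (\<Omega> \<times> (UNIV :: (real \<times> (real^'n)) set))"
    using \<Omega> by (auto intro: open_Times)
  have bc: "continuous_on (\<Omega> \<times> UNIV) (\<lambda>z. b (fst z) (snd z))"
  proof -
    have "continuous_on (\<Omega> \<times> UNIV) (\<lambda>z. \<chi> i. b (fst z) (snd z) $ i)"
      using b by (intro continuous_on_vec_lambda) (simp add: W1inf_bounded_def case_prod_unfold)
    then show ?thesis by simp
  qed
  show "(\<lambda>x. b x (v x)) \<in> borel_measurable (lebesgue_on \<Omega>)" if "v \<in> borel_measurable (lebesgue_on \<Omega>)"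
    using borel_measurable_superposition[OF bc that] by simp
  have cc: "continuous_on (\<Omega> \<times> UNIV) (\<lambda>z. c (fst z) (fst (snd z)) (snd (snd z)))"
    using c by (simp add: W1inf_bounded_def case_prod_unfold)
  show "(\<lambda>x. c x (v x) (p x)) \<in> borel_measurable (lebesgue_on \<Omega>)"
    if "v \<in> borel_measurable (lebesgue_on \<Omega>)" "p \<in> borel_measurable (lebesgue_on \<Omega>)"
    using borel_measurable_superposition[OF cc borel_measurable_Pair[OF that]] by simp
  show "\<bar>c x s q\<bar> \<le> C_A" if "x \<in> \<Omega>"
    using W1inf_bounded_le[OF op(2) c, of "(x, s, q)"] that by simp
  show "norm (b x s) \<le> real CARD('n) * C_A" if "x \<in> \<Omega>"
  proof -
    have "norm (b x s) \<le> (\<Sum>i\<in>UNIV. \<bar>b x s $ i\<bar>)" by (rule norm_le_l1_cart)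
    also have "\<dots> \<le> (\<Sum>i\<in>(UNIV::'n set). C_A)"
      using W1inf_bounded_le[OF op(1) b, of "(x, s)"] that by (intro sum_mono) auto
    finally show ?thesis by simp
  qed
qed

lemma H1_norm_L2_le:
  assumes \<Omega>: "open \<Omega>" and u: "u \<in> H1 \<Omega>" "H1_norm \<Omega> u \<le> C"
  shows "(\<integral>x. (u x)\<^sup>2 \<partial>lebesgue_on \<Omega>) \<le> C\<^sup>2"
proof -
  have i: "integrable (lebesgue_on \<Omega>) (\<lambda>x. (u x)\<^sup>2)" "integrable (lebesgue_on \<Omega>) (\<lambda>x. (norm (wgrad \<Omega> u x))\<^sup>2)"
    using u square_integrable_wgrad[OF \<Omega> u(1)] by (auto simp: H1_def square_integrable_def)
  then have "(\<integral>x. (u x)\<^sup>2 \<partial>lebesgue_on \<Omega>) \<le> (\<integral>x. (u x)\<^sup>2 + (norm (wgrad \<Omega> u x))\<^sup>2 \<partial>lebesgue_on \<Omega>)"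
    by (intro integral_mono) auto
  also have "\<dots> \<le> C\<^sup>2" using u(2) unfolding H1_norm_def by (rule sqrt_le_D)
  finally show ?thesis .
qed

lemma cutoff_eq: "\<epsilon> > 0 \<Longrightarrow> cutoff xbar \<epsilon> x = max 0 (min 1 (2 - 2 * norm (x - xbar) / \<epsilon>))"
  by (auto simp: cutoff_def max_def min_def field_simps)

text \<open>The factor \<open>min 1 (\<epsilon>0 powr ((N - 3) / 2))\<close> keeps the height of the
  peak below \<open>g2 - g1\<close>: as \<open>N \<le> 3\<close>, the power
  \<open>\<epsilon> powr ((3 - N) / 2)\<close> is largest at \<open>\<epsilon>0\<close>.\<close>

lemma
  fixes xbar x :: "real^'n"
  assumes n: "CARD('n) \<in> {2, 3}" and g: "g1 < g2" and \<epsilon>: "0 < \<epsilon>" "\<epsilon> \<le> \<epsilon>0"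
  shows peak_data_bounds: "g1 \<le> peak_data xbar \<epsilon>0 g1 g2 \<epsilon> x" "peak_data xbar \<epsilon>0 g1 g2 \<epsilon> x \<le> g2"
    and continuous_on_peak_data: "continuous_on UNIV (peak_data xbar \<epsilon>0 g1 g2 \<epsilon>)"
    and peak_data_outside: "norm (x - xbar) \<ge> \<epsilon> \<Longrightarrow> peak_data xbar \<epsilon>0 g1 g2 \<epsilon> x = g1"
    and peak_data_inside: "norm (x - xbar) \<le> \<epsilon> / 2 \<Longrightarrow> peak_data xbar \<epsilon>0 g1 g2 \<epsilon> x
      = g1 + (g2 - g1) * min 1 (\<epsilon>0 powr ((real CARD('n) - 3) / 2)) * \<epsilon> powr ((3 - real CARD('n)) / 2)"
proof -
  let ?h = "min 1 (\<epsilon>0 powr ((real CARD('n) - 3) / 2)) * \<epsilon> powr ((3 - real CARD('n)) / 2)"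
  have p: "peak_data xbar \<epsilon>0 g1 g2 \<epsilon> y = g1 + (g2 - g1) * ?h * cutoff xbar \<epsilon> y" for y
    by (simp add: peak_data_def Let_def mult.assoc)
  have h0: "?h \<ge> 0" by simp
  have h1: "?h \<le> 1"
  proof -
    have "?h \<le> \<epsilon>0 powr ((real CARD('n) - 3) / 2) * \<epsilon>0 powr ((3 - real CARD('n)) / 2)"
      using n \<epsilon> by (intro mult_mono powr_mono2) auto
    also have "\<dots> = 1" using \<epsilon> by (simp flip: powr_add add_divide_distrib)
    finally show ?thesis .
  qed
  have c: "0 \<le> cutoff xbar \<epsilon> x" "cutoff xbar \<epsilon> x \<le> 1" using \<epsilon> by (auto simp: cutoff_eq)
  have "?h * cutoff xbar \<epsilon> x \<le> 1" using h1 c by (rule mult_le_one)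
  then have "(g2 - g1) * (?h * cutoff xbar \<epsilon> x) \<le> (g2 - g1) * 1" using g by (intro mult_left_mono) auto
  then show "peak_data xbar \<epsilon>0 g1 g2 \<epsilon> x \<le> g2" by (simp add: p mult.assoc)
  have "0 \<le> (g2 - g1) * ?h * cutoff xbar \<epsilon> x" using g h0 c by (intro mult_nonneg_nonneg) auto
  then show "g1 \<le> peak_data xbar \<epsilon>0 g1 g2 \<epsilon> x" by (simp add: p)
  have "peak_data xbar \<epsilon>0 g1 g2 \<epsilon> = (\<lambda>y. g1 + (g2 - g1) * ?h * max 0 (min 1 (2 - 2 * norm (y - xbar) / \<epsilon>)))"
    using \<epsilon> by (intro ext) (simp only: p cutoff_eq)
  then show "continuous_on UNIV (peak_data xbar \<epsilon>0 g1 g2 \<epsilon>)"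
    using \<epsilon> by (simp only:) (intro continuous_intros, simp)
  show "norm (x - xbar) \<ge> \<epsilon> \<Longrightarrow> peak_data xbar \<epsilon>0 g1 g2 \<epsilon> x = g1"
    using \<epsilon> by (simp add: p cutoff_def)
  show "norm (x - xbar) \<le> \<epsilon> / 2 \<Longrightarrow> peak_data xbar \<epsilon>0 g1 g2 \<epsilon> x
      = g1 + (g2 - g1) * min 1 (\<epsilon>0 powr ((real CARD('n) - 3) / 2)) * \<epsilon> powr ((3 - real CARD('n)) / 2)"
    unfolding p by (simp add: cutoff_def mult.assoc)
qed

lemma peak_data_in_dirichlet_data:
  fixes xbar :: "real^'n"
  assumes n: "CARD('n) \<in> {2, 3}" and C_G: "large_enough \<Omega> xbar \<epsilon>0 glo ghi C_G"
    and g: "glo \<le> g1" "g1 < g2" "g2 \<le> ghi" and \<epsilon>: "0 < \<epsilon>" "\<epsilon> \<le> \<epsilon>0"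
  shows "peak_data xbar \<epsilon>0 g1 g2 \<epsilon> \<in> dirichlet_data \<Omega> glo ghi C_G"
proof -
  have "glo \<le> peak_data xbar \<epsilon>0 g1 g2 \<epsilon> x \<and> peak_data xbar \<epsilon>0 g1 g2 \<epsilon> x \<le> ghi" for x
    using peak_data_bounds[OF n g(2) \<epsilon>, of xbar x] g by linarith
  then show ?thesis
    using C_G g \<epsilon> unfolding large_enough_def dirichlet_data_def by auto
qed

text \<open>The surface measure is finite because some admissible peak, which is square integrable, is
  bounded away from zero.\<close>

lemma surface_measure_finite:
  fixes xbar :: "real^'n"
  assumes n: "CARD('n) \<in> {2, 3}" and C_G: "large_enough \<Omega> xbar \<epsilon>0 glo ghi C_G"
    and glo: "glo < ghi" and \<epsilon>0: "\<epsilon>0 > 0"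
  shows "finite_measure (surface_measure \<Omega>)"
proof -
  let ?S = "surface_measure \<Omega>"
  \<comment> \<open>Both levels are put on one side of zero: on the positive side if
    \<open>ghi > 0\<close>; otherwise \<open>glo\<close> and the midpoint are both negative.\<close>
  have "\<exists>g1 g2 \<delta>. glo \<le> g1 \<and> g1 < g2 \<and> g2 \<le> ghi \<and> \<delta> > 0 \<and> (g1 \<ge> \<delta> \<or> g2 \<le> - \<delta>)"
  proof (cases "ghi > 0")
    case True
    then have "glo \<le> max glo (ghi / 2) \<and> max glo (ghi / 2) < ghi \<and> ghi \<le> ghi \<and> 0 < ghi / 2 \<and>
        (ghi / 2 \<le> max glo (ghi / 2) \<or> ghi \<le> - (ghi / 2))" using glo by auto
    then show ?thesis by blast
  next
    case False
    then have "glo \<le> glo \<and> glo < (glo + ghi) / 2 \<and> (glo + ghi) / 2 \<le> ghi \<and> 0 < - ((glo + ghi) / 2) \<and>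
        (- ((glo + ghi) / 2) \<le> glo \<or> (glo + ghi) / 2 \<le> - (- ((glo + ghi) / 2)))" using glo by simp
    then show ?thesis by blast
  qed
  then obtain g1 g2 \<delta> where g: "glo \<le> g1" "g1 < g2" "g2 \<le> ghi" "\<delta> > 0" "g1 \<ge> \<delta> \<or> g2 \<le> - \<delta>" by blast
  let ?p = "peak_data xbar \<epsilon>0 g1 g2 \<epsilon>0"
  have "?p \<in> dirichlet_data \<Omega> glo ghi C_G"
    using \<epsilon>0 by (intro peak_data_in_dirichlet_data[OF n C_G g(1-3)]) auto
  then have int: "integrable ?S (\<lambda>x. (norm (?p x))\<^sup>2)"
    by (simp add: dirichlet_data_def H1_boundary_def square_integrable_def)
  have le: "\<delta>\<^sup>2 \<le> (norm (?p x))\<^sup>2" for x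
  proof -
    have "\<delta> \<le> \<bar>?p x\<bar>" using peak_data_bounds[OF n g(2) \<epsilon>0 order_refl, of xbar x] g(4,5) by linarith
    then show ?thesis using g(4) by (intro power_mono) auto
  qed
  have "ennreal (\<delta>\<^sup>2) * emeasure ?S (space ?S) = (\<integral>\<^sup>+x. ennreal (\<delta>\<^sup>2) \<partial>?S)" by simp
  also have "\<dots> \<le> (\<integral>\<^sup>+x. ennreal (norm ((norm (?p x))\<^sup>2)) \<partial>?S)"
    using le by (intro nn_integral_mono ennreal_leI) simp
  also have "\<dots> < \<infinity>" using int by (simp add: integrable_iff_bounded)
  finally have "emeasure ?S (space ?S) < \<infinity>"
    using g(4) by (auto simp: ennreal_mult_less_top)
  then show ?thesis by (intro finite_measureI) auto
qed

text \<open>The constant sequence approximates; finiteness of the surface measure makes the bounded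
  function square integrable on the boundary.\<close>

lemma has_trace_smooth:
  fixes \<Omega> :: "'a::euclidean_space set"
  assumes d: "DIM('a) \<ge> 2" and \<Omega>: "open \<Omega>" "bounded \<Omega>" and fin: "finite_measure (surface_measure \<Omega>)"
    and \<phi>: "smooth \<phi>" "compact K" "\<And>x. x \<notin> K \<Longrightarrow> \<phi> x = 0"
  shows "has_trace \<Omega> \<phi> \<phi>"
proof -
  have c: "continuous_on UNIV \<phi>" using \<phi>(1) by (rule smooth_continuous_on)
  obtain M where M: "\<And>x. \<bar>\<phi> x\<bar> \<le> M" using compact_support_bounded[OF c \<phi>(2,3)] by metis
  have m: "\<phi> \<in> borel_measurable (surface_measure \<Omega>)"
    using c d by (intro borel_measurable_surface_measure borel_measurable_continuous_onI)
  have "integrable (surface_measure \<Omega>) (\<lambda>x. (norm (\<phi> x))\<^sup>2)"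
  proof (rule finite_measure.integrable_const_bound[OF fin])
    have "(norm (\<phi> x))\<^sup>2 \<le> M\<^sup>2" for x using M[of x] by (intro power_mono) auto
    then show "AE x in surface_measure \<Omega>. norm ((norm (\<phi> x))\<^sup>2) \<le> M\<^sup>2" by simp
  qed (use m in measurable)
  then have "square_integrable (surface_measure \<Omega>) \<phi>" using m by (simp add: square_integrable_def)
  then show ?thesis
    using \<phi>(1) smooth_in_H1[OF \<Omega> \<phi>(1)]
    by (auto simp: has_trace_def H1_converges_def L2_converges_def intro!: exI[of _ "\<lambda>_. \<phi>"])
qed

lemma continuous_antiderivative:
  fixes a :: "real \<Rightarrow> real"
  assumes "continuous_on UNIV a"
  obtains A where "\<And>t. (A has_real_derivative a t) (at t)" "A t0 = 0"
proof -
  have "\<exists>F. \<forall>x. (-\<infinity>::ereal) < x \<longrightarrow> x < \<infinity> \<longrightarrow> (F has_vector_derivative a x) (at x)"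
    using assms by (intro einterval_antiderivative) (auto simp: continuous_on_eq_continuous_at)
  then obtain F where F: "\<And>x. (F has_real_derivative a x) (at x)"
    by (auto simp: has_real_derivative_iff_has_vector_derivative)
  have "((\<lambda>x. F x - F t0) has_real_derivative a x) (at x)" for x
    using F by (auto intro!: derivative_eq_intros)
  then show ?thesis by (intro that[of "\<lambda>x. F x - F t0"]) auto
qed

lemma geometric_assumption_halfspace:
  assumes "geometric_assumption \<Omega> \<Gamma>' xbar \<epsilon>0 e"
  obtains r where "r > 0" "r \<le> \<epsilon>0" "\<Omega> \<inter> ball xbar r = {y \<in> ball xbar r. y \<bullet> e < xbar \<bullet> e}"
proof -
  have \<Omega>: "open \<Omega>" and \<Gamma>: "xbar \<in> \<Gamma>'" "\<Gamma>' \<subseteq> frontier \<Omega>" "open_smooth_boundary_part \<Omega> \<Gamma>'" and \<epsilon>0: "\<epsilon>0 > 0"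
    and n: "\<And>y. y \<in> ball xbar \<epsilon>0 \<inter> frontier \<Omega> \<Longrightarrow> outer_normal \<Omega> y = e"
    using assms by (auto simp: geometric_assumption_def bounded_lipschitz_domain_def)
  obtain \<nu> \<psi> where g: "local_graph \<Omega> xbar \<nu> \<psi>" and s: "smooth \<psi>"
    using \<Gamma> by (auto simp: open_smooth_boundary_part_def)
  show ?thesis
    by (rule constant_normal_imp_halfspace[OF \<Omega> _ g smooth_differentiable[OF s] \<epsilon>0 n])
      (use \<Gamma> that in auto)
qed

lemma continuous_coefficient_gap:
  fixes a1 a2 :: "real \<Rightarrow> real"
  assumes a: "continuous_on UNIV a1" "continuous_on UNIV a2" and s: "s < ghi" "a2 s < a1 s"
  obtains g2 c where "s < g2" "g2 \<le> ghi" "c > 0" "\<And>t. s \<le> t \<Longrightarrow> t \<le> g2 \<Longrightarrow> c \<le> a1 t - a2 t"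
proof -
  have "continuous_on UNIV (\<lambda>t. a1 t - a2 t)" using a by (intro continuous_intros)
  then have "isCont (\<lambda>t. a1 t - a2 t) s" by (simp add: continuous_on_eq_continuous_at)
  moreover have "(a1 s - a2 s) / 2 > 0" using s by simp
  ultimately obtain \<delta> where \<delta>: "\<delta> > 0"
    "\<And>t. dist t s < \<delta> \<Longrightarrow> dist (a1 t - a2 t) (a1 s - a2 s) < (a1 s - a2 s) / 2"
    unfolding continuous_at_eps_delta by metis
  show ?thesis
  proof (rule that[of "min ghi (s + \<delta> / 2)" "(a1 s - a2 s) / 2"])
    fix t assume t: "s \<le> t" "t \<le> min ghi (s + \<delta> / 2)"
    then have "dist t s < \<delta>" using \<delta>(1) by (auto simp: dist_real_def)
    then show "(a1 s - a2 s) / 2 \<le> a1 t - a2 t" using \<delta>(2)[of t] by (auto simp: dist_real_def abs_if split: if_splits)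
  qed (use s \<delta> in auto)
qed

section \<open>Different coefficients yield different fluxes\<close>

text \<open>The case of a positive gap \<open>a1 s - a2 s\<close>. If all fluxes agreed, a fixed
  positive number would be bounded by positive powers of \<open>\<epsilon>\<close> for all small
  \<open>\<epsilon>\<close>.\<close>

lemma nonidentical_imp_flux_differs:
  fixes \<Omega> \<Gamma>' :: "(real^'n) set" and xbar :: "real^'n" and N :: 'n
    and \<epsilon>0 glo ghi C_A C_G C_U alo ahi :: real
    and a1 a2 :: "real \<Rightarrow> real"
    and b1 b2 :: "real^'n \<Rightarrow> real \<Rightarrow> real^'n"
    and c1 c2 :: "real^'n \<Rightarrow> real \<Rightarrow> real^'n \<Rightarrow> real"
    and u1 u2 :: "(real^'n \<Rightarrow> real) \<Rightarrow> (real^'n \<Rightarrow> real)"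
  assumes dim: "CARD('n) \<in> {2, 3}"
    and constants: "glo < ghi" "C_A > 0" "alo > 0"
    and geometry: "geometric_assumption \<Omega> \<Gamma>' xbar \<epsilon>0 (axis N 1)"
    and \<Gamma>M: "\<Gamma>M = ball xbar \<epsilon>0 \<inter> frontier \<Omega>"
    and C_G: "large_enough \<Omega> xbar \<epsilon>0 glo ghi C_G"
    and G: "G = dirichlet_data \<Omega> glo ghi C_G"
    and coeff1: "coefficient_assumption \<Omega> C_A alo ahi a1 b1 c1"
    and coeff2: "coefficient_assumption \<Omega> C_A alo ahi a2 b2 c2"
    and solv1: "solvability_assumption \<Omega> G C_U a1 b1 c1"
    and solv2: "solvability_assumption \<Omega> G C_U a2 b2 c2"
    and u1: "\<And>g. g \<in> G \<Longrightarrow> weak_solution \<Omega> a1 b1 c1 g (u1 g)"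
    and u2: "\<And>g. g \<in> G \<Longrightarrow> weak_solution \<Omega> a2 b2 c2 g (u2 g)"
    and s: "glo < s" "s < ghi" "a2 s < a1 s"
  shows "\<exists>g\<in>G. \<not> same_flux_on \<Omega> \<Gamma>M (neumann_flux \<Omega> a1 b1 c1 (u1 g)) (neumann_flux \<Omega> a2 b2 c2 (u2 g))"
proof (rule ccontr)
  assume "\<not> ?thesis"
  then have same: "\<And>g. g \<in> G \<Longrightarrow>
    same_flux_on \<Omega> \<Gamma>M (neumann_flux \<Omega> a1 b1 c1 (u1 g)) (neumann_flux \<Omega> a2 b2 c2 (u2 g))" by blast
  define e :: "real^'n" where "e = axis N 1"
  define n where "n = real CARD('n)"
  have e: "e \<in> Basis" by (simp add: e_def axis_in_Basis_iff)
  have DIM: "DIM(real^'n) = CARD('n)" by simp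
  have d: "DIM(real^'n) \<ge> 2" using dim by auto
  have n2: "n \<ge> 2" using dim by (auto simp: n_def)
  have \<Omega>: "open \<Omega>" "bounded \<Omega>" and \<epsilon>0: "\<epsilon>0 > 0"
    using geometry by (auto simp: geometric_assumption_def bounded_lipschitz_domain_def)
  obtain r where r: "r > 0" "r \<le> \<epsilon>0" and half: "\<Omega> \<inter> ball xbar r = {y \<in> ball xbar r. y \<bullet> e < xbar \<bullet> e}"
    using geometric_assumption_halfspace[OF geometry] unfolding e_def by blast
  have fin: "finite_measure (surface_measure \<Omega>)"
    by (rule surface_measure_finite[OF dim C_G constants(1) \<epsilon>0])
  note ac = coefficient_a_continuous[OF coeff1 \<Omega>(1)] coefficient_a_continuous[OF coeff2 \<Omega>(1)]
  obtain g2 c0 where g2: "s < g2" "g2 \<le> ghi" and c0: "c0 > 0" "\<And>t. s \<le> t \<Longrightarrow> t \<le> g2 \<Longrightarrow> c0 \<le> a1 t - a2 t"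
    using continuous_coefficient_gap[OF ac s(2,3)] by blast
  obtain A1 where A1: "\<And>t. (A1 has_real_derivative a1 t) (at t)" "A1 s = 0"
    using continuous_antiderivative[OF ac(1)] by blast
  obtain A2 where A2: "\<And>t. (A2 has_real_derivative a2 t) (at t)" "A2 s = 0"
    using continuous_antiderivative[OF ac(2)] by blast
  have Acont: "continuous_on UNIV A1" "continuous_on UNIV A2"
    using A1(1) A2(1) DERIV_isCont by (blast intro: continuous_at_imp_continuous_on)+
  have abound: "\<bar>a1 t\<bar> \<le> ahi" "\<bar>a2 t\<bar> \<le> ahi" for t
  proof -
    have "alo \<le> a1 t" "a1 t \<le> ahi" "alo \<le> a2 t" "a2 t \<le> ahi"
      using coeff1 coeff2 by (auto simp: coefficient_assumption_def)
    then show "\<bar>a1 t\<bar> \<le> ahi" "\<bar>a2 t\<bar> \<le> ahi" using constants(3) by auto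
  qed
  have W: "c0 * (t - s) \<le> A1 t - A2 t" if t: "s \<le> t" "t \<le> g2" for t
  proof (cases "s = t")
    case False
    have "((\<lambda>t. A1 t - A2 t) has_real_derivative a1 t - a2 t) (at t)" for t
      using A1(1) A2(1) by (rule DERIV_diff)
    then obtain z where z: "s < z" "z < t" "(A1 t - A2 t) - (A1 s - A2 s) = (t - s) * (a1 z - a2 z)"
      using MVT2[of s t "\<lambda>t. A1 t - A2 t" "\<lambda>t. a1 t - a2 t"] t False by auto
    then show ?thesis using c0(2)[of z] t A1(2) A2(2) by (simp add: mult.commute mult_right_mono)
  qed (use A1 A2 in simp)
  obtain C where C: "C > 0" "\<And>\<epsilon>. 0 < \<epsilon> \<Longrightarrow> \<epsilon> \<le> r / 2 \<Longrightarrow> integrable lborel (kern xbar e r \<epsilon>)"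
    "\<And>\<epsilon>. 0 < \<epsilon> \<Longrightarrow> \<epsilon> \<le> r / 2 \<Longrightarrow> (\<integral>x. kern xbar e r \<epsilon> x \<partial>lborel) \<le> C * \<epsilon> powr (- 1 / 4)"
    using kern_integral[OF e r(1), where ?x0.0 = xbar] by blast
  \<comment> \<open>\<open>D\<close> bounds the squared \<open>L\<^sup>2\<close> norm of
    \<open>A (u)\<close> for either solution, \<open>C2\<close> is the constant of the squared
    Laplacian of the probe, and \<open>E\<close> gathers the bounds on \<open>b\<close> and
    \<open>c\<close> with those on the probe and its gradient.\<close>
  define D where "D = 2 * ahi\<^sup>2 * (C_U\<^sup>2 + s\<^sup>2 * measure lebesgue \<Omega>)"
  define C2 where "C2 = (n * (16 * (1 + n) + 36 * r\<^sup>2 + 4))\<^sup>2"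
  define E where "E = n * C_A * (n * (1 + n + 8 * r\<^sup>2)) + C_A * r"
  define h where "h = (g2 - s) * min 1 (\<epsilon>0 powr ((n - 3) / 2))"
  \<comment> \<open>The lower bound of \<open>slab_main_term_ge\<close> stripped of its powers of
    \<open>\<epsilon>\<close>, whose product is
    \<open>\<epsilon> powr ((1 - n) / 2)\<close>.\<close>
  define \<kappa> where "\<kappa> = c0 * h * (flat 0 (r\<^sup>2 / 8) * (3 / 4) / 2 ^ (CARD('n) + 2)) / n ^ (CARD('n) - 1)"
  have h: "h > 0" using g2 \<epsilon>0 by (simp add: h_def)
  have \<kappa>: "\<kappa> > 0"
    unfolding \<kappa>_def using h c0(1) r(1) n2 by (intro mult_pos_pos divide_pos_pos zero_less_power) auto
  \<comment> \<open>Both exponents on the right are positive because \<open>n \<ge> 2\<close>. The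
    inequality is the comparison of boundary and error terms, multiplied by
    \<open>\<epsilon> powr ((n - 1) / 2)\<close>.\<close>
  have main: "\<kappa> \<le> (D + C2 * C) * \<epsilon> powr (3 / 8) + 2 * E * C * \<epsilon> powr (n / 2 - 3 / 4)"
    if \<epsilon>: "0 < \<epsilon>" "\<epsilon> \<le> r / 2" for \<epsilon>
  proof -
    have \<epsilon>': "\<epsilon> \<le> \<epsilon>0" using \<epsilon> r by linarith
    define g where "g = peak_data xbar \<epsilon>0 s g2 \<epsilon>"
    define \<phi> where "\<phi> = probe xbar e r \<epsilon>"
    define Q where "Q = slab_proj e (xbar \<bullet> e)"
    \<comment> \<open>This weight balances Young's inequality: \<open>t\<close> and
      \<open>\<epsilon> powr (2 - n) * \<epsilon> powr (- 1 / 4) / t\<close> become the same power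
      of \<open>\<epsilon>\<close>.\<close>
    define t where "t = \<epsilon> powr (7 / 8 - n / 2)"
    let ?S = "\<lambda>A. \<integral>x. indicator (slab e) x * (A (g (Q x)) * pd e \<phi> (Q x)) \<partial>lborel"
    have gG: "g \<in> G" unfolding G g_def using s g2 \<epsilon> \<epsilon>'
      by (intro peak_data_in_dirichlet_data[OF dim C_G]) auto
    note peak = peak_data_bounds[OF dim g2(1) \<epsilon>(1) \<epsilon>'] continuous_on_peak_data[OF dim g2(1) \<epsilon>(1) \<epsilon>']
      peak_data_outside[OF dim g2(1) \<epsilon>(1) \<epsilon>'] peak_data_inside[OF dim g2(1) \<epsilon>(1) \<epsilon>']
    have gc: "continuous_on UNIV g" unfolding g_def by (rule peak)
    have \<phi>s: "smooth \<phi>" unfolding \<phi>_def by (rule probe_smooth[OF d \<Omega> e r(1) half \<epsilon>])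
    have \<phi>0: "\<phi> x = 0" if "x \<notin> cball xbar (r / 2)" for x
      unfolding \<phi>_def by (rule probe_support[OF d \<Omega> e r(1) half \<epsilon> that])
    \<comment> \<open>The probe is an admissible test function: it is its own trace and vanishes
      outside the ball of radius \<open>r / 2 < \<epsilon>0\<close>, hence on the boundary off
      \<open>\<Gamma>M\<close>.\<close>
    have zero: "neumann_flux \<Omega> a1 b1 c1 (u1 g) \<phi> - neumann_flux \<Omega> a2 b2 c2 (u2 g) \<phi> = 0"
    proof -
      have "has_trace \<Omega> \<phi> \<phi>"
        by (rule has_trace_smooth[OF d \<Omega> fin \<phi>s compact_cball \<phi>0])
      moreover have "\<phi> \<in> H1 \<Omega>" by (rule smooth_in_H1[OF \<Omega> \<phi>s])
      moreover have "AE x in surface_measure \<Omega>. x \<notin> \<Gamma>M \<longrightarrow> \<phi> x = 0"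
      proof (rule AE_I2, rule impI)
        fix x assume "x \<in> space (surface_measure \<Omega>)" "x \<notin> \<Gamma>M"
        then have "x \<notin> ball xbar \<epsilon>0" unfolding \<Gamma>M space_surface_measure[OF d] by blast
        then have "x \<notin> cball xbar (r / 2)" using r by auto
        then show "\<phi> x = 0" by (rule \<phi>0)
      qed
      ultimately show ?thesis
        using same[OF gG] unfolding same_flux_on_def vanishes_on_def by blast
    qed
    have close: "\<bar>neumann_flux \<Omega> a b c u \<phi> - ?S A\<bar> \<le> t / 2 * D + (C2 / \<epsilon> ^ (CARD('n) - 2) / (2 * t) + E) * (C * \<epsilon> powr (- 1 / 4))"
      if co: "coefficient_assumption \<Omega> C_A alo ahi a b c" and so: "solvability_assumption \<Omega> G C_U a b c"
        and u: "weak_solution \<Omega> a b c g u" and A: "\<And>t. (A has_real_derivative a t) (at t)" "A s = 0"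
        and ab: "\<And>t. \<bar>a t\<bar> \<le> ahi"
      for a A b c u
    proof -
      have tr: "has_trace \<Omega> u g" and uH: "u \<in> H1 \<Omega>" using u by (auto simp: weak_solution_def)
      have "H1_norm \<Omega> u \<le> C_U" using so gG u by (auto simp: solvability_assumption_def)
      then have U: "(\<integral>x. (u x)\<^sup>2 \<partial>lebesgue_on \<Omega>) \<le> C_U\<^sup>2" by (rule H1_norm_L2_le[OF \<Omega>(1) uH])
      have um: "u \<in> borel_measurable (lebesgue_on \<Omega>)" using uH by (simp add: H1_def square_integrable_def)
      have wm: "wgrad \<Omega> u \<in> borel_measurable (lebesgue_on \<Omega>)"
        using square_integrable_wgrad[OF \<Omega>(1) uH] by (simp add: square_integrable_def)
      have tpos: "t > 0" using \<epsilon> by (simp add: t_def)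
      have n0: "0 \<le> n * C_A" "0 \<le> C_A" using n2 constants(2) by auto
      have bl: "norm (b x (u x)) \<le> n * C_A" if "x \<in> \<Omega>" for x
        unfolding n_def by (rule coefficient_b_le[OF co \<Omega>(1) that])
      have "\<bar>neumann_flux \<Omega> a b c u \<phi> - ?S A\<bar>
        \<le> t / 2 * (2 * ahi\<^sup>2 * (C_U\<^sup>2 + s\<^sup>2 * measure lebesgue \<Omega>))
        + ((real DIM(real^'n) * (16 * (1 + real DIM(real^'n)) + 36 * r\<^sup>2 + 4))\<^sup>2 / \<epsilon> ^ (DIM(real^'n) - 2) / (2 * t)
          + n * C_A * (real DIM(real^'n) * (1 + real DIM(real^'n) + 8 * r\<^sup>2)) + C_A * r) * (C * \<epsilon> powr (- 1 / 4))"
        unfolding neumann_flux_def \<phi>_def Q_def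
        by (rule flux_close[OF d \<Omega> e r(1) half \<epsilon> A coefficient_a_continuous[OF co \<Omega>(1)] ab tr gc
          coefficient_b_measurable[OF co \<Omega>(1) um] bl n0(1) coefficient_c_measurable[OF co \<Omega>(1) um wm]
          coefficient_c_le[OF co \<Omega>(1)] n0(2) U tpos C(2)[OF \<epsilon>] C(3)[OF \<epsilon>]])
      then show ?thesis unfolding DIM by (simp only: D_def C2_def E_def n_def add.assoc)
    qed
    note cl = close[OF coeff1 solv1 u1[OF gG] A1 abound(1)] close[OF coeff2 solv2 u2[OF gG] A2 abound(2)]
    have up: "?S A1 - ?S A2 \<le> t * D + (C2 / \<epsilon> ^ (CARD('n) - 2) / t + 2 * E) * (C * \<epsilon> powr (- 1 / 4))"
    proof -
      have "?S A1 - ?S A2 \<le> 2 * (t / 2 * D + (C2 / \<epsilon> ^ (CARD('n) - 2) / (2 * t) + E) * (C * \<epsilon> powr (- 1 / 4)))"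
      proof -
        \<comment> \<open>The two fluxes are equal, so the boundary integrals differ by at most the
          sum of the two errors.\<close>
        have "S1 - S2 \<le> 2 * B" if "\<bar>F1 - S1\<bar> \<le> B" "\<bar>F2 - S2\<bar> \<le> B" "F1 - F2 = 0" for F1 F2 S1 S2 B :: real
          using that by linarith
        from this[OF cl zero] show ?thesis .
      qed
      also have "\<dots> = t * D + (2 * (C2 / \<epsilon> ^ (CARD('n) - 2) / (2 * t)) + 2 * E) * (C * \<epsilon> powr (- 1 / 4))"
        by (simp only: distrib_left distrib_right mult.assoc)
      finally show ?thesis by simp
    qed
    have lo: "c0 * (h * \<epsilon> powr ((3 - n) / 2)) * (flat 0 (r\<^sup>2 / 8) * (3 / 4) / 2 ^ (CARD('n) + 2) / \<epsilon> ^ CARD('n))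
        * (\<epsilon> / CARD('n)) ^ (CARD('n) - 1) \<le> ?S A1 - ?S A2"
    proof -
      have int: "integrable lborel (\<lambda>x. indicator (slab e) x * (A (g (Q x)) * pd e \<phi> (Q x)))"
        if "continuous_on UNIV A" for A
        unfolding Q_def
      proof (rule slab_integrable[OF e, of "\<lambda>x. A (g x) * pd e \<phi> x" "cball xbar (r / 2)"])
        have "continuous_on UNIV (\<lambda>x. A (g x))" using that gc by (auto intro: continuous_on_compose2)
        then show "continuous_on UNIV (\<lambda>x. A (g x) * pd e \<phi> x)"
          using smooth_continuous_on[OF smooth_pd[OF \<phi>s e]] by (rule continuous_on_mult)
        show "A (g x) * pd e \<phi> x = 0" if "x \<notin> cball xbar (r / 2)" for x
          using pd_vanishes[OF closed_cball \<phi>0 that] by simp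
      qed simp
      let ?k = "\<lambda>x. A1 (g x) - A2 (g x)"
      have "?S A1 - ?S A2 = (\<integral>x. indicator (slab e) x * (A1 (g (Q x)) * pd e \<phi> (Q x))
          - indicator (slab e) x * (A2 (g (Q x)) * pd e \<phi> (Q x)) \<partial>lborel)"
        using int[OF Acont(1)] int[OF Acont(2)] by (rule Bochner_Integration.integral_diff[symmetric])
      also have "\<dots> = (\<integral>x. indicator (slab e) x * (?k (Q x) * pd e \<phi> (Q x)) \<partial>lborel)"
        by (simp only: right_diff_distrib left_diff_distrib)
      finally have eq: "?S A1 - ?S A2 = (\<integral>x. indicator (slab e) x * (?k (Q x) * pd e \<phi> (Q x)) \<partial>lborel)" .
      have gb: "s \<le> g x" "g x \<le> g2" for x using peak(1,2) by (auto simp: g_def)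
      have kc: "continuous_on UNIV ?k"
        using Acont gc by (intro continuous_on_diff) (auto intro: continuous_on_compose2)
      have k1: "?k x = 0" if "\<epsilon> \<le> norm (x - xbar)" for x
        using peak(4)[OF that] A1(2) A2(2) by (simp add: g_def)
      have k2: "0 \<le> ?k x" for x
      proof -
        have "0 \<le> c0 * (g x - s)" using c0(1) gb by simp
        then show ?thesis using W[OF gb] by (rule order_trans)
      qed
      have k3: "c0 * (h * \<epsilon> powr ((3 - n) / 2)) \<le> ?k x" if "norm (x - xbar) \<le> \<epsilon> / 2" for x
      proof -
        have "g x - s = h * \<epsilon> powr ((3 - n) / 2)" using peak(5)[OF that] by (simp add: g_def h_def n_def)
        then show ?thesis using W[OF gb, of x] by simp
      qed
      have k4: "0 \<le> c0 * (h * \<epsilon> powr ((3 - n) / 2))" using c0(1) h by simp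
      show ?thesis unfolding eq unfolding \<phi>_def Q_def
        by (rule slab_main_term_ge[OF d \<Omega> e r(1) half \<epsilon> kc k1 k2 k3 k4, unfolded DIM])
    qed
    have pw: "\<epsilon> ^ k = \<epsilon> powr real k" for k using \<epsilon> by (simp add: powr_realpow)
    have "\<kappa> * \<epsilon> powr ((1 - n) / 2) \<le> (D + C2 * C) * \<epsilon> powr (7 / 8 - n / 2) + 2 * E * C * \<epsilon> powr (- 1 / 4)"
    proof -
      have "\<kappa> * \<epsilon> powr ((1 - n) / 2) = c0 * (h * \<epsilon> powr ((3 - n) / 2)) * (flat 0 (r\<^sup>2 / 8) * (3 / 4) / 2 ^ (CARD('n) + 2) / \<epsilon> ^ CARD('n))
        * (\<epsilon> / CARD('n)) ^ (CARD('n) - 1)"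
      proof -
        \<comment> \<open>Power count of height, disc area and normal derivative:
          \<open>(3 - n) / 2 + (n - 1) - n = (1 - n) / 2\<close>.\<close>
        have "\<epsilon> powr ((1 - n) / 2) = \<epsilon> powr ((3 - n) / 2) * (\<epsilon> ^ (CARD('n) - 1) / \<epsilon> ^ CARD('n))"
        proof -
          have card: "real (CARD('n) - 1) = n - 1" "real CARD('n) = n" using dim by (auto simp: n_def)
          have eq: "\<epsilon> ^ (CARD('n) - 1) / \<epsilon> ^ CARD('n) = \<epsilon> powr (n - 1 - n)"
            unfolding pw card by (rule powr_diff[symmetric])
          have "(1 - n) / 2 = (3 - n) / 2 + (n - 1 - n)" by (simp add: field_simps)
          then show ?thesis unfolding eq by (simp only: powr_add)
        qed
        then show ?thesis by (simp add: \<kappa>_def power_divide n_def ac_simps)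
      qed
      also have "\<dots> \<le> t * D + (C2 / \<epsilon> ^ (CARD('n) - 2) / t + 2 * E) * (C * \<epsilon> powr (- 1 / 4))"
        using lo up by (rule order_trans)
      also have "\<dots> = t * D + C2 * C * (1 / \<epsilon> ^ (CARD('n) - 2) / t * \<epsilon> powr (- 1 / 4)) + 2 * E * C * \<epsilon> powr (- 1 / 4)"
        by (simp add: distrib_right)
      also have "1 / \<epsilon> ^ (CARD('n) - 2) / t * \<epsilon> powr (- 1 / 4) = \<epsilon> powr (7 / 8 - n / 2)"
      proof -
        have "real (CARD('n) - 2) = n - 2" using dim by (auto simp: n_def)
        then have "1 / \<epsilon> ^ (CARD('n) - 2) = \<epsilon> powr (2 - n)"
          unfolding pw using powr_minus_divide[of \<epsilon> "n - 2"] by simp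
        then have "1 / \<epsilon> ^ (CARD('n) - 2) / t * \<epsilon> powr (- 1 / 4) = \<epsilon> powr (2 - n - (7 / 8 - n / 2) + (- 1 / 4))"
          by (simp only: t_def powr_diff powr_add)
        also have "2 - n - (7 / 8 - n / 2) + (- 1 / 4) = 7 / 8 - n / 2" by (simp add: field_simps)
        finally show ?thesis .
      qed
      finally show ?thesis by (simp add: t_def distrib_right mult.commute)
    qed
    then have "\<kappa> * \<epsilon> powr ((1 - n) / 2) * \<epsilon> powr ((n - 1) / 2)
      \<le> ((D + C2 * C) * \<epsilon> powr (7 / 8 - n / 2) + 2 * E * C * \<epsilon> powr (- 1 / 4)) * \<epsilon> powr ((n - 1) / 2)"
      by (rule mult_right_mono) simp
    moreover have "\<epsilon> powr ((1 - n) / 2) * \<epsilon> powr ((n - 1) / 2) = 1"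
      using \<epsilon> by (simp flip: powr_add add_divide_distrib)
    moreover have "\<epsilon> powr (7 / 8 - n / 2) * \<epsilon> powr ((n - 1) / 2) = \<epsilon> powr (3 / 8)"
      "\<epsilon> powr (- 1 / 4) * \<epsilon> powr ((n - 1) / 2) = \<epsilon> powr (n / 2 - 3 / 4)"
      by (simp_all add: diff_divide_distrib flip: powr_add)
    ultimately show ?thesis by (simp only: distrib_right mult.assoc mult_1_right)
  qed
  have "((\<lambda>\<epsilon>. (D + C2 * C) * \<epsilon> powr (3 / 8) + 2 * E * C * \<epsilon> powr (n / 2 - 3 / 4)) \<longlongrightarrow>
      (D + C2 * C) * 0 + 2 * E * C * 0) (at_right 0)"
  proof (intro tendsto_add tendsto_mult tendsto_const)
    have *: "((\<lambda>\<epsilon>. \<epsilon> powr q) \<longlongrightarrow> 0) (at_right 0)" if "q > 0" for q :: real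
    proof -
      have "((\<lambda>\<epsilon>. \<epsilon> powr q) \<longlongrightarrow> 0 powr q) (at_right 0)"
        using that by (intro tendsto_powr') (auto intro!: tendsto_intros simp: eventually_at_right_less eventually_at_filter)
      then show ?thesis by simp
    qed
    show "((\<lambda>\<epsilon>. \<epsilon> powr (3 / 8)) \<longlongrightarrow> (0::real)) (at_right 0)" by (rule *) simp
    show "((\<lambda>\<epsilon>. \<epsilon> powr (n / 2 - 3 / 4)) \<longlongrightarrow> (0::real)) (at_right 0)" using n2 by (intro *) simp
  qed
  then have "eventually (\<lambda>\<epsilon>. (D + C2 * C) * \<epsilon> powr (3 / 8) + 2 * E * C * \<epsilon> powr (n / 2 - 3 / 4) < \<kappa>) (at_right 0)"
    using \<kappa> by (intro order_tendstoD) auto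
  moreover have "eventually (\<lambda>\<epsilon>::real. 0 < \<epsilon> \<and> \<epsilon> < r / 2) (at_right 0)"
    using r(1) by (auto simp: eventually_at_right_field intro!: exI[of _ "r / 2"])
  ultimately have "eventually (\<lambda>\<epsilon>::real. False) (at_right 0)"
    by eventually_elim (use main in force)
  then show False by simp
qed

section \<open>The converse implication\<close>

text \<open>Once \<open>u\<close> is known to solve the second problem, uniqueness there identifies
  it with \<open>v\<close> almost everywhere, and the integrands of the two fluxes agree almost
  everywhere.\<close>

lemma equal_coefficients_same_flux:
  fixes \<Omega> :: "(real^'n) set"
  assumes \<Omega>: "open \<Omega>" and glo: "glo < ghi"
    and coeff1: "coefficient_assumption \<Omega> C_A alo ahi a1 b1 c1"
    and coeff2: "coefficient_assumption \<Omega> C_A alo ahi a2 b2 c2"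
    and uniq1: "unique_bounded_solutions \<Omega> G glo ghi a1 b1 c1"
    and uniq2: "unique_bounded_solutions \<Omega> G glo ghi a2 b2 c2"
    and b: "\<And>x s. x \<in> \<Omega> \<Longrightarrow> b1 x s = b2 x s" and c: "\<And>x s p. x \<in> \<Omega> \<Longrightarrow> c1 x s p = c2 x s p"
    and a: "\<And>s. s \<in> {glo<..<ghi} \<Longrightarrow> a1 s = a2 s"
    and g: "g \<in> G" and u: "weak_solution \<Omega> a1 b1 c1 g u" and v: "weak_solution \<Omega> a2 b2 c2 g v"
  shows "same_flux_on \<Omega> \<Gamma> (neumann_flux \<Omega> a1 b1 c1 u) (neumann_flux \<Omega> a2 b2 c2 v)"
proof -
  let ?L = "lebesgue_on \<Omega>"
  note ac = coefficient_a_continuous[OF coeff1 \<Omega>] coefficient_a_continuous[OF coeff2 \<Omega>]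
  \<comment> \<open>Solutions may take the end values \<open>glo\<close> and \<open>ghi\<close>, so
    equality is extended to the closed interval by continuity.\<close>
  have a': "a1 s = a2 s" if "glo \<le> s" "s \<le> ghi" for s
  proof -
    have "closed {s. a1 s = a2 s}" using ac by (rule closed_Collect_eq)
    moreover have "{glo<..<ghi} \<subseteq> {s. a1 s = a2 s}" using a by auto
    ultimately have "closure {glo<..<ghi} \<subseteq> {s. a1 s = a2 s}" by (rule closure_minimal[rotated])
    then show ?thesis using that glo by (auto simp: closure_greaterThanLessThan)
  qed
  have bd: "AE x in ?L. a1 (u x) = a2 (u x)"
  proof -
    have "AE x in ?L. glo \<le> u x \<and> u x \<le> ghi"
      using uniq1 g u by (auto simp: unique_bounded_solutions_def)
    then show ?thesis by eventually_elim (use a' in blast)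
  qed
  have uH: "u \<in> H1 \<Omega>" and vH: "v \<in> H1 \<Omega>" using u v by (auto simp: weak_solution_def)
  note am [measurable] = borel_measurable_continuous_onI[OF ac(1)] borel_measurable_continuous_onI[OF ac(2)]
  have meas: "z \<in> borel_measurable ?L" "wgrad \<Omega> z \<in> borel_measurable ?L" if "z \<in> H1 \<Omega>" for z
    using that square_integrable_wgrad[OF \<Omega> that] by (auto simp: H1_def square_integrable_def)
  note um [measurable] = meas[OF uH] and vm [measurable] = meas[OF vH]
  note [measurable] = coefficient_b_measurable[OF coeff1 \<Omega> um(1)] coefficient_b_measurable[OF coeff2 \<Omega> um(1)]
    coefficient_c_measurable[OF coeff1 \<Omega> um] coefficient_c_measurable[OF coeff2 \<Omega> um]
    coefficient_b_measurable[OF coeff2 \<Omega> vm(1)] coefficient_c_measurable[OF coeff2 \<Omega> vm]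
  have "weak_solution \<Omega> a2 b2 c2 g u"
    unfolding weak_solution_def
  proof (intro conjI ballI)
    show "u \<in> H1 \<Omega>" "has_trace \<Omega> u g" using u by (auto simp: weak_solution_def)
    fix \<phi> assume \<phi>: "\<phi> \<in> H1_0 \<Omega>"
    then have \<phi>H: "\<phi> \<in> H1 \<Omega>" by (simp add: H1_0_def)
    note [measurable] = meas[OF \<phi>H]
    have i1: "(\<integral>x. (a1 (u x) *\<^sub>R wgrad \<Omega> u x + b1 x (u x)) \<bullet> wgrad \<Omega> \<phi> x \<partial>?L)
      = (\<integral>x. (a2 (u x) *\<^sub>R wgrad \<Omega> u x + b2 x (u x)) \<bullet> wgrad \<Omega> \<phi> x \<partial>?L)"
    proof (rule integral_cong_AE)
      show "AE x in ?L. (a1 (u x) *\<^sub>R wgrad \<Omega> u x + b1 x (u x)) \<bullet> wgrad \<Omega> \<phi> x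
        = (a2 (u x) *\<^sub>R wgrad \<Omega> u x + b2 x (u x)) \<bullet> wgrad \<Omega> \<phi> x"
        using bd AE_space by eventually_elim (simp add: b)
    qed measurable
    have i2: "(\<integral>x. c1 x (u x) (wgrad \<Omega> u x) * \<phi> x \<partial>?L) = (\<integral>x. c2 x (u x) (wgrad \<Omega> u x) * \<phi> x \<partial>?L)"
      by (intro Bochner_Integration.integral_cong) (auto simp: c)
    have "(\<integral>x. (a1 (u x) *\<^sub>R wgrad \<Omega> u x + b1 x (u x)) \<bullet> wgrad \<Omega> \<phi> x \<partial>?L)
      + (\<integral>x. c1 x (u x) (wgrad \<Omega> u x) * \<phi> x \<partial>?L) = 0"
      using u \<phi> unfolding weak_solution_def by blast
    then show "(\<integral>x. (a2 (u x) *\<^sub>R wgrad \<Omega> u x + b2 x (u x)) \<bullet> wgrad \<Omega> \<phi> x \<partial>?L)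
      + (\<integral>x. c2 x (u x) (wgrad \<Omega> u x) * \<phi> x \<partial>?L) = 0"
      unfolding i1 i2 .
  qed
  then have uv: "AE x in ?L. v x = u x"
    using uniq2 g v by (auto simp: unique_bounded_solutions_def)
  \<comment> \<open>Functions equal almost everywhere have literally the same chosen weak
    gradient.\<close>
  then have w: "wgrad \<Omega> v = wgrad \<Omega> u" by (rule wgrad_cong_AE[OF vH uH])
  have "neumann_flux \<Omega> a1 b1 c1 u \<phi> = neumann_flux \<Omega> a2 b2 c2 v \<phi>" if \<phi>: "\<phi> \<in> H1 \<Omega>" for \<phi>
    unfolding neumann_flux_def
  proof (rule integral_cong_AE)
    note [measurable] = meas[OF \<phi>]
    show "(\<lambda>x. a1 (u x) * (wgrad \<Omega> u x \<bullet> wgrad \<Omega> \<phi> x) + b1 x (u x) \<bullet> wgrad \<Omega> \<phi> x + c1 x (u x) (wgrad \<Omega> u x) * \<phi> x) \<in> borel_measurable ?L"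
      by measurable
    show "(\<lambda>x. a2 (v x) * (wgrad \<Omega> v x \<bullet> wgrad \<Omega> \<phi> x) + b2 x (v x) \<bullet> wgrad \<Omega> \<phi> x + c2 x (v x) (wgrad \<Omega> v x) * \<phi> x) \<in> borel_measurable ?L"
      by measurable
    show "AE x in ?L. a1 (u x) * (wgrad \<Omega> u x \<bullet> wgrad \<Omega> \<phi> x) + b1 x (u x) \<bullet> wgrad \<Omega> \<phi> x + c1 x (u x) (wgrad \<Omega> u x) * \<phi> x
      = a2 (v x) * (wgrad \<Omega> v x \<bullet> wgrad \<Omega> \<phi> x) + b2 x (v x) \<bullet> wgrad \<Omega> \<phi> x + c2 x (v x) (wgrad \<Omega> v x) * \<phi> x"
      using bd uv AE_space by eventually_elim (simp add: b c w)
  qed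
  then show ?thesis by (simp add: same_flux_on_def vanishes_on_def)
qed

lemma same_flux_on_sym:
  assumes "same_flux_on \<Omega> \<Gamma> j1 j2"
  shows "same_flux_on \<Omega> \<Gamma> j2 j1"
  unfolding same_flux_on_def vanishes_on_def
proof (intro allI impI)
  fix \<phi> t
  assume "\<phi> \<in> H1 \<Omega> \<and> has_trace \<Omega> \<phi> t \<and> (AE x in surface_measure \<Omega>. x \<notin> \<Gamma> \<longrightarrow> t x = 0)"
  then have "j1 \<phi> - j2 \<phi> = 0" using assms unfolding same_flux_on_def vanishes_on_def by blast
  then show "j2 \<phi> - j1 \<phi> = 0" by simp
qed

theorem theorem3:
  fixes \<Omega> \<Gamma>' :: "(real^'n) set" and xbar :: "real^'n" and N :: 'n
    and \<epsilon>0 glo ghi C_A C_G C_U alo ahi :: real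
    and a1 a2 :: "real \<Rightarrow> real"
    and b1 b2 :: "real^'n \<Rightarrow> real \<Rightarrow> real^'n"
    and c1 c2 :: "real^'n \<Rightarrow> real \<Rightarrow> real^'n \<Rightarrow> real"
    and u1 u2 :: "(real^'n \<Rightarrow> real) \<Rightarrow> (real^'n \<Rightarrow> real)"
    and \<Gamma>M :: "(real^'n) set"
    and G :: "(real^'n \<Rightarrow> real) set"
    and j1 j2 :: "(real^'n \<Rightarrow> real) \<Rightarrow> (real^'n \<Rightarrow> real) \<Rightarrow> real"
  assumes dim: "CARD('n) \<in> {2, 3}"
    and constants: "glo < ghi" "C_A > 0" "C_G > 0" "alo > 0" "ahi > 0"
    and geometry: "geometric_assumption \<Omega> \<Gamma>' xbar \<epsilon>0 (axis N 1)"
    and \<Gamma>M: "\<Gamma>M = ball xbar \<epsilon>0 \<inter> frontier \<Omega>"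
    and C_G: "large_enough \<Omega> xbar \<epsilon>0 glo ghi C_G"
    and G: "G = dirichlet_data \<Omega> glo ghi C_G"
    and coeff1: "coefficient_assumption \<Omega> C_A alo ahi a1 b1 c1"
    and coeff2: "coefficient_assumption \<Omega> C_A alo ahi a2 b2 c2"
    and solv1: "solvability_assumption \<Omega> G C_U a1 b1 c1"
    and solv2: "solvability_assumption \<Omega> G C_U a2 b2 c2"
    and u1: "\<And>g. g \<in> G \<Longrightarrow> weak_solution \<Omega> a1 b1 c1 g (u1 g)"
    and u2: "\<And>g. g \<in> G \<Longrightarrow> weak_solution \<Omega> a2 b2 c2 g (u2 g)"
    and j1: "\<And>g. j1 g = neumann_flux \<Omega> a1 b1 c1 (u1 g)"
    and j2: "\<And>g. j2 g = neumann_flux \<Omega> a2 b2 c2 (u2 g)"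
  shows "((\<exists>s\<in>{glo<..<ghi}. a1 s \<noteq> a2 s) \<longrightarrow> (\<exists>g\<in>G. \<not> same_flux_on \<Omega> \<Gamma>M (j1 g) (j2 g)))
    \<and> (unique_bounded_solutions \<Omega> G glo ghi a1 b1 c1
        \<and> unique_bounded_solutions \<Omega> G glo ghi a2 b2 c2
        \<and> (\<forall>x\<in>\<Omega>. \<forall>s. b1 x s = b2 x s) \<and> (\<forall>x\<in>\<Omega>. \<forall>s p. c1 x s p = c2 x s p)
      \<longrightarrow> ((\<exists>g\<in>G. \<not> same_flux_on \<Omega> \<Gamma>M (j1 g) (j2 g)) \<longrightarrow> (\<exists>s\<in>{glo<..<ghi}. a1 s \<noteq> a2 s)))"
proof (intro conjI impI)
  assume "\<exists>s\<in>{glo<..<ghi}. a1 s \<noteq> a2 s"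
  then obtain s where s: "glo < s" "s < ghi" "a2 s < a1 s \<or> a1 s < a2 s"
    by (auto simp: neq_iff)
  note common = dim constants(1,2,4) geometry \<Gamma>M C_G G
  from s(3) show "\<exists>g\<in>G. \<not> same_flux_on \<Omega> \<Gamma>M (j1 g) (j2 g)"
  proof
    assume "a2 s < a1 s"
    then show ?thesis
      unfolding j1 j2
      by (intro nonidentical_imp_flux_differs[OF common coeff1 coeff2 solv1 solv2 u1 u2 s(1,2)])
  next
    \<comment> \<open>The same lemma with the two problems exchanged; agreement of fluxes is a
      symmetric relation.\<close>
    assume "a1 s < a2 s"
    then have "\<exists>g\<in>G. \<not> same_flux_on \<Omega> \<Gamma>M (j2 g) (j1 g)"
      unfolding j1 j2
      by (intro nonidentical_imp_flux_differs[OF common coeff2 coeff1 solv2 solv1 u2 u1 s(1,2)])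
    then show ?thesis using same_flux_on_sym by blast
  qed
next
  assume *: "unique_bounded_solutions \<Omega> G glo ghi a1 b1 c1
        \<and> unique_bounded_solutions \<Omega> G glo ghi a2 b2 c2
        \<and> (\<forall>x\<in>\<Omega>. \<forall>s. b1 x s = b2 x s) \<and> (\<forall>x\<in>\<Omega>. \<forall>s p. c1 x s p = c2 x s p)"
    and "\<exists>g\<in>G. \<not> same_flux_on \<Omega> \<Gamma>M (j1 g) (j2 g)"
  then obtain g where g: "g \<in> G" "\<not> same_flux_on \<Omega> \<Gamma>M (j1 g) (j2 g)" by blast
  have \<Omega>: "open \<Omega>" using geometry by (simp add: geometric_assumption_def bounded_lipschitz_domain_def)
  show "\<exists>s\<in>{glo<..<ghi}. a1 s \<noteq> a2 s"
  proof (rule ccontr)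
    assume "\<not> ?thesis"
    then have "same_flux_on \<Omega> \<Gamma>M (j1 g) (j2 g)"
      unfolding j1 j2 using *
      by (intro equal_coefficients_same_flux[OF \<Omega> constants(1) coeff1 coeff2 _ _ _ _ _ g(1) u1[OF g(1)] u2[OF g(1)]]) auto
    then show False using g(2) by simp
  qed
qed

end
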